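(* Let $X=\mathcal A^{\mathbb N}$ and $Y=\mathcal D^{\mathbb N}$ be two full shifts over finite alphabets, with left shifts $T$ and $S$, let $\pi:X\to Y$ be a one-block factor map, let $\mathbf a=(a,b)\in\mathbb R^2$ with $a>0$ and $b\ge0$, and endow $X$ with the metric $d_{\mathbf a}$. Let $\mu\in\mathcal M(X,T)$. Then $\mathcal G(\mu)\ne\emptyset$ and $$\dim_H\mathcal G(\mu)=a h_\mu(T)+b h_{\mu\circ\pi^{-1}}(S).$$
   Context: A one-block factor map $\pi:X\to Y$ is a continuous surjection with $\pi T=S\pi$ induced letter by letter by a map $\mathcal A\to\mathcal D$. $\mathcal M(X,T)$ is the set of $T$-invariant Borel probability measures; $h_\mu(T)$ is measure-theoretic entropy. The metric is $d_{\mathbf a}(x,y)=\max\big(e^{-|x\wedge y|/a},\,e^{-|\pi x\wedge\pi y|/(a+b)}\big)$, where $|x\wedge y|=\inf\{k\ge1:x_k\ne y_k\}-1$ and similarly for $|\pi x\wedge\pi y|$ ($\inf\emptyset=\infty$, $e^{-\infty}=0$). $\dim_H$ is Hausdorff dimension with respect to $d_{\mathbf a}$. The set of generic points of $\mu$ is $\mathcal G(\mu)=\{x\in X:\lim_{n\to\infty}\frac1nS_ng(x)=\int g\,d\mu\ \ \forall g\in C(X)\}$, where $C(X)$ is the set of real continuous functions on $X$ and $S_ng(x)=\sum_{i=0}^{n-1}g(T^ix)$. *)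

theory Defs
  imports "HOL-Probability.Probability" "HOL-Real_Asymp.Real_Asymp"
begin

section \<open>Full shifts\<close>

text \<open>
  The one-sided full shift over a finite alphabet is the type \<open>nat \<Rightarrow> 'a\<close> with
  \<open>'a :: finite\<close>.  Coordinates start at \<open>0\<close>, so the letter written \<open>x\<^sub>k\<close> (\<open>k \<ge> 1\<close>)
  in the usual indexing is \<open>x (k - 1)\<close>.  The alphabet carries the discrete topology whether or
  not the type \<open>'a\<close> has some other topology attached to it.
\<close>

definition left_shift :: "(nat \<Rightarrow> 'a) \<Rightarrow> nat \<Rightarrow> 'a" where
  "left_shift x = (\<lambda>n. x (Suc n))"

definition shift_topology :: "(nat \<Rightarrow> 'a) topology" where
  "shift_topology = product_topology (\<lambda>_. discrete_topology UNIV) UNIV"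

definition shift_borel :: "(nat \<Rightarrow> 'a) measure" where
  "shift_borel = sigma UNIV {U. openin shift_topology U}"

definition one_block_factor_map :: "((nat \<Rightarrow> 'a) \<Rightarrow> nat \<Rightarrow> 'd) \<Rightarrow> bool" where
  "one_block_factor_map \<pi> \<longleftrightarrow>
     continuous_map shift_topology shift_topology \<pi> \<and> surj \<pi> \<and> \<pi> \<circ> left_shift = left_shift \<circ> \<pi> \<and>
     (\<exists>p. \<forall>x n. \<pi> x n = p (x n))"

definition invariant_measures :: "(nat \<Rightarrow> 'a) measure set" where
  "invariant_measures =
     {\<mu>. prob_space \<mu> \<and> sets \<mu> = sets shift_borel \<and> distr \<mu> shift_borel left_shift = \<mu>}"

definition generic_points :: "(nat \<Rightarrow> 'a) measure \<Rightarrow> (nat \<Rightarrow> 'a) set" where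
  "generic_points \<mu> =
     {x. \<forall>g. continuous_map shift_topology euclideanreal g \<longrightarrow>
          (\<lambda>n. (\<Sum>i<n. g ((left_shift ^^ i) x)) / real n) \<longlonglongrightarrow> (\<integral>y. g y \<partial>\<mu>)}"


section \<open>The weighted metric\<close>

text \<open>
  With coordinates starting at \<open>0\<close>, the subtraction of \<open>1\<close> in
  \<open>|x \<and> y| = inf {k \<ge> 1. x\<^sub>k \<noteq> y\<^sub>k} - 1\<close> is absorbed by the indexing.
  In \<^typ>\<open>enat\<close> the infimum of the empty set is \<open>\<infinity>\<close>.
\<close>

definition common_prefix :: "(nat \<Rightarrow> 'a) \<Rightarrow> (nat \<Rightarrow> 'a) \<Rightarrow> enat" where
  "common_prefix x y = Inf (enat ` {k. x k \<noteq> y k})"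

definition exp_minus :: "enat \<Rightarrow> real \<Rightarrow> real" where
  "exp_minus n c = (case n of enat k \<Rightarrow> exp (- real k / c) | \<infinity> \<Rightarrow> 0)"

definition weighted_dist ::
    "((nat \<Rightarrow> 'a) \<Rightarrow> nat \<Rightarrow> 'd) \<Rightarrow> real \<Rightarrow> real \<Rightarrow> (nat \<Rightarrow> 'a) \<Rightarrow> (nat \<Rightarrow> 'a) \<Rightarrow> real" where
  "weighted_dist \<pi> a b x y =
     max (exp_minus (common_prefix x y) a) (exp_minus (common_prefix (\<pi> x) (\<pi> y)) (a + b))"


section \<open>Hausdorff dimension with respect to a distance function\<close>

definition ediam :: "('x \<Rightarrow> 'x \<Rightarrow> real) \<Rightarrow> 'x set \<Rightarrow> ennreal" where
  "ediam d U = (SUP x\<in>U. SUP y\<in>U. ennreal (d x y))"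

text \<open>
  The gauge \<open>(diam U)\<^sup>s\<close>, with the usual conventions at \<open>s = 0\<close>: it is \<open>1\<close> for nonempty
  \<open>U\<close> (whereas \<open>0 powr 0 = 0\<close>) and \<open>0\<close> for \<open>U = {}\<close>.  It is only used for sets of finite
  diameter.
\<close>

definition diam_power :: "('x \<Rightarrow> 'x \<Rightarrow> real) \<Rightarrow> real \<Rightarrow> 'x set \<Rightarrow> ennreal" where
  "diam_power d s U =
     (if U = {} then 0 else if s = 0 then 1 else ennreal (enn2real (ediam d U) powr s))"

definition hausdorff_content ::
    "('x \<Rightarrow> 'x \<Rightarrow> real) \<Rightarrow> real \<Rightarrow> real \<Rightarrow> 'x set \<Rightarrow> ennreal" where
  "hausdorff_content d s \<delta> E =
     (INF U\<in>{U :: nat \<Rightarrow> 'x set. E \<subseteq> (\<Union>i. U i) \<and> (\<forall>i. ediam d (U i) \<le> ennreal \<delta>)}.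
        \<Sum>i. diam_power d s (U i))"

definition hausdorff_measure :: "('x \<Rightarrow> 'x \<Rightarrow> real) \<Rightarrow> real \<Rightarrow> 'x set \<Rightarrow> ennreal" where
  "hausdorff_measure d s E = (SUP \<delta>\<in>{0<..}. hausdorff_content d s \<delta> E)"

definition hausdorff_dim :: "('x \<Rightarrow> 'x \<Rightarrow> real) \<Rightarrow> 'x set \<Rightarrow> ereal" where
  "hausdorff_dim d E = Inf {ereal s | s. s \<ge> 0 \<and> hausdorff_measure d s E = 0}"


section \<open>Measure-theoretic entropy\<close>

definition finite_measurable_partition :: "'x measure \<Rightarrow> 'x set set \<Rightarrow> bool" where
  "finite_measurable_partition M P \<longleftrightarrow> finite P \<and> P \<subseteq> sets M \<and> partition_on (space M) P"

text \<open>Natural logarithm, as in the base \<open>e\<close> of the metric; null atoms contribute \<open>0 * ln 0 = 0\<close>.\<close>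

definition partition_entropy :: "'x measure \<Rightarrow> 'x set set \<Rightarrow> real" where
  "partition_entropy M P = - (\<Sum>A\<in>P. measure M A * ln (measure M A))"

text \<open>The join of the partitions \<open>T\<^sup>-\<^sup>i P\<close> for \<open>i < n\<close>.\<close>

definition iterated_join ::
    "'x measure \<Rightarrow> ('x \<Rightarrow> 'x) \<Rightarrow> 'x set set \<Rightarrow> nat \<Rightarrow> 'x set set" where
  "iterated_join M T P n =
     {{x \<in> space M. \<forall>i<n. (T ^^ i) x \<in> A i} | A. \<forall>i<n. A i \<in> P} - {{}}"

definition entropy_wrt_partition :: "'x measure \<Rightarrow> ('x \<Rightarrow> 'x) \<Rightarrow> 'x set set \<Rightarrow> ereal" where
  "entropy_wrt_partition M T P =
     lim (\<lambda>n. ereal (partition_entropy M (iterated_join M T P n) / real n))"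

definition measure_entropy :: "'x measure \<Rightarrow> ('x \<Rightarrow> 'x) \<Rightarrow> ereal" where
  "measure_entropy M T =
     (SUP P\<in>{P. finite_measurable_partition M P}. entropy_wrt_partition M T P)"


section \<open>Compatibility of the definitions\<close>

lemma topspace_shift_topology [simp]: "topspace shift_topology = UNIV"
  by (simp add: shift_topology_def)

lemma space_shift_borel [simp]: "space shift_borel = UNIV"
  by (simp add: shift_borel_def space_measure_of_conv)

lemma sets_shift_borel: "sets shift_borel = sigma_sets UNIV {U. openin shift_topology U}"
  by (simp add: shift_borel_def sets_measure_of_conv)

lemma common_prefix_ge_iff: "enat n \<le> common_prefix x y \<longleftrightarrow> (\<forall>k<n. x k = y k)"
  unfolding common_prefix_def le_Inf_iff by (auto simp: not_le[symmetric])

lemma common_prefix_ultrametric: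
  "min (common_prefix x y) (common_prefix y z) \<le> common_prefix x z"
proof (rule ccontr)
  assume "\<not> ?thesis"
  then obtain n where n: "common_prefix x z = enat n"
    by (cases "common_prefix x z") auto
  with \<open>\<not> ?thesis\<close> have "enat (Suc n) \<le> common_prefix x y" "enat (Suc n) \<le> common_prefix y z"
    by (auto simp: Suc_ile_eq not_le)
  then have "enat (Suc n) \<le> common_prefix x z"
    by (simp add: common_prefix_ge_iff)
  with n show False by simp
qed

lemma common_prefix_commute: "common_prefix x y = common_prefix y x"
  by (simp add: common_prefix_def eq_commute)

lemma common_prefix_infinity_iff: "common_prefix x y = \<infinity> \<longleftrightarrow> x = y"
proof
  assume "common_prefix x y = \<infinity>"
  then have "\<forall>k<n. x k = y k" for n
    by (simp flip: common_prefix_ge_iff)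
  then show "x = y" by auto
qed (simp add: common_prefix_def top_enat_def)

lemma exp_minus_nonneg [simp]: "0 \<le> exp_minus n c"
  by (auto simp: exp_minus_def split: enat.split)

lemma exp_minus_eq_0_iff [simp]: "exp_minus n c = 0 \<longleftrightarrow> n = \<infinity>"
  by (auto simp: exp_minus_def split: enat.split)

lemma exp_minus_antimono:
  assumes "c > 0" "m \<le> n" shows "exp_minus n c \<le> exp_minus m c"
  using assms by (cases m; cases n) (auto simp: exp_minus_def divide_right_mono)

lemma exp_minus_triangle:
  assumes "c > 0"
  shows "exp_minus (common_prefix x z) c
           \<le> exp_minus (common_prefix x y) c + exp_minus (common_prefix y z) c"
proof -
  have "exp_minus (common_prefix x z) c
          \<le> exp_minus (min (common_prefix x y) (common_prefix y z)) c"
    using assms common_prefix_ultrametric by (rule exp_minus_antimono)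
  also have "\<dots> \<le> exp_minus (common_prefix x y) c + exp_minus (common_prefix y z) c"
    by (simp add: min_def)
  finally show ?thesis .
qed

lemma Metric_space_weighted_dist:
  assumes "a > 0" "b \<ge> 0"
  shows "Metric_space UNIV (weighted_dist \<pi> a b)"
proof
  fix x y z
  show "0 \<le> weighted_dist \<pi> a b x y"
    by (simp add: weighted_dist_def le_max_iff_disj)
  show "weighted_dist \<pi> a b x y = weighted_dist \<pi> a b y x"
    by (simp add: weighted_dist_def common_prefix_commute)
  have "exp_minus (common_prefix x y) a = 0 \<longleftrightarrow> x = y"
    by (simp add: common_prefix_infinity_iff)
  moreover have "exp_minus (common_prefix (\<pi> x) (\<pi> y)) (a + b) = 0" if "x = y"
    using that common_prefix_infinity_iff by auto
  ultimately show "weighted_dist \<pi> a b x y = 0 \<longleftrightarrow> x = y"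
    using exp_minus_nonneg[of "common_prefix x y" a] exp_minus_nonneg[of "common_prefix (\<pi> x) (\<pi> y)" "a+b"]
    unfolding weighted_dist_def by (smt (verit))
  show "weighted_dist \<pi> a b x z \<le> weighted_dist \<pi> a b x y + weighted_dist \<pi> a b y z"
    using exp_minus_triangle[of a x z y] exp_minus_triangle[of "a + b" "\<pi> x" "\<pi> z" "\<pi> y"] assms
    unfolding weighted_dist_def by (smt (verit))
qed

text \<open>
  The weighted metric induces the product topology, so the Borel sets and the continuous
  functions used above are those of the metric space.
\<close>

lemma mtopology_weighted_dist:
  fixes \<pi> :: "(nat \<Rightarrow> 'a) \<Rightarrow> nat \<Rightarrow> 'd"
  assumes ab: "a > 0" "b \<ge> 0" and \<pi>: "one_block_factor_map \<pi>"
  shows "Metric_space.mtopology UNIV (weighted_dist \<pi> a b) = shift_topology"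
proof -
  interpret Metric_space UNIV "weighted_dist \<pi> a b"
    using ab by (rule Metric_space_weighted_dist)
  obtain p where p: "\<And>x n. \<pi> x n = p (x n)"
    using \<pi> by (auto simp: one_block_factor_map_def)
  have cyl_open: "openin shift_topology {y. \<forall>k<n. y k = x k}" for n and x :: "nat \<Rightarrow> 'a"
  proof -
    have "openin shift_topology (Pi\<^sub>E UNIV (\<lambda>k. if k < n then {x k} else UNIV))"
      unfolding shift_topology_def openin_PiE_gen
      by (rule disjI2) (auto intro: finite_subset[of _ "{..<n}"] split: if_splits)
    also have "Pi\<^sub>E UNIV (\<lambda>k. if k < n then {x k} else UNIV) = {y. \<forall>k<n. y k = x k}"
      by (auto simp: PiE_UNIV_domain Pi_iff split: if_splits)
    finally show ?thesis .
  qed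
  show ?thesis
  proof (rule topology_eq[THEN iffD2], intro allI iffI)
    fix U :: "(nat \<Rightarrow> 'a) set" assume U: "openin mtopology U"
    show "openin shift_topology U"
    proof (subst openin_subopen, intro ballI)
      fix x assume "x \<in> U"
      then obtain r where r: "r > 0" "mball x r \<subseteq> U"
        using U by (auto simp: openin_mtopology)
      have "((\<lambda>n. exp (- real n / (a + b))) \<longlongrightarrow> 0) sequentially"
        using ab by real_asymp
      then obtain n where n: "exp (- real n / (a + b)) < r"
        using r(1) by (metis (no_types, lifting) eventually_sequentially order_tendstoD(2) order_refl)
      have "y \<in> mball x r" if y: "\<forall>k<n. y k = x k" for y
      proof -
        have "enat n \<le> common_prefix x y" "enat n \<le> common_prefix (\<pi> x) (\<pi> y)"
          using y p by (auto simp: common_prefix_ge_iff)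
        then have "exp_minus (common_prefix x y) a \<le> exp_minus (enat n) a"
          "exp_minus (common_prefix (\<pi> x) (\<pi> y)) (a + b) \<le> exp_minus (enat n) (a + b)"
          using ab by (auto intro!: exp_minus_antimono)
        moreover have "exp_minus (enat n) a \<le> exp_minus (enat n) (a + b)"
          using ab by (auto simp: exp_minus_def intro!: divide_left_mono mult_pos_pos)
        ultimately have "weighted_dist \<pi> a b x y \<le> exp_minus (enat n) (a + b)"
          by (simp add: weighted_dist_def)
        then have "weighted_dist \<pi> a b x y \<le> exp (- real n / (a + b))"
          by (simp add: exp_minus_def)
        with n show ?thesis by simp
      qed
      with r have "{y. \<forall>k<n. y k = x k} \<subseteq> U" by blast
      then show "\<exists>T. openin shift_topology T \<and> x \<in> T \<and> T \<subseteq> U"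
        using cyl_open by (intro exI[of _ "{y. \<forall>k<n. y k = x k}"]) auto
    qed
  next
    fix U :: "(nat \<Rightarrow> 'a) set" assume U: "openin shift_topology U"
    have "\<exists>r>0. mball x r \<subseteq> U" if xU: "x \<in> U" for x
    proof -
      obtain V where V: "x \<in> Pi\<^sub>E UNIV V" "finite {i. V i \<noteq> UNIV}" "Pi\<^sub>E UNIV V \<subseteq> U"
        using product_topology_open_contains_basis[OF U[unfolded shift_topology_def] xU] by auto
      obtain n where n: "\<And>i. V i \<noteq> UNIV \<Longrightarrow> i < n"
        using finite_nat_bounded[OF V(2)] by auto
      have "y \<in> U" if y: "y \<in> mball x (exp (- real n / a))" for y
      proof -
        have "exp_minus (common_prefix x y) a < exp_minus (enat n) a"
          using y by (simp add: weighted_dist_def exp_minus_def)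
        then have "enat n \<le> common_prefix x y"
          using exp_minus_antimono[OF ab(1), of "common_prefix x y" "enat n"] by (meson leD linear)
        then have "\<forall>k<n. x k = y k"
          by (simp add: common_prefix_ge_iff)
        then have "y k \<in> V k" for k
          using V(1) n[of k] by (cases "k < n") (auto simp: PiE_UNIV_domain Pi_iff, metis)
        then show ?thesis using V(3) by (auto simp: PiE_UNIV_domain)
      qed
      then show ?thesis by (intro exI[of _ "exp (- real n / a)"]) auto
    qed
    then show "openin mtopology U" by (auto simp: openin_mtopology)
  qed
qed

end

theory Submission
  imports Defs
begin

text \<open>
  Let \<open>h\<close> and \<open>h'\<close> be the entropies of \<open>\<mu>\<close> and of its image. Upper bound: for a generic point the logarithm of a Markov weight of a word is a Birkhoff sum of a
  continuous function. A ball of radius \<open>exp (- n / a)\<close> prescribes the first \<open>n\<close> letters of a point and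
  the first \<open>n (a + b) / a\<close> letters of its image. Weighting the letters of the point up to \<open>n\<close> with a
  Markov approximation of \<open>\<mu>\<close> and the remaining letters of the image with one of \<open>\<mu> \<circ> \<pi>\<^sup>-\<^sup>1\<close>, the weights
  of all balls have a bounded sum, while those of the balls that meet the generic points are not
  much smaller than \<open>exp (- n (a h + b h') / a)\<close>; this bounds the number of balls needed.

  Lower bound: concatenate independent blocks of lengths \<open>1, 2, 3, \<dots>\<close>, each distributed according to
  the corresponding marginal of \<open>\<mu>\<close>. A strong law of large numbers for the blocks shows that almost every
  concatenation is generic, whether or not \<open>\<mu>\<close> is ergodic, and that the ball of radius \<open>exp (- n / a)\<close>
  around it has probability about \<open>exp (- n (a h + b h') / a)\<close>, so that the mass distribution principle
  applies.
\<close>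

section \<open>Words and the topology of the full shift\<close>

text \<open>If \<open>\<mu>\<close> is not ergodic, its generic points form a
  \<open>\<mu>\<close>-null set and the information per letter need not converge to a constant. So
  \<open>\<mu>\<close> itself cannot serve as mass distribution, and pointwise entropy theorems do
  not give the value. Genericity controls averages of continuous functions only; this is why the
  upper bound uses weights with finite memory, kept strictly positive so that their logarithms are
  continuous. After the first n letters of a point, a ball of radius exp (- n / a) prescribes only
  about n b / a further image letters, hence the exponent n h + (n b / a) h'. Linear growth of the
  block lengths serves three purposes. Blocks become long, so that their entropy per letter tends to
  h and few windows cross a boundary. The block being cut at position n has O(sqrt n) letters and is
  negligible. Finally, J blocks have about J^2 / 2 letters while their squared lengths sum only to
  order J^3, so that deviations proportional to J^2 have probability exponentially small in
  J.\<close>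

definition word :: "nat \<Rightarrow> (nat \<Rightarrow> 'a) \<Rightarrow> 'a list" where
  "word n x = map x [0..<n]"

text \<open>Selects one point of each cylinder, so that functions of points can be evaluated on
  words; the filler letter is arbitrary.\<close>

definition extend :: "'a list \<Rightarrow> nat \<Rightarrow> 'a" where
  "extend w = (\<lambda>i. if i < length w then w ! i else undefined)"

lemma length_word [simp]: "length (word n x) = n"
  by (simp add: word_def)

lemma nth_word [simp]: "i < n \<Longrightarrow> word n x ! i = x i"
  by (simp add: word_def)

lemma word_0 [simp]: "word 0 x = []"
  by (simp add: word_def)

lemma word_Suc: "word (Suc n) x = word n x @ [x n]"
  by (simp add: word_def)

lemma word_eq_iff: "word n x = word n y \<longleftrightarrow> (\<forall>i<n. x i = y i)"
  by (auto simp: word_def)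

lemma word_eq_mono: "word n x = word n y \<Longrightarrow> m \<le> n \<Longrightarrow> word m x = word m y"
  by (simp add: word_eq_iff)

lemma word_extend [simp]: "word (length w) (extend w) = w"
  by (rule nth_equalityI) (simp_all add: extend_def)

lemma word_extend_word [simp]: "word n (extend (word n x)) = word n x"
  by (metis length_word word_extend)

lemma finite_words [simp]: "finite {w :: 'a::finite list. length w = n}"
  using finite_lists_length_eq[of "UNIV :: 'a set" n] by simp

lemma card_words: "card {w :: 'a::finite list. length w = n} = CARD('a) ^ n"
  using card_lists_length_eq[of "UNIV :: 'a set" n] by simp

lemma sum_words_Suc:
  fixes f :: "'a::finite list \<Rightarrow> 'b::comm_monoid_add"
  shows "(\<Sum>w | length w = Suc n. f w) = (\<Sum>w | length w = n. \<Sum>s\<in>UNIV. f (w @ [s]))"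
proof -
  have "(\<Sum>w | length w = n. \<Sum>s\<in>UNIV. f (w @ [s]))
      = (\<Sum>(w, s)\<in>{w. length w = n} \<times> UNIV. f (w @ [s]))"
    by (simp add: sum.cartesian_product)
  also have "\<dots> = (\<Sum>w | length w = Suc n. f w)"
    by (rule sum.reindex_bij_witness[of _ "\<lambda>w. (butlast w, last w)" "\<lambda>(w, s). w @ [s]"])
       (auto, metis append_butlast_last_id list.size(3) nat.distinct(1))
  finally show ?thesis ..
qed

lemma left_shift_funpow [simp]: "(left_shift ^^ i) x k = x (k + i)"
  by (induction i arbitrary: x) (simp_all add: left_shift_def funpow_swap1)

text \<open>A basic open set constrains finitely many coordinates, all of which lie in some initial
  segment. The topological arguments below use this description by cylinders.\<close>

lemma openin_shift_topology_iff:
  "openin shift_topology U \<longleftrightarrow> (\<forall>x\<in>U. \<exists>n. \<forall>y. word n y = word n x \<longrightarrow> y \<in> U)"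
proof
  assume U: "openin shift_topology U"
  show "\<forall>x\<in>U. \<exists>n. \<forall>y. word n y = word n x \<longrightarrow> y \<in> U"
  proof
    fix x assume xU: "x \<in> U"
    obtain V where V: "x \<in> Pi\<^sub>E UNIV V" "finite {i. V i \<noteq> UNIV}" "Pi\<^sub>E UNIV V \<subseteq> U"
      using product_topology_open_contains_basis[OF U[unfolded shift_topology_def] xU] by auto
    obtain n where n: "\<And>i. V i \<noteq> UNIV \<Longrightarrow> i < n"
      using finite_nat_bounded[OF V(2)] by auto
    have "y \<in> U" if y: "word n y = word n x" for y
    proof -
      have "y k \<in> V k" for k
        using V(1) n[of k] y
        by (cases "k < n") (auto simp: PiE_UNIV_domain Pi_iff word_eq_iff)
      then show ?thesis using V(3) by (auto simp: PiE_UNIV_domain)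
    qed
    then show "\<exists>n. \<forall>y. word n y = word n x \<longrightarrow> y \<in> U" by blast
  qed
next
  assume *: "\<forall>x\<in>U. \<exists>n. \<forall>y. word n y = word n x \<longrightarrow> y \<in> U"
  show "openin shift_topology U"
  proof (subst openin_subopen, intro ballI)
    fix x assume "x \<in> U"
    then obtain n where n: "\<And>y. word n y = word n x \<Longrightarrow> y \<in> U" using * by blast
    have "openin shift_topology (Pi\<^sub>E UNIV (\<lambda>k. if k < n then {x k} else UNIV))"
      unfolding shift_topology_def openin_PiE_gen
      by (rule disjI2) (auto intro: finite_subset[of _ "{..<n}"] split: if_splits)
    also have "Pi\<^sub>E UNIV (\<lambda>k. if k < n then {x k} else UNIV) = {y. word n y = word n x}"
      by (auto simp: PiE_UNIV_domain Pi_iff word_eq_iff split: if_splits)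
    finally show "\<exists>T. openin shift_topology T \<and> x \<in> T \<and> T \<subseteq> U"
      using n by blast
  qed
qed

lemma openin_finite_coordinates:
  assumes "\<And>x y. word n x = word n y \<Longrightarrow> x \<in> U \<longleftrightarrow> y \<in> U"
  shows "openin shift_topology U"
  unfolding openin_shift_topology_iff using assms by blast

lemma continuous_map_finite_coordinates:
  assumes "\<And>x y. word n x = word n y \<Longrightarrow> f x = f y"
  shows "continuous_map shift_topology euclideanreal f"
proof -
  have "openin shift_topology {x. f x \<in> U}" for U
    by (rule openin_finite_coordinates[of n]) (metis assms mem_Collect_eq)
  then show ?thesis by (auto simp: continuous_map_def)
qed

lemma compact_space_shift_topology:
  "compact_space (shift_topology :: (nat \<Rightarrow> 'a::finite) topology)"
  by (simp add: shift_topology_def compact_space_product_topology compact_space_discrete_topology)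

text \<open>By compactness finitely many cylinders, on each of which \<open>g\<close> stays within
  \<open>e / 2\<close> of its value at a centre, cover the space. Words of the maximal length
  \<open>N\<close> occurring among them determine membership in each.\<close>

lemma uniformly_continuous_shift:
  fixes g :: "(nat \<Rightarrow> 'a::finite) \<Rightarrow> real"
  assumes g: "continuous_map shift_topology euclideanreal g" and e: "e > 0"
  shows "\<exists>n. \<forall>x y. word n x = word n y \<longrightarrow> \<bar>g x - g y\<bar> < e"
proof -
  have "\<exists>n. \<forall>y. word n y = word n x \<longrightarrow> \<bar>g y - g x\<bar> < e / 2" for x
  proof -
    have "openin shift_topology {y \<in> topspace shift_topology. g y \<in> {g x - e/2<..<g x + e/2}}"
      using g by (rule openin_continuous_map_preimage) auto
    then have "\<forall>z\<in>{y. g y \<in> {g x - e/2<..<g x + e/2}}. \<exists>n. \<forall>y. word n y = word n z \<longrightarrow>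
        y \<in> {y. g y \<in> {g x - e/2<..<g x + e/2}}"
      unfolding openin_shift_topology_iff by simp
    moreover have "x \<in> {y. g y \<in> {g x - e/2<..<g x + e/2}}" using e by simp
    ultimately obtain n where
      n: "\<And>y. word n y = word n x \<Longrightarrow> y \<in> {y. g y \<in> {g x - e/2<..<g x + e/2}}"
      by blast
    have "\<bar>g y - g x\<bar> < e / 2" if "word n y = word n x" for y
      using n[OF that] unfolding mem_Collect_eq greaterThanLessThan_iff by linarith
    then show ?thesis by blast
  qed
  then obtain n where n: "\<And>x y. word (n x) y = word (n x) x \<Longrightarrow> \<bar>g y - g x\<bar> < e / 2"
    by metis
  define C where "C x = {y. word (n x) y = word (n x) x}" for x
  have "openin shift_topology (C x)" for x
    unfolding C_def by (rule openin_finite_coordinates[of "n x"]) auto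
  moreover have "UNIV \<subseteq> \<Union>(range C)" by (auto simp: C_def)
  ultimately obtain \<F> where "finite \<F>" "\<F> \<subseteq> range C" "UNIV \<subseteq> \<Union>\<F>"
    using compactinD[OF compact_space_shift_topology[unfolded compact_space_def topspace_shift_topology],
        of "range C"] by blast
  then obtain F where F: "finite F" "UNIV \<subseteq> (\<Union>x\<in>F. C x)"
    using finite_subset_image[of \<F> C UNIV] by blast
  define N where "N = Max (n ` F)"
  have "\<bar>g y - g z\<bar> < e" if yz: "word N y = word N z" for y z
  proof -
    obtain x where x: "x \<in> F" "y \<in> C x" using F by blast
    then have "n x \<le> N" using F by (simp add: N_def)
    then have "z \<in> C x" using x yz word_eq_mono[of N y z "n x"] by (simp add: C_def)
    then have "\<bar>g y - g x\<bar> < e / 2" "\<bar>g z - g x\<bar> < e / 2"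
      using x n by (auto simp: C_def)
    then show ?thesis by arith
  qed
  then show ?thesis by blast
qed

lemma continuous_bounded_shift:
  fixes g :: "(nat \<Rightarrow> 'a::finite) \<Rightarrow> real"
  assumes g: "continuous_map shift_topology euclideanreal g"
  shows "\<exists>B. \<forall>x. \<bar>g x\<bar> \<le> B"
proof -
  obtain n where n: "\<And>x y. word n x = word n y \<Longrightarrow> \<bar>g x - g y\<bar> < 1"
    using uniformly_continuous_shift[OF g, of 1] by auto
  define B where "B = Max ((\<lambda>w. \<bar>g (extend w)\<bar>) ` {w. length w = n}) + 1"
  have "\<bar>g x\<bar> \<le> B" for x
  proof -
    have "\<bar>g (extend (word n x))\<bar> \<le> B - 1"
      by (auto simp: B_def intro!: Max_ge)
    then show ?thesis using n[of x "extend (word n x)"] by simp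
  qed
  then show ?thesis by blast
qed

lemma measurable_finite_coordinates:
  fixes f :: "(nat \<Rightarrow> 'a::finite) \<Rightarrow> 'b"
  assumes "\<And>x y. word n x = word n y \<Longrightarrow> f x = f y" "\<And>x. f x \<in> space N"
  shows "f \<in> measurable shift_borel N"
proof (rule measurableI)
  \<comment> \<open>Every preimage is a union of cylinders of length \<open>n\<close>, hence
    open.\<close>
  fix A
  have "openin shift_topology (f -` A)"
    by (rule openin_finite_coordinates[of n]) (metis assms(1) vimage_eq)
  then show "f -` A \<inter> space shift_borel \<in> sets shift_borel"
    by (auto simp: sets_shift_borel)
qed (use assms(2) in auto)

lemma measurable_continuous_shift:
  assumes "continuous_map shift_topology shift_topology f"
  shows "f \<in> measurable shift_borel shift_borel"
  unfolding shift_borel_def[where 'a = 'b]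
proof (rule measurable_sigma_sets)
  show "sets (sigma UNIV {U. openin shift_topology U}) = sigma_sets UNIV {U. openin shift_topology U}"
    by (simp add: sets_measure_of_conv)
  fix U :: "(nat \<Rightarrow> 'b) set" assume "U \<in> {U. openin shift_topology U}"
  then have "openin shift_topology {x \<in> topspace shift_topology. f x \<in> U}"
    using assms by (intro openin_continuous_map_preimage) auto
  then show "f -` U \<inter> space shift_borel \<in> sets shift_borel"
    by (auto simp: sets_shift_borel vimage_def)
qed auto

lemma measurable_continuous_real:
  assumes "continuous_map shift_topology euclideanreal g"
  shows "g \<in> borel_measurable shift_borel"
proof (rule borel_measurableI)
  fix S :: "real set" assume "open S"
  then have "openin shift_topology {x \<in> topspace shift_topology. g x \<in> S}"
    using assms by (intro openin_continuous_map_preimage) auto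
  then show "g -` S \<inter> space shift_borel \<in> sets shift_borel"
    by (auto simp: sets_shift_borel vimage_def)
qed

lemma continuous_left_shift: "continuous_map shift_topology shift_topology left_shift"
proof -
  have "openin shift_topology {x. left_shift x \<in> U}" if "openin shift_topology U"
    for U :: "(nat \<Rightarrow> 'a) set"
    unfolding openin_shift_topology_iff
  proof
    fix x assume "x \<in> {x. left_shift x \<in> U}"
    then obtain n where "\<And>y. word n y = word n (left_shift x) \<Longrightarrow> y \<in> U"
      using \<open>openin shift_topology U\<close> unfolding openin_shift_topology_iff by auto
    then have "word (Suc n) y = word (Suc n) x \<longrightarrow> y \<in> {x. left_shift x \<in> U}" for y
      by (auto simp: word_eq_iff left_shift_def)
    then show "\<exists>n. \<forall>y. word n y = word n x \<longrightarrow> y \<in> {x. left_shift x \<in> U}" by blast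
  qed
  then show ?thesis by (auto simp: continuous_map_def)
qed

lemma measurable_left_shift [measurable]: "left_shift \<in> measurable shift_borel shift_borel"
  by (rule measurable_continuous_shift[OF continuous_left_shift])

lemma measurable_left_shift_funpow [measurable]:
  "(left_shift ^^ i) \<in> measurable shift_borel shift_borel"
  by (rule measurable_compose_n[OF measurable_left_shift])

locale shift_system = prob_space \<mu> for \<mu> :: "(nat \<Rightarrow> 'a::finite) measure" +
  assumes sets_eq [measurable_cong]: "sets \<mu> = sets shift_borel"
    and invariant: "distr \<mu> shift_borel left_shift = \<mu>"
begin

lemma space_eq [simp]: "space \<mu> = UNIV"
  using sets_eq_imp_space_eq[OF sets_eq] by simp

lemma distr_funpow: "distr \<mu> shift_borel (left_shift ^^ i) = \<mu>"
proof (induction i)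
  case 0
  show ?case using distr_id2[of shift_borel \<mu>] sets_eq by (simp add: id_def)
next
  case (Suc i)
  have "distr \<mu> shift_borel (left_shift ^^ Suc i)
      = distr (distr \<mu> shift_borel (left_shift ^^ i)) shift_borel left_shift"
    by (subst distr_distr) (auto simp: comp_def)
  also have "\<dots> = \<mu>" unfolding Suc by (rule invariant)
  finally show ?case .
qed

lemma integral_funpow:
  fixes f :: "(nat \<Rightarrow> 'a) \<Rightarrow> real"
  assumes "f \<in> borel_measurable shift_borel"
  shows "(\<integral>x. f ((left_shift ^^ i) x) \<partial>\<mu>) = (\<integral>x. f x \<partial>\<mu>)"
  by (subst (2) distr_funpow[of i, symmetric], subst integral_distr) (use assms in auto)

lemma integrable_continuous:
  assumes "continuous_map shift_topology euclideanreal g"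
  shows "integrable \<mu> g"
proof -
  obtain B where "\<And>x. \<bar>g x\<bar> \<le> B" using continuous_bounded_shift[OF assms] by auto
  moreover have "g \<in> borel_measurable \<mu>"
    using measurable_continuous_real[OF assms] by (simp add: measurable_cong_sets[OF sets_eq refl])
  ultimately show ?thesis by (intro integrable_const_bound[of _ B]) auto
qed

end

lemma shift_system_iff: "shift_system \<mu> \<longleftrightarrow> \<mu> \<in> invariant_measures"
  by (auto simp: shift_system_def shift_system_axioms_def invariant_measures_def)

lemma (in shift_system) shift_system_factor:
  fixes \<pi> :: "(nat \<Rightarrow> 'a) \<Rightarrow> nat \<Rightarrow> 'd::finite"
  assumes \<pi>: "one_block_factor_map \<pi>"
  shows "shift_system (distr \<mu> shift_borel \<pi>)"
proof -
  have [measurable]: "\<pi> \<in> measurable shift_borel shift_borel"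
    using \<pi> unfolding one_block_factor_map_def by (blast intro: measurable_continuous_shift)
  have comm: "left_shift \<circ> \<pi> = \<pi> \<circ> left_shift"
    using \<pi> unfolding one_block_factor_map_def by metis
  have m: "\<pi> \<in> measurable \<mu> shift_borel" by measurable
  have "distr (distr \<mu> shift_borel \<pi>) shift_borel left_shift
      = distr \<mu> shift_borel (left_shift \<circ> \<pi>)"
    by (rule distr_distr[OF measurable_left_shift m])
  also have "\<dots> = distr (distr \<mu> shift_borel left_shift) shift_borel \<pi>"
    unfolding comm by (rule distr_distr[symmetric]) measurable
  also have "\<dots> = distr \<mu> shift_borel \<pi>" unfolding invariant ..
  finally show ?thesis
    using prob_space_distr[OF m] by (simp add: shift_system_def shift_system_axioms_def)
qed

section \<open>Entropy of finite-valued functions\<close>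

text \<open>Shannon entropy, in nats, of the partition into the fibres of \<open>f\<close>. With
  functions in place of partitions, joins become pairs or lists of values, and coarser partitions
  become compositions.\<close>

definition rv_entropy :: "'a measure \<Rightarrow> ('a \<Rightarrow> 'v) \<Rightarrow> real" where
  "rv_entropy M f =
     - (\<Sum>v\<in>f ` space M. measure M (f -` {v} \<inter> space M) * ln (measure M (f -` {v} \<inter> space M)))"

lemma rv_entropy_superset:
  assumes "finite S" "f ` space M \<subseteq> S"
  shows "rv_entropy M f =
     - (\<Sum>v\<in>S. measure M (f -` {v} \<inter> space M) * ln (measure M (f -` {v} \<inter> space M)))"
proof -
  have "measure M (f -` {v} \<inter> space M) = 0" if "v \<notin> f ` space M" for v
  proof -
    have "f -` {v} \<inter> space M = {}" using that by auto
    then show ?thesis by simp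
  qed
  then show ?thesis
    unfolding rv_entropy_def using assms by (intro arg_cong[where f = uminus] sum.mono_neutral_left) auto
qed

context prob_space
begin

text \<open>The bridge to information theory with logarithms to the base e, through which data
  processing and the chain rule become available.\<close>

lemma rv_entropy_eq_entropy:
  assumes "simple_function M f"
  shows "rv_entropy M f = entropy (exp 1) (count_space (f ` space M)) f"
proof -
  interpret information_space M "exp 1" by unfold_locales simp
  show ?thesis
    by (subst entropy_simple_distributed[OF simple_distributedI[OF assms measure_nonneg refl]])
       (simp add: rv_entropy_def log_def)
qed

lemma rv_entropy_comp_le:
  assumes "simple_function M f"
  shows "rv_entropy M (\<lambda>x. h (f x)) \<le> rv_entropy M f"
proof -
  interpret information_space M "exp 1" by unfold_locales simp
  have "simple_function M (\<lambda>x. h (f x))"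
    using simple_function_compose[OF assms, of h] by (simp add: comp_def)
  then show ?thesis
    using entropy_data_processing[OF assms, of h] assms
    by (simp add: rv_entropy_eq_entropy comp_def)
qed

lemma rv_entropy_Pair_le:
  assumes f: "simple_function M f" and g: "simple_function M g"
  shows "rv_entropy M (\<lambda>x. (f x, g x)) \<le> rv_entropy M f + rv_entropy M g"
proof -
  interpret information_space M "exp 1" by unfold_locales simp
  show ?thesis
    using entropy_chain_rule[OF f g] conditional_entropy_less_eq_entropy[OF g f] f g
    by (simp add: rv_entropy_eq_entropy simple_function_Pair)
qed

lemma rv_entropy_nonneg: "0 \<le> rv_entropy M f"
proof -
  have "p * ln p \<le> 0" if "0 \<le> p" "p \<le> 1" for p :: real
    using that by (cases "p = 0") (auto intro!: mult_nonneg_nonpos)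
  then show ?thesis
    unfolding rv_entropy_def using prob_le_1 by (auto intro!: sum_nonpos)
qed

text \<open>Uses \<open>- p ln p \<le> 1 - p\<close> for the dominant value and \<open>- p ln p \<le> 2 sqrt p\<close> for the others.\<close>

lemma rv_entropy_le_if_nearly_constant:
  assumes f: "simple_function M f" and d: "prob {x \<in> space M. f x \<noteq> v0} \<le> d"
  shows "rv_entropy M f \<le> d + real (card (f ` space M)) * (2 * sqrt d)"
proof -
  let ?p = "\<lambda>v. prob (f -` {v} \<inter> space M)"
  have S: "finite (f ` space M)" using simple_functionD(1)[OF f] .
  have m: "f -` A \<inter> space M \<in> events" for A using simple_functionD(2)[OF f] .
  have d0: "0 \<le> d" using d measure_nonneg order_trans by blast
  have 1: "- (p * ln p) \<le> 1 - p" if "0 \<le> p" for p :: real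
  proof (cases "p = 0")
    case False
    then have "ln (1 / p) \<le> 1 / p - 1" using that by (intro ln_le_minus_one) auto
    then have "p * ln (1 / p) \<le> p * (1 / p - 1)" using that by (intro mult_left_mono) auto
    with False that show ?thesis by (simp add: ln_div right_diff_distrib)
  qed simp
  have 2: "- (p * ln p) \<le> 2 * sqrt p" if "0 \<le> p" for p :: real
  proof (cases "p = 0")
    case False
    then have p: "p > 0" using that by simp
    have "ln (1 / sqrt p) \<le> 1 / sqrt p - 1" using p by (intro ln_le_minus_one) auto
    then have "- ln p \<le> 2 * (1 / sqrt p)" using p by (simp add: ln_div ln_sqrt)
    then have "p * (- ln p) \<le> p * (2 * (1 / sqrt p))" using that by (intro mult_left_mono) auto
    also have "\<dots> = 2 * sqrt p" using p by (simp add: real_div_sqrt field_simps)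
    finally show ?thesis by simp
  qed simp
  have "- (?p v * ln (?p v)) \<le> (if v = v0 then d else 0) + 2 * sqrt d" for v
  proof (cases "v = v0")
    case True
    have "1 - ?p v0 = prob (space M - (f -` {v0} \<inter> space M))"
      using prob_compl[OF m] by simp
    also have "space M - (f -` {v0} \<inter> space M) = {x \<in> space M. f x \<noteq> v0}" by auto
    finally have "1 - ?p v0 \<le> d" using d by simp
    then have "- (?p v0 * ln (?p v0)) \<le> d" using 1[of "?p v0"] by simp
    moreover have "0 \<le> sqrt d" using d0 by simp
    ultimately have "- (?p v0 * ln (?p v0)) \<le> d + 2 * sqrt d" by linarith
    then show ?thesis using True by simp
  next
    case False
    have eq: "{x \<in> space M. f x \<noteq> v0} = f -` (- {v0}) \<inter> space M" by auto
    have "?p v \<le> prob {x \<in> space M. f x \<noteq> v0}"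
      unfolding eq by (rule finite_measure_mono[OF _ m]) (use False in blast)
    then have "?p v \<le> d" using d by linarith
    then have "sqrt (?p v) \<le> sqrt d" by simp
    then have "- (?p v * ln (?p v)) \<le> 2 * sqrt d" using 2[OF measure_nonneg, of M "f -` {v} \<inter> space M"] by linarith
    then show ?thesis using False by simp
  qed
  then have "(\<Sum>v\<in>f ` space M. - (?p v * ln (?p v)))
      \<le> (\<Sum>v\<in>f ` space M. (if v = v0 then d else 0) + 2 * sqrt d)"
    by (intro sum_mono)
  also have "\<dots> = (\<Sum>v\<in>f ` space M. if v = v0 then d else 0) + real (card (f ` space M)) * (2 * sqrt d)"
    by (simp add: sum.distrib)
  also have "(\<Sum>v\<in>f ` space M. if v = v0 then d else 0) \<le> d"
    using S d0 by (simp add: sum.delta)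
  finally show ?thesis by (simp add: rv_entropy_def sum_negf)
qed

end

section \<open>Itineraries and entropy rates of a measure-preserving map\<close>

definition itinerary :: "('x \<Rightarrow> 'x) \<Rightarrow> ('x \<Rightarrow> 'v) \<Rightarrow> nat \<Rightarrow> 'x \<Rightarrow> 'v list" where
  "itinerary T f n x = map (\<lambda>i. f ((T ^^ i) x)) [0..<n]"

lemma length_itinerary [simp]: "length (itinerary T f n x) = n"
  by (simp add: itinerary_def)

lemma nth_itinerary [simp]: "i < n \<Longrightarrow> itinerary T f n x ! i = f ((T ^^ i) x)"
  by (simp add: itinerary_def)

lemma itinerary_eq_iff:
  "itinerary T f n x = itinerary T f n y \<longleftrightarrow> (\<forall>i<n. f ((T ^^ i) x) = f ((T ^^ i) y))"
  by (auto simp: itinerary_def)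

lemma itinerary_add: "itinerary T f (m + n) x = itinerary T f m x @ itinerary T f n ((T ^^ m) x)"
proof -
  have "(T ^^ (i - m)) ((T ^^ m) x) = (T ^^ i) x" if "m \<le> i" for i
    using that by (metis comp_apply funpow_add le_add_diff_inverse2)
  then show ?thesis by (intro nth_equalityI) (auto simp: nth_append)
qed

lemma word_eq_itinerary: "word n = itinerary left_shift (\<lambda>x. x 0) n"
  by (rule ext, rule nth_equalityI) auto

locale measure_preserving_system = prob_space M for M :: "'x measure" +
  fixes T :: "'x \<Rightarrow> 'x"
  assumes measurable_T [measurable]: "T \<in> measurable M M"
    and distr_T: "distr M M T = M"
begin

lemma measurable_T_funpow [measurable]: "(T ^^ n) \<in> measurable M M"
  by (rule measurable_compose_n[OF measurable_T])

lemma distr_T_funpow: "distr M M (T ^^ n) = M"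
proof (induction n)
  case 0
  show ?case using distr_id2[of M M] by (simp add: id_def)
next
  case (Suc n)
  have "distr M M (T ^^ Suc n) = distr (distr M M (T ^^ n)) M T"
    by (simp add: distr_distr)
  also have "\<dots> = M" unfolding Suc by (rule distr_T)
  finally show ?case .
qed

lemma simple_function_funpow:
  assumes "simple_function M f"
  shows "simple_function M (\<lambda>x. f ((T ^^ n) x))"
proof -
  have "(\<lambda>x. f ((T ^^ n) x)) ` space M \<subseteq> f ` space M"
    using measurable_space[OF measurable_T_funpow] by blast
  moreover have "(\<lambda>x. f ((T ^^ n) x)) -` {v} \<inter> space M \<in> sets M" for v
  proof -
    have "(T ^^ n) -` (f -` {v} \<inter> space M) \<inter> space M \<in> sets M"
      using simple_functionD(2)[OF assms] by measurable
    also have "(T ^^ n) -` (f -` {v} \<inter> space M) \<inter> space M = (\<lambda>x. f ((T ^^ n) x)) -` {v} \<inter> space M"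
      using measurable_space[OF measurable_T_funpow] by auto
    finally show ?thesis .
  qed
  ultimately show ?thesis
    using simple_functionD(1)[OF assms] finite_subset unfolding simple_function_def by blast
qed

lemma rv_entropy_funpow:
  assumes "simple_function M f"
  shows "rv_entropy M (\<lambda>x. f ((T ^^ n) x)) = rv_entropy M f"
proof -
  have "prob ((\<lambda>x. f ((T ^^ n) x)) -` {v} \<inter> space M) = prob (f -` {v} \<inter> space M)" for v
  proof -
    have "prob (f -` {v} \<inter> space M) = measure (distr M M (T ^^ n)) (f -` {v} \<inter> space M)"
      by (simp add: distr_T_funpow)
    also have "\<dots> = prob ((T ^^ n) -` (f -` {v} \<inter> space M) \<inter> space M)"
      using simple_functionD(2)[OF assms] by (intro measure_distr) auto
    also have "(T ^^ n) -` (f -` {v} \<inter> space M) \<inter> space M = (\<lambda>x. f ((T ^^ n) x)) -` {v} \<inter> space M"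
      using measurable_space[OF measurable_T_funpow] by auto
    finally show ?thesis by simp
  qed
  moreover have "(\<lambda>x. f ((T ^^ n) x)) ` space M \<subseteq> f ` space M"
    using measurable_space[OF measurable_T_funpow] by blast
  ultimately show ?thesis
    using simple_functionD(1)[OF assms]
    by (subst (1 2) rv_entropy_superset[of "f ` space M"]) auto
qed

lemma simple_function_itinerary:
  assumes "simple_function M f"
  shows "simple_function M (itinerary T f n)"
proof (induction n)
  case 0
  have "itinerary T f 0 = (\<lambda>_. [])" by (auto simp: itinerary_def)
  then show ?case by simp
next
  case (Suc n)
  have "itinerary T f (Suc n) = (\<lambda>x. itinerary T f n x @ [f ((T ^^ n) x)])"
    by (auto simp: itinerary_def)
  moreover have "simple_function M (\<lambda>x. itinerary T f n x @ [f ((T ^^ n) x)])"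
    by (rule simple_function_compose2[OF Suc simple_function_funpow[OF assms], of "\<lambda>u v. u @ [v]"])
  ultimately show ?case by simp
qed

text \<open>The last \<open>n\<close> symbols form the itinerary of a shifted point, which by
  invariance has the same law, and so the same entropy, as the first \<open>n\<close>. Subadditivity
  of the entropy of a pair does the rest.\<close>

lemma rv_entropy_itinerary_add_le:
  assumes f: "simple_function M f"
  shows "rv_entropy M (itinerary T f (m + n))
      \<le> rv_entropy M (itinerary T f m) + rv_entropy M (itinerary T f n)"
proof -
  note sf = simple_function_itinerary[OF f]
  have "rv_entropy M (itinerary T f (m + n))
      = rv_entropy M (\<lambda>x. case_prod (@) (itinerary T f m x, itinerary T f n ((T ^^ m) x)))"
    by (simp add: itinerary_add[abs_def])
  also have "\<dots> \<le> rv_entropy M (\<lambda>x. (itinerary T f m x, itinerary T f n ((T ^^ m) x)))"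
    by (intro rv_entropy_comp_le simple_function_Pair sf simple_function_funpow)
  also have "\<dots> \<le> rv_entropy M (itinerary T f m) + rv_entropy M (\<lambda>x. itinerary T f n ((T ^^ m) x))"
    by (intro rv_entropy_Pair_le sf simple_function_funpow)
  finally show ?thesis by (simp add: rv_entropy_funpow sf)
qed

lemma rv_entropy_itinerary_le:
  assumes f: "simple_function M f"
  shows "rv_entropy M (itinerary T f n) \<le> real n * rv_entropy M f"
proof (induction n)
  case 0
  have "itinerary T f 0 -` {v} \<inter> space M = (if v = [] then space M else {})" for v
    by (auto simp: itinerary_def)
  moreover have "itinerary T f 0 ` space M \<subseteq> {[]}"
    by (auto simp: itinerary_def)
  ultimately have "rv_entropy M (itinerary T f 0) = 0"
    by (subst rv_entropy_superset[of "{[]}"]) (simp_all add: prob_space)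
  then show ?case by simp
next
  case (Suc n)
  have "itinerary T f 1 = (\<lambda>x. (\<lambda>v. [v]) (f x))" by (auto simp: itinerary_def)
  then have "rv_entropy M (itinerary T f 1) \<le> rv_entropy M f"
    using rv_entropy_comp_le[OF f, of "\<lambda>v. [v]"] by simp
  then show ?case
    using Suc rv_entropy_itinerary_add_le[OF f, of n 1] by (simp add: algebra_simps)
qed

end

text \<open>The limit is the infimum of \<open>u n / n\<close> over positive \<open>n\<close>;
  nonnegativity makes this infimum finite.\<close>

lemma fekete:
  fixes u :: "nat \<Rightarrow> real"
  assumes nonneg: "\<And>n. 0 \<le> u n" and sub: "\<And>m n. u (m + n) \<le> u m + u n"
  obtains L where "(\<lambda>n. u n / real n) \<longlonglongrightarrow> L"
proof -
  define L where "L = (INF n\<in>{1..}. u n / real n)"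
  have bdd: "bdd_below ((\<lambda>n. u n / real n) ` {1..})"
    using nonneg by (intro bdd_belowI[of _ 0]) auto
  have L: "L \<le> u n / real n" if "n > 0" for n
    unfolding L_def using that by (intro cINF_lower[OF bdd]) auto
  \<comment> \<open>The case \<open>k = 0\<close> is excluded because subadditivity does not force
    \<open>u 0 = 0\<close>.\<close>
  have mult: "u (k * m) \<le> real k * u m" if "k > 0" for k m
    using that
  proof (induction k rule: nat_induct_non_zero)
    case (Suc k)
    then show ?case using sub[of m "k * m"] by (simp add: algebra_simps)
  qed simp
  have "\<exists>N. \<forall>n\<ge>N. u n / real n < L + e" if e: "e > 0" for e
  proof -
    have "\<exists>m\<in>{1..}. u m / real m < L + e / 2"
      using cInf_lessD[of "(\<lambda>n. u n / real n) ` {1..}" "L + e / 2"] e by (auto simp: L_def)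
    then obtain m where m: "m \<ge> 1" "u m / real m < L + e / 2" by auto
    define B where "B = Max (u ` {..m})"
    have B: "u r \<le> B" if "r \<le> m" for r using that by (auto simp: B_def)
    \<comment> \<open>Division with remainder by \<open>m\<close>: the remainder costs at most the
      constant \<open>B\<close>, which disappears after division by \<open>n\<close>.\<close>
    have bound: "u n \<le> real n * (u m / real m) + B" if n: "n \<ge> m" for n
    proof -
      have "n div m > 0" using n m by (simp add: div_greater_zero_iff)
      have "u n = u (n div m * m + n mod m)" by simp
      also have "\<dots> \<le> real (n div m) * u m + B"
        using sub[of "n div m * m" "n mod m"] mult[OF \<open>n div m > 0\<close>, of m] B[of "n mod m"] m
        by (smt (verit) mod_le_divisor One_nat_def Suc_le_lessD)
      also have "real (n div m) * u m \<le> (real n / real m) * u m"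
        using nonneg by (intro mult_right_mono of_nat_div_le_of_nat)
      finally show ?thesis by simp
    qed
    have "(\<lambda>n. B / real n) \<longlonglongrightarrow> 0" by real_asymp
    then have "\<forall>\<^sub>F n in sequentially. B / real n < e / 2"
      using e by (intro order_tendstoD) auto
    then obtain N where N: "\<And>n. n \<ge> N \<Longrightarrow> B / real n < e / 2"
      by (auto simp: eventually_sequentially)
    have "u n / real n < L + e" if n: "n \<ge> max N m" for n
    proof -
      have "n > 0" using n m by auto
      have "u n / real n \<le> (real n * (u m / real m) + B) / real n"
        using bound[of n] n by (intro divide_right_mono) auto
      also have "\<dots> = u m / real m + B / real n" using \<open>n > 0\<close> by (simp add: field_simps)
      also have "\<dots> < (L + e / 2) + e / 2" using m(2) N[of n] n by (intro add_strict_mono) auto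
      also have "\<dots> = L + e" by simp
      finally show ?thesis .
    qed
    then show ?thesis by blast
  qed
  then have "(\<lambda>n. u n / real n) \<longlonglongrightarrow> L"
  proof (intro order_tendstoI)
    fix a assume "a < L"
    then show "\<forall>\<^sub>F n in sequentially. a < u n / real n"
      using L by (intro eventually_sequentiallyI[of 1]) (metis Suc_le_lessD One_nat_def less_le_trans)
  next
    fix a assume "L < a" "\<And>e. 0 < e \<Longrightarrow> \<exists>N. \<forall>n\<ge>N. u n / real n < L + e"
    then show "\<forall>\<^sub>F n in sequentially. u n / real n < a"
      unfolding eventually_sequentially by (metis add.commute diff_add_cancel diff_gt_0_iff_gt)
  qed
  with that show thesis by blast
qed

context measure_preserving_system
begin

definition entropy_rate :: "('x \<Rightarrow> 'v) \<Rightarrow> real" where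
  "entropy_rate f = lim (\<lambda>n. rv_entropy M (itinerary T f n) / real n)"

lemma entropy_rate:
  assumes f: "simple_function M f"
  shows entropy_rate_tendsto: "(\<lambda>n. rv_entropy M (itinerary T f n) / real n) \<longlonglongrightarrow> entropy_rate f"
    and entropy_rate_nonneg: "0 \<le> entropy_rate f"
proof -
  obtain L where L: "(\<lambda>n. rv_entropy M (itinerary T f n) / real n) \<longlonglongrightarrow> L"
    using fekete[of "\<lambda>n. rv_entropy M (itinerary T f n)"]
      rv_entropy_nonneg rv_entropy_itinerary_add_le[OF f] by blast
  have "entropy_rate f = L" unfolding entropy_rate_def using L by (rule limI)
  with L show "(\<lambda>n. rv_entropy M (itinerary T f n) / real n) \<longlonglongrightarrow> entropy_rate f" by simp
  have "0 \<le> L" using L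
    by (rule LIMSEQ_le_const) (auto intro!: exI[of _ 0] divide_nonneg_nonneg rv_entropy_nonneg)
  then show "0 \<le> entropy_rate f" using \<open>entropy_rate f = L\<close> by simp
qed

text \<open>If \<open>f\<close> labels each point by the atom containing it, the nonempty atoms of
  the join are exactly the fibres of the attained itineraries.\<close>

lemma partition_entropy_iterated_join:
  assumes f: "\<And>x. x \<in> space M \<Longrightarrow> f x \<in> P \<and> x \<in> f x" and P: "disjoint P"
  shows "partition_entropy M (iterated_join M T P n) = rv_entropy M (itinerary T f n)"
proof -
  let ?F = "itinerary T f n"
  have T: "(T ^^ i) x \<in> space M" if "x \<in> space M" for i x
    using measurable_space[OF measurable_T_funpow that] .
  have unique: "f x = A" if "x \<in> space M" "A \<in> P" "x \<in> A" for x A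
    using f[OF that(1)] that P unfolding disjoint_def by blast
  have "iterated_join M T P n = (\<lambda>v. ?F -` {v} \<inter> space M) ` (?F ` space M)" (is "?l = ?r")
  proof (intro equalityI subsetI)
    fix B assume "B \<in> ?l"
    then obtain A where A: "B = {x \<in> space M. \<forall>i<n. (T ^^ i) x \<in> A i}" "\<forall>i<n. A i \<in> P" "B \<noteq> {}"
      unfolding iterated_join_def by blast
    then obtain y where y: "y \<in> B" by blast
    have "f ((T ^^ i) x) = A i \<longleftrightarrow> (T ^^ i) x \<in> A i" if "i < n" "x \<in> space M" for i x
      using unique[OF T] f[OF T] A(2) that by metis
    then have eq: "(\<forall>i<n. f ((T ^^ i) x) = A i) \<longleftrightarrow> (\<forall>i<n. (T ^^ i) x \<in> A i)"
      if "x \<in> space M" for x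
      using that by simp
    have "\<forall>i<n. f ((T ^^ i) y) = A i" using eq[of y] y A(1) by simp
    then have "x \<in> B \<longleftrightarrow> x \<in> ?F -` {?F y} \<inter> space M" for x
      unfolding A(1) by (simp add: itinerary_eq_iff eq conj_commute cong: conj_cong)
    then have "B = ?F -` {?F y} \<inter> space M" by blast
    then show "B \<in> ?r" using y A(1) by blast
  next
    fix B assume "B \<in> ?r"
    then obtain y where y: "y \<in> space M" "B = ?F -` {?F y} \<inter> space M" by auto
    have "f ((T ^^ i) x) = f ((T ^^ i) y) \<longleftrightarrow> (T ^^ i) x \<in> f ((T ^^ i) y)" if "x \<in> space M" for i x
      using unique[OF T] f[OF T] y(1) that by metis
    then have "B = {x \<in> space M. \<forall>i<n. (T ^^ i) x \<in> f ((T ^^ i) y)}"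
      unfolding y(2) by (auto simp: itinerary_eq_iff)
    moreover have "\<forall>i<n. f ((T ^^ i) y) \<in> P" using f[OF T[OF y(1)]] by simp
    moreover have "B \<noteq> {}" using y by blast
    ultimately show "B \<in> ?l"
      unfolding iterated_join_def by (intro DiffI CollectI exI[of _ "\<lambda>i. f ((T ^^ i) y)"] conjI) simp_all
  qed
  moreover have "inj_on (\<lambda>v. ?F -` {v} \<inter> space M) (?F ` space M)"
    by (auto simp: inj_on_def)
  ultimately show ?thesis
    by (simp add: partition_entropy_def rv_entropy_def sum.reindex)
qed

lemma entropy_wrt_partition_eq:
  assumes f: "\<And>x. x \<in> space M \<Longrightarrow> f x \<in> P \<and> x \<in> f x" and P: "finite_measurable_partition M P"
  shows "simple_function M f" "entropy_wrt_partition M T P = ereal (entropy_rate f)"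
proof -
  have P': "finite P" "P \<subseteq> sets M" "disjoint P"
    using P by (auto simp: finite_measurable_partition_def partition_on_def)
  have "f -` {A} \<inter> space M \<in> sets M" if "A \<in> f ` space M" for A
  proof -
    have A: "A \<in> P" using that f by auto
    have "f x = A" if "x \<in> A" "x \<in> space M" for x
      using disjointD[OF P'(3) A, of "f x"] f[OF that(2)] that(1) by blast
    moreover have "A \<subseteq> space M" using A P'(2) sets.sets_into_space by blast
    ultimately have "f -` {A} \<inter> space M = A" using f by blast
    then show ?thesis using A P' by auto
  qed
  moreover have "f ` space M \<subseteq> P" using f by auto
  ultimately show sf: "simple_function M f"
    unfolding simple_function_def using P'(1) finite_subset by blast
  have "(\<lambda>n. ereal (partition_entropy M (iterated_join M T P n) / real n)) \<longlonglongrightarrow> ereal (entropy_rate f)"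
    using entropy_rate_tendsto[OF sf]
    by (simp add: partition_entropy_iterated_join[OF f P'(3)])
  then show "entropy_wrt_partition M T P = ereal (entropy_rate f)"
    unfolding entropy_wrt_partition_def by (rule limI)
qed

end

section \<open>The entropy of a shift-invariant measure is its word entropy rate\<close>

lemma measure_UN_Diff_incseq_small:
  assumes "prob_space M" "range A \<subseteq> sets M" "incseq A" "e > 0"
  shows "\<exists>n. measure M ((\<Union>i. A i) - A n) < e"
proof -
  interpret prob_space M by fact
  have "(\<lambda>i. prob (A i)) \<longlonglongrightarrow> prob (\<Union>i. A i)"
    using assms by (intro finite_Lim_measure_incseq) auto
  then have "\<forall>\<^sub>F n in sequentially. prob (\<Union>i. A i) - e < prob (A n)"
    using assms(4) by (intro order_tendstoD) auto
  then obtain n where "prob (\<Union>i. A i) - e < prob (A n)"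
    by (auto simp: eventually_sequentially)
  moreover have "prob ((\<Union>i. A i) - A n) = prob (\<Union>i. A i) - prob (A n)"
    using assms(2) by (intro finite_measure_Diff) auto
  ultimately have "prob ((\<Union>i. A i) - A n) < e" by linarith
  then show ?thesis by blast
qed

section \<open>Approximation of measurable sets and simple functions by cylinders\<close>

definition cylindrical :: "nat \<Rightarrow> (nat \<Rightarrow> 'a) set \<Rightarrow> bool" where
  "cylindrical k C \<longleftrightarrow> (\<forall>x y. word k x = word k y \<longrightarrow> (x \<in> C \<longleftrightarrow> y \<in> C))"

lemma cylindricalD: "cylindrical k C \<Longrightarrow> word k x = word k y \<Longrightarrow> x \<in> C \<longleftrightarrow> y \<in> C"
  unfolding cylindrical_def by blast

lemma cylindrical_mono: "cylindrical k C \<Longrightarrow> k \<le> l \<Longrightarrow> cylindrical l C"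
  unfolding cylindrical_def by (meson word_eq_mono)

lemma cylindrical_Compl: "cylindrical k C \<Longrightarrow> cylindrical k (- C)"
  unfolding cylindrical_def by (metis ComplD ComplI)

lemma cylindrical_UN: "(\<And>i. i \<in> I \<Longrightarrow> cylindrical k (C i)) \<Longrightarrow> cylindrical k (\<Union>i\<in>I. C i)"
  unfolding cylindrical_def by (metis UN_iff)

context shift_system
begin

lemma measure_preserving_left_shift: "measure_preserving_system \<mu> left_shift"
proof -
  have "left_shift \<in> measurable \<mu> \<mu>"
    unfolding measurable_cong_sets[OF sets_eq sets_eq] by (rule measurable_left_shift)
  moreover have "distr \<mu> \<mu> left_shift = distr \<mu> shift_borel left_shift"
    by (rule distr_cong) (rule refl sets_eq)+
  ultimately show ?thesis
    using prob_space_axioms invariant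
    by (simp add: measure_preserving_system_def measure_preserving_system_axioms_def)
qed

sublocale measure_preserving_system \<mu> left_shift
  by (rule measure_preserving_left_shift)

lemma simple_function_finite_coordinates:
  assumes "\<And>x y. word n x = word n y \<Longrightarrow> f x = f y"
  shows "simple_function \<mu> f"
proof -
  have "range f \<subseteq> (\<lambda>w. f (extend w)) ` {w. length w = n}"
  proof clarify
    fix x
    have "f x = f (extend (word n x))" by (rule assms) simp
    then show "f x \<in> (\<lambda>w. f (extend w)) ` {w. length w = n}"
      by (intro image_eqI[of _ _ "word n x"]) auto
  qed
  then have "finite (range f)" by (rule finite_subset) simp
  moreover have "f -` {v} \<in> sets \<mu>" for v
  proof -
    have "openin shift_topology (f -` {v})"
      by (rule openin_finite_coordinates[of n]) (metis assms vimage_eq)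
    then show ?thesis by (auto simp: sets_eq sets_shift_borel)
  qed
  ultimately show ?thesis by (simp add: simple_function_def)
qed

lemma simple_function_word: "simple_function \<mu> (word n)"
  by (rule simple_function_finite_coordinates)

text \<open>Approximation in measure by finite unions of cylinders. The measurable sets with this
  property include the open sets and are closed under complements and countable unions, which is
  what the induction over the Borel sets in \<open>approximable_sets\<close> requires.\<close>

definition approximable :: "(nat \<Rightarrow> 'a) set \<Rightarrow> bool" where
  "approximable A \<longleftrightarrow> (\<forall>e>0. \<exists>k C. cylindrical k C \<and>
     prob ((A - C) \<union> (C - A)) < e)"

lemma finite_coordinates_sets:
  assumes "cylindrical k C"
  shows "C \<in> sets \<mu>"
proof -
  have "openin shift_topology C"
    by (rule openin_finite_coordinates[of k]) (rule cylindricalD[OF assms])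
  then show ?thesis by (auto simp: sets_eq sets_shift_borel)
qed

lemma approximable_open:
  assumes U: "openin shift_topology U"
  shows "approximable U"
  unfolding approximable_def
proof (intro allI impI)
  fix e :: real assume e: "e > 0"
  \<comment> \<open>\<open>V n\<close> is the union of the cylinders of length \<open>n\<close>
    contained in \<open>U\<close>; these sets increase to \<open>U\<close>.\<close>
  define V where "V n = {x. \<forall>y. word n y = word n x \<longrightarrow> y \<in> U}" for n
  have V: "cylindrical n (V n)" for n
    unfolding cylindrical_def V_def mem_Collect_eq by (intro allI impI) (simp only:)
  have "range V \<subseteq> sets \<mu>" using finite_coordinates_sets[OF V] by blast
  moreover have "incseq V"
  proof (intro incseq_SucI subsetI)
    fix n x assume "x \<in> V n"
    then have "y \<in> U" if "word (Suc n) y = word (Suc n) x" for y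
      using word_eq_mono[OF that, of n] by (simp add: V_def)
    then show "x \<in> V (Suc n)" by (simp add: V_def)
  qed
  ultimately obtain n where n: "prob ((\<Union>i. V i) - V n) < e"
    using measure_UN_Diff_incseq_small[OF prob_space_axioms] e by blast
  have "(\<Union>i. V i) = U"
    using U unfolding openin_shift_topology_iff V_def by auto
  moreover have "V n \<subseteq> U" by (auto simp: V_def)
  ultimately have "prob ((U - V n) \<union> (V n - U)) < e"
    using n by (simp add: Diff_eq_empty_iff[THEN iffD2])
  with V show "\<exists>k C. cylindrical k C \<and>
     prob ((U - C) \<union> (C - U)) < e" by blast
qed

lemma approximable_Compl:
  assumes "approximable A"
  shows "approximable (- A)"
  unfolding approximable_def
proof (intro allI impI)
  fix e :: real assume "e > 0"
  then obtain k C where C: "cylindrical k C"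
    "prob ((A - C) \<union> (C - A)) < e"
    using assms unfolding approximable_def by blast
  have "(- A - - C) \<union> (- C - - A) = (A - C) \<union> (C - A)" by blast
  then have "prob ((- A - - C) \<union> (- C - - A)) < e" using C(2) by presburger
  with cylindrical_Compl[OF C(1)] show "\<exists>k C. cylindrical k C \<and>
     prob ((- A - C) \<union> (C - - A)) < e" by blast
qed

lemma approximable_UN:
  fixes A :: "nat \<Rightarrow> (nat \<Rightarrow> 'a) set"
  assumes A: "\<And>i. approximable (A i)" "\<And>i. A i \<in> sets \<mu>"
  shows "approximable (\<Union>i. A i)"
  unfolding approximable_def
proof (intro allI impI)
  fix e :: real assume e: "e > 0"
  define U where "U n = (\<Union>i<n. A i)" for n
  have U: "range U \<subseteq> sets \<mu>" using A(2) by (auto simp: U_def)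
  have "incseq U" by (rule incseq_SucI) (auto simp: U_def less_Suc_eq)
  then obtain n where n: "prob ((\<Union>i. U i) - U n) < e / 2"
    using measure_UN_Diff_incseq_small[OF prob_space_axioms U] e by (meson half_gt_zero)
  have UN: "(\<Union>i. U i) = (\<Union>i. A i)" by (auto simp: U_def)
  \<comment> \<open>Half of \<open>e\<close> is spent on the tail of the union; the other half is
    shared by the first \<open>n\<close> sets. Writing \<open>Suc n\<close> keeps the denominator
    positive for \<open>n = 0\<close>.\<close>
  have "\<exists>k C. cylindrical k C \<and>
      prob ((A i - C) \<union> (C - A i)) < e / (2 * real (Suc n))" for i
    using A(1)[of i] e unfolding approximable_def by simp
  then obtain k C where C:
    "\<And>i. cylindrical (k i) (C i)"
    "\<And>i. prob ((A i - C i) \<union> (C i - A i)) < e / (2 * real (Suc n))"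
    by metis
  define K where "K = (\<Sum>i<n. k i)"
  have K: "k i \<le> K" if "i < n" for i
    unfolding K_def using that by (intro member_le_sum) auto
  let ?C = "\<Union>i<n. C i"
  have "cylindrical K ?C"
    using C(1) K by (intro cylindrical_UN) (auto intro: cylindrical_mono)
  moreover have "prob (((\<Union>i. A i) - ?C) \<union> (?C - (\<Union>i. A i))) < e"
  proof -
    let ?D = "\<lambda>i. (A i - C i) \<union> (C i - A i)"
    have D: "?D i \<in> sets \<mu>" for i
      using A(2) finite_coordinates_sets[OF C(1)] by auto
    have R: "(\<Union>i. U i) - U n \<in> sets \<mu>" using U by auto
    have DU: "(\<Union>i<n. ?D i) \<in> sets \<mu>" by (intro sets.finite_UN finite_lessThan D)
    have "((\<Union>i. A i) - ?C) \<union> (?C - (\<Union>i. A i)) \<subseteq> ((\<Union>i. U i) - U n) \<union> (\<Union>i<n. ?D i)"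
      unfolding UN by (auto simp: U_def)
    then have "prob (((\<Union>i. A i) - ?C) \<union> (?C - (\<Union>i. A i)))
        \<le> prob (((\<Union>i. U i) - U n) \<union> (\<Union>i<n. ?D i))"
      by (rule finite_measure_mono[OF _ sets.Un[OF R DU]])
    also have "\<dots> \<le> prob ((\<Union>i. U i) - U n) + prob (\<Union>i<n. ?D i)"
      by (rule measure_Un_le[OF R DU])
    also have "prob (\<Union>i<n. ?D i) \<le> (\<Sum>i<n. prob (?D i))"
      using D by (intro measure_UNION_le) auto
    also have "\<dots> \<le> (\<Sum>i<n. e / (2 * real (Suc n)))"
      using C(2) by (intro sum_mono less_imp_le)
    also have "\<dots> \<le> e / 2" using e by (simp add: field_simps)
    finally show ?thesis using n by simp
  qed
  ultimately show "\<exists>k C. cylindrical k C \<and>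
     prob (((\<Union>i. A i) - C) \<union> (C - (\<Union>i. A i))) < e" by blast
qed

lemma approximable_sets:
  assumes "A \<in> sets \<mu>"
  shows "approximable A"
proof -
  have "A \<in> sigma_sets UNIV {U. openin shift_topology U}"
    using assms by (simp add: sets_eq sets_shift_borel)
  then show ?thesis
  proof induction
    case (Basic U)
    then show ?case by (simp add: approximable_open)
  next
    case Empty
    show ?case by (rule approximable_open) simp
  next
    case (Compl A)
    then show ?case using approximable_Compl[of A] by (simp add: Compl_eq_Diff_UNIV)
  next
    case (Union A)
    then show ?case by (intro approximable_UN) (auto simp: sets_eq sets_shift_borel)
  qed
qed

lemma simple_function_approx:
  assumes f: "simple_function \<mu> f" and d: "d > 0"
  shows "\<exists>k f'. (\<forall>x y. word k x = word k y \<longrightarrow> f' x = f' y) \<and> prob {x. f x \<noteq> f' x} \<le> d"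
proof -
  define S where "S = range f"
  have S: "finite S" "S \<noteq> {}" using simple_functionD(1)[OF f] by (auto simp: S_def)
  have fs: "f -` {v} \<in> sets \<mu>" for v using simple_functionD(2)[OF f, of "{v}"] by simp
  have pos: "d / real (card S) > 0" using d S by (simp add: card_gt_0_iff)
  have "\<exists>k C. cylindrical k C \<and>
      prob ((f -` {v} - C) \<union> (C - f -` {v})) < d / real (card S)" for v
    using approximable_sets[OF fs[of v]] pos unfolding approximable_def by blast
  then obtain k C where C:
    "\<And>v. cylindrical (k v) (C v)"
    "\<And>v. prob ((f -` {v} - C v) \<union> (C v - f -` {v})) < d / real (card S)"
    by metis
  define K where "K = (\<Sum>v\<in>S. k v)"
  have K: "k v \<le> K" if "v \<in> S" for v
    unfolding K_def using that S by (intro member_le_sum) auto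
  \<comment> \<open>Outside the symmetric differences \<open>f x\<close> is the only label whose
    approximating set contains \<open>x\<close>. Elsewhere the choice may be arbitrary, but it still
    depends on the first \<open>K\<close> letters only.\<close>
  define f' where "f' x = (SOME v. v \<in> S \<and> x \<in> C v)" for x
  have "f' x = f' y" if "word K x = word K y" for x y
  proof -
    have "(v \<in> S \<and> x \<in> C v) \<longleftrightarrow> (v \<in> S \<and> y \<in> C v)" for v
      using cylindricalD[OF cylindrical_mono[OF C(1) K] that, of v] by blast
    then show ?thesis unfolding f'_def by presburger
  qed
  moreover have "prob {x. f x \<noteq> f' x} \<le> d"
  proof -
    let ?D = "\<lambda>v. (f -` {v} - C v) \<union> (C v - f -` {v})"
    have D: "?D v \<in> sets \<mu>" for v
      using fs finite_coordinates_sets[OF C(1)] by blast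
    have agree: "f' x = f x" if "x \<notin> (\<Union>v\<in>S. ?D v)" for x
    proof -
      have iff: "x \<in> f -` {v} \<longleftrightarrow> x \<in> C v" if "v \<in> S" for v
        using \<open>x \<notin> (\<Union>v\<in>S. ?D v)\<close> that by blast
      have "f x \<in> S" by (simp add: S_def)
      then show ?thesis
        unfolding f'_def using iff by (intro some_equality) auto
    qed
    have sub: "{x. f x \<noteq> f' x} \<subseteq> (\<Union>v\<in>S. ?D v)"
    proof (rule subsetI, rule ccontr)
      fix x assume "x \<in> {x. f x \<noteq> f' x}" "x \<notin> (\<Union>v\<in>S. ?D v)"
      with agree[OF this(2)] show False by simp
    qed
    have "(\<Union>v\<in>S. ?D v) \<in> sets \<mu>" by (intro sets.finite_UN S D)
    then have "prob {x. f x \<noteq> f' x} \<le> prob (\<Union>v\<in>S. ?D v)"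
      by (rule finite_measure_mono[OF sub])
    also have "\<dots> \<le> (\<Sum>v\<in>S. prob (?D v))"
      by (intro measure_UNION_le S D)
    also have "\<dots> \<le> (\<Sum>v\<in>S. d / real (card S))"
      using C(2) by (intro sum_mono less_imp_le)
    also have "\<dots> = d" using S by simp
    finally show ?thesis .
  qed
  ultimately show ?thesis by blast
qed

text \<open>The coordinate \<open>x 0\<close> induces the partition into one-letter cylinders, the
  standard generator of the full shift.\<close>

definition word_entropy_rate :: real where
  "word_entropy_rate = entropy_rate (\<lambda>x. x 0)"

lemma simple_function_coordinate: "simple_function \<mu> (\<lambda>x. x i)"
  by (rule simple_function_finite_coordinates[of "Suc i"]) (simp add: word_eq_iff)

lemma word_entropy_tendsto: "(\<lambda>n. rv_entropy \<mu> (word n) / real n) \<longlonglongrightarrow> word_entropy_rate"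
  using entropy_rate_tendsto[OF simple_function_coordinate, of 0]
  by (simp add: word_eq_itinerary word_entropy_rate_def)

lemma word_entropy_rate_nonneg: "0 \<le> word_entropy_rate"
  using entropy_rate_nonneg[OF simple_function_coordinate, of 0] by (simp add: word_entropy_rate_def)

text \<open>
  If \<open>f'\<close> depends on finitely many coordinates and equals \<open>f\<close> off a small set, then the itinerary
  of \<open>f\<close> is determined by that of \<open>f'\<close> and by that of the correction \<open>c\<close>, which is almost constant.
\<close>

lemma entropy_rate_le_word_entropy_rate:
  assumes f: "simple_function \<mu> f"
  shows "entropy_rate f \<le> word_entropy_rate"
proof (rule field_le_epsilon)
  fix e :: real assume e: "e > 0"
  \<comment> \<open>The correction \<open>c\<close> below takes the values of \<open>f\<close>,
    wrapped in \<open>Some\<close>, and the additional value \<open>None\<close>.\<close>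
  define N where "N = real (card (range f)) + 1"
  \<comment> \<open>The bound for the entropy of a nearly constant function tends to
    \<open>0\<close> with the size \<open>d\<close> of the exceptional set, so some positive
    \<open>d\<close> brings it below \<open>e\<close>.\<close>
  have "((\<lambda>d. d + N * (2 * sqrt d)) \<longlongrightarrow> 0 + N * (2 * sqrt 0)) (at_right 0)"
    by (intro tendsto_intros)
  then have "\<forall>\<^sub>F d in at_right 0. d + N * (2 * sqrt d) < e"
    using e by (intro order_tendstoD) auto
  then have "\<forall>\<^sub>F d in at_right (0::real). d > 0 \<and> d + N * (2 * sqrt d) < e"
    using eventually_at_right_less[of "0::real"] by eventually_elim auto
  then obtain d where d: "d > 0" "d + N * (2 * sqrt d) < e"
    using eventually_happens by force
  obtain k f' where f': "\<And>x y. word k x = word k y \<Longrightarrow> f' x = f' y" "prob {x. f x \<noteq> f' x} \<le> d"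
    using simple_function_approx[OF f d(1)] by blast
  define c where "c x = (if f x = f' x then None else Some (f x))" for x
  have sf': "simple_function \<mu> f'" using f'(1) by (rule simple_function_finite_coordinates)
  have sc: "simple_function \<mu> c"
    unfolding c_def[abs_def]
    by (rule simple_function_compose2[OF f sf', of "\<lambda>u v. if u = v then None else Some u"])
  have "card (range c) \<le> card (insert None (Some ` range f))"
    using simple_functionD(1)[OF f] by (intro card_mono) (auto simp: c_def)
  also have "\<dots> \<le> card (range f) + 1"
    using simple_functionD(1)[OF f] by (simp add: card_image)
  finally have "real (card (range c)) \<le> N" by (simp add: N_def)
  moreover have "rv_entropy \<mu> c \<le> d + real (card (c ` space \<mu>)) * (2 * sqrt d)"
    by (rule rv_entropy_le_if_nearly_constant[OF sc, of None]) (use f'(2) in \<open>simp add: c_def cong: conj_cong\<close>)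
  moreover have "0 \<le> 2 * sqrt d" using d by simp
  ultimately have "rv_entropy \<mu> c \<le> d + N * (2 * sqrt d)"
    using mult_right_mono[of "real (card (range c))" N "2 * sqrt d"] unfolding space_eq by linarith
  then have cd: "rv_entropy \<mu> c \<le> e" using d(2) by linarith
  have bound: "rv_entropy \<mu> (itinerary left_shift f n)
      \<le> real n * e + (rv_entropy \<mu> (word n) + rv_entropy \<mu> (word k))" for n
  proof -
    let ?I = "\<lambda>g. itinerary left_shift g n"
    note sI = simple_function_itinerary
    have "?I f x = map2 (\<lambda>u v. case u of None \<Rightarrow> v | Some u \<Rightarrow> u) (?I c x) (?I f' x)" for x
      by (rule nth_equalityI) (auto simp: c_def)
    then have "rv_entropy \<mu> (?I f)
        = rv_entropy \<mu> (\<lambda>x. (\<lambda>(u, v). map2 (\<lambda>u v. case u of None \<Rightarrow> v | Some u \<Rightarrow> u) u v) (?I c x, ?I f' x))"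
      by (simp add: case_prod_beta' flip: fun_eq_iff) (metis (no_types, lifting) ext)
    also have "\<dots> \<le> rv_entropy \<mu> (\<lambda>x. (?I c x, ?I f' x))"
      by (rule rv_entropy_comp_le[OF simple_function_Pair[OF sI[OF sc] sI[OF sf']]])
    also have "\<dots> \<le> rv_entropy \<mu> (?I c) + rv_entropy \<mu> (?I f')"
      by (rule rv_entropy_Pair_le[OF sI[OF sc] sI[OF sf']])
    also have "rv_entropy \<mu> (?I c) \<le> real n * rv_entropy \<mu> c"
      by (rule rv_entropy_itinerary_le[OF sc])
    also have "\<dots> \<le> real n * e" using cd by (intro mult_left_mono) auto
    \<comment> \<open>Each \<open>f'\<close> reads \<open>k\<close> letters, so \<open>n\<close>
      successive values are determined by \<open>n + k\<close> letters. The extra \<open>k\<close>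
      letters cost a constant independent of \<open>n\<close>.\<close>
    also have "rv_entropy \<mu> (?I f') \<le> rv_entropy \<mu> (word (n + k))"
    proof -
      have "?I f' x = ?I f' (extend (word (n + k) x))" for x
        by (rule nth_equalityI) (auto intro!: f'(1) simp: word_eq_iff extend_def)
      then have "?I f' = (\<lambda>x. (\<lambda>w. ?I f' (extend w)) (word (n + k) x))" by blast
      then show ?thesis
        using rv_entropy_comp_le[OF simple_function_word, of "\<lambda>w. ?I f' (extend w)" "n + k"] by simp
    qed
    also have "\<dots> \<le> rv_entropy \<mu> (word n) + rv_entropy \<mu> (word k)"
      unfolding word_eq_itinerary by (rule rv_entropy_itinerary_add_le[OF simple_function_coordinate])
    finally show ?thesis by simp
  qed
  have "(\<lambda>n. rv_entropy \<mu> (word k) / real n) \<longlonglongrightarrow> 0"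
    by (rule real_tendsto_divide_at_top[OF tendsto_const filterlim_real_sequentially])
  then have "(\<lambda>n. e + rv_entropy \<mu> (word n) / real n + rv_entropy \<mu> (word k) / real n)
      \<longlonglongrightarrow> e + word_entropy_rate + 0"
    by (intro tendsto_intros word_entropy_tendsto)
  moreover have "\<forall>n\<ge>1. rv_entropy \<mu> (itinerary left_shift f n) / real n
      \<le> e + rv_entropy \<mu> (word n) / real n + rv_entropy \<mu> (word k) / real n"
  proof (intro allI impI)
    fix n :: nat assume "n \<ge> 1"
    then show "rv_entropy \<mu> (itinerary left_shift f n) / real n
        \<le> e + rv_entropy \<mu> (word n) / real n + rv_entropy \<mu> (word k) / real n"
      using divide_right_mono[OF bound[of n], of "real n"] by (simp add: add_divide_distrib)
  qed
  ultimately have "entropy_rate f \<le> e + word_entropy_rate + 0"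
    by (rule LIMSEQ_le[OF entropy_rate_tendsto[OF f] _ exI])
  then show "entropy_rate f \<le> word_entropy_rate + e" by simp
qed

text \<open>The Kolmogorov-Sinai theorem for the generator of one-letter cylinders: no finite
  partition has a larger rate, and the generator is itself one of the partitions in the
  supremum.\<close>

theorem measure_entropy_eq: "measure_entropy \<mu> left_shift = ereal word_entropy_rate"
proof (rule antisym)
  show "measure_entropy \<mu> left_shift \<le> ereal word_entropy_rate"
    unfolding measure_entropy_def
  proof (rule SUP_least)
    fix P assume "P \<in> {P. finite_measurable_partition \<mu> P}"
    then have P: "finite_measurable_partition \<mu> P" by simp
    then have "\<exists>A. A \<in> P \<and> x \<in> A" for x
      unfolding finite_measurable_partition_def partition_on_def using space_eq by blast
    then obtain f where f: "\<And>x. f x \<in> P \<and> x \<in> f x" by metis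
    show "entropy_wrt_partition \<mu> left_shift P \<le> ereal word_entropy_rate"
      using entropy_wrt_partition_eq[OF f P] entropy_rate_le_word_entropy_rate[of f] by simp
  qed
  define f :: "(nat \<Rightarrow> 'a) \<Rightarrow> (nat \<Rightarrow> 'a) set" where "f x = {y. y 0 = x 0}" for x
  have sf: "simple_function \<mu> f"
    by (rule simple_function_finite_coordinates[of 1]) (simp add: f_def word_eq_iff)
  have "f x \<in> sets \<mu>" for x
    by (rule finite_coordinates_sets[of 1]) (auto simp: f_def word_eq_iff cylindrical_def)
  then have "range f \<subseteq> sets \<mu>" by blast
  moreover have "partition_on UNIV (range f)"
    by (intro partition_onI) (auto simp: f_def disjnt_def)
  ultimately have P: "finite_measurable_partition \<mu> (range f)"
    using simple_functionD(1)[OF sf] by (simp add: finite_measurable_partition_def)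
  have f: "f x \<in> range f \<and> x \<in> f x" for x by (auto simp: f_def)
  have "rv_entropy \<mu> (word n) \<le> rv_entropy \<mu> (itinerary left_shift f n)" for n
  proof -
    \<comment> \<open>The itinerary consists of atoms rather than letters; the letter of an atom is
      read off from any of its points.\<close>
    have "word n x = map (\<lambda>A. (SOME y. y \<in> A) 0) (itinerary left_shift f n x)" for x
    proof (rule nth_equalityI)
      fix i assume "i < length (word n x)"
      moreover have "(SOME y. y \<in> f z) 0 = z 0" for z
        by (rule someI2[of _ z]) (auto simp: f_def)
      ultimately show "word n x ! i = map (\<lambda>A. (SOME y. y \<in> A) 0) (itinerary left_shift f n x) ! i"
        by simp
    qed simp
    then have "word n = (\<lambda>x. map (\<lambda>A. (SOME y. y \<in> A) 0) (itinerary left_shift f n x))" by blast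
    then show ?thesis
      using rv_entropy_comp_le[OF simple_function_itinerary[OF sf], of "map (\<lambda>A. (SOME y. y \<in> A) 0)" n]
      by simp
  qed
  then have "word_entropy_rate \<le> entropy_rate f"
    by (intro LIMSEQ_le[OF word_entropy_tendsto entropy_rate_tendsto[OF sf]] exI[of _ 0])
       (auto intro!: divide_right_mono)
  then have "ereal word_entropy_rate \<le> entropy_wrt_partition \<mu> left_shift (range f)"
    using entropy_wrt_partition_eq(2)[OF f P] by simp
  also have "\<dots> \<le> measure_entropy \<mu> left_shift"
    unfolding measure_entropy_def using P by (intro SUP_upper) simp
  finally show "ereal word_entropy_rate \<le> measure_entropy \<mu> left_shift" .
qed

end

section \<open>Word probabilities and Markov weights\<close>

context shift_system
begin

definition word_prob :: "'a list \<Rightarrow> real" where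
  "word_prob w = prob {x. word (length w) x = w}"

lemma word_fibre_sets [measurable]: "{x. word n x = w} \<in> sets \<mu>"
  by (rule finite_coordinates_sets[of n]) (simp add: cylindrical_def)

lemma word_prob_nonneg: "0 \<le> word_prob w"
  by (simp add: word_prob_def)

lemma word_prob_le_1: "word_prob w \<le> 1"
  by (simp add: word_prob_def)

lemma integral_word: "(\<integral>x. f (word n x) \<partial>\<mu>) = (\<Sum>w | length w = n. word_prob w * f w)"
proof -
  have "f (word n x) = (\<Sum>w | length w = n. f w * indicator {x. word n x = w} x)" for x
  proof -
    have "(\<Sum>w | length w = n. f w * indicator {x. word n x = w} x)
        = (\<Sum>w | length w = n. if word n x = w then f w else 0)"
      by (intro sum.cong) (auto simp: indicator_def)
    then show ?thesis by (simp add: sum.delta')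
  qed
  then have "(\<integral>x. f (word n x) \<partial>\<mu>)
      = (\<integral>x. (\<Sum>w | length w = n. f w * indicator {x. word n x = w} x) \<partial>\<mu>)"
    by presburger
  also have "\<dots> = (\<Sum>w | length w = n. \<integral>x. f w * indicator {x. word n x = w} x \<partial>\<mu>)"
    by (intro Bochner_Integration.integral_sum integrable_mult_right integrable_real_indicator)
       (auto simp: emeasure_eq_measure)
  also have "\<dots> = (\<Sum>w | length w = n. word_prob w * f w)"
    by (intro sum.cong refl) (auto simp: word_prob_def)
  finally show ?thesis .
qed

lemma rv_entropy_word:
  "rv_entropy \<mu> (word n) = - (\<Sum>w | length w = n. word_prob w * ln (word_prob w))"
proof -
  have "word n -` {w} = {x. word n x = w}" for w :: "'a list" by auto
  then show ?thesis
    by (subst rv_entropy_superset[of "{w. length w = n}"])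
       (auto simp: word_prob_def intro!: sum.cong)
qed

lemma sum_word_prob: "(\<Sum>w | length w = n. word_prob w) = 1"
  using integral_word[of "\<lambda>_. 1" n] prob_space by simp

lemma sum_word_prob_snoc: "(\<Sum>s\<in>UNIV. word_prob (w @ [s])) = word_prob w"
proof -
  let ?A = "\<lambda>s. {x. word (Suc (length w)) x = w @ [s]}"
  have "{x. word (length w) x = w} = (\<Union>s. ?A s)"
    by (auto simp: word_Suc)
  then have "word_prob w = prob (\<Union>s. ?A s)" by (simp add: word_prob_def)
  also have "\<dots> = (\<Sum>s\<in>UNIV. prob (?A s))"
    by (rule finite_measure_finite_Union) (auto simp: disjoint_family_on_def)
  finally show ?thesis by (simp add: word_prob_def)
qed

lemma word_prob_snoc_le: "word_prob (w @ [s]) \<le> word_prob w"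
  unfolding sum_word_prob_snoc[of w, symmetric]
  by (rule member_le_sum) (auto simp: word_prob_nonneg)

text \<open>The increments are the conditional entropies of a letter given the \<open>k\<close>
  preceding ones. If all were at least the rate plus \<open>e\<close>, their averages, and thus
  \<open>rv_entropy \<mu> (word n) / n\<close>, could not converge to the rate.\<close>

lemma entropy_increment_small:
  assumes "e > 0"
  shows "\<exists>k. rv_entropy \<mu> (word (Suc k)) - rv_entropy \<mu> (word k) < word_entropy_rate + e"
proof (rule ccontr)
  let ?H = "\<lambda>n. rv_entropy \<mu> (word n)"
  assume "\<not> ?thesis"
  then have "\<not> ?H (Suc k) - ?H k < word_entropy_rate + e" for k by blast
  then have inc: "?H k + (word_entropy_rate + e) \<le> ?H (Suc k)" for k
    by (smt (verit))
  have "real n * (word_entropy_rate + e) \<le> ?H n" for n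
  proof (induction n)
    case (Suc n)
    then show ?case using inc[of n] by (simp add: algebra_simps)
  qed (simp add: rv_entropy_nonneg)
  then have "\<forall>n\<ge>1. word_entropy_rate + e \<le> ?H n / real n"
    by (simp add: field_simps)
  then have "word_entropy_rate + e \<le> word_entropy_rate"
    by (intro LIMSEQ_le_const[OF word_entropy_tendsto] exI)
  with assms show False by simp
qed

text \<open>On words of length \<open>k + 1\<close>, \<open>q\<close> is the conditional probability
  under \<open>\<mu>\<close> of the last letter given the first \<open>k\<close>, mixed with the
  uniform distribution to become strictly positive. Where the condition has probability zero, the
  uniform distribution is used alone.\<close>

lemma exists_markov_weight:
  assumes e: "e > 0"
  shows "\<exists>k q. (\<forall>w. 0 < q w) \<and> (\<forall>w. length w = k \<longrightarrow> (\<Sum>s\<in>UNIV. q (w @ [s])) = 1) \<and>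
    - (\<integral>x. ln (q (word (Suc k) x)) \<partial>\<mu>) \<le> word_entropy_rate + e"
proof -
  obtain k where k: "rv_entropy \<mu> (word (Suc k)) - rv_entropy \<mu> (word k) < word_entropy_rate + e / 2"
    using entropy_increment_small[of "e / 2"] e by auto
  \<comment> \<open>The mixture keeps a share \<open>1 - d\<close> of the conditional probability,
    so mixing raises \<open>- ln q\<close> by at most \<open>- ln (1 - d) = e / 2\<close>.\<close>
  define d where "d = 1 - exp (- e / 2)"
  have d: "0 < d" "d < 1" "- ln (1 - d) = e / 2" using e by (auto simp: d_def)
  let ?A = "real CARD('a)"
  define q where "q v = (if word_prob (butlast v) > 0
      then (1 - d) * (word_prob v / word_prob (butlast v)) + d / ?A else 1 / ?A)" for v
  have A: "?A > 0" by (simp add: card_gt_0_iff)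
  have q: "0 < q v" for v
    using d A unfolding q_def by (auto intro!: add_nonneg_pos simp: word_prob_nonneg)
  have "(\<Sum>s\<in>UNIV. q (w @ [s])) = 1" for w
  proof (cases "word_prob w > 0")
    case True
    then have "(\<Sum>s\<in>UNIV. q (w @ [s]))
        = (1 - d) * ((\<Sum>s\<in>UNIV. word_prob (w @ [s])) / word_prob w) + d"
      using A by (simp add: q_def sum.distrib sum_divide_distrib sum_distrib_left)
    then show ?thesis using True by (simp add: sum_word_prob_snoc)
  qed (use A in \<open>simp add: q_def\<close>)
  moreover have "- (\<integral>x. ln (q (word (Suc k) x)) \<partial>\<mu>) \<le> word_entropy_rate + e"
  proof -
    \<comment> \<open>Summed over \<open>v\<close>, the right-hand side becomes the entropy
      increment at \<open>k\<close> plus \<open>e / 2\<close>: by consistency, the terms with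
      \<open>butlast v\<close> sum to minus the entropy of the words of length
      \<open>k\<close>.\<close>
    have le: "- (word_prob v * ln (q v))
        \<le> - (word_prob v * ln (word_prob v)) + word_prob v * ln (word_prob (butlast v)) + word_prob v * (e / 2)"
      if "length v = Suc k" for v
    proof (cases "word_prob v = 0")
      case False
      then have pv: "word_prob v > 0" using word_prob_nonneg[of v] by simp
      have "v = butlast v @ [last v]"
        using that by (metis append_butlast_last_id list.size(3) nat.distinct(1))
      then have pb: "word_prob (butlast v) > 0"
        using pv word_prob_snoc_le[of "butlast v" "last v"] by simp
      have "ln ((1 - d) * (word_prob v / word_prob (butlast v))) \<le> ln (q v)"
        using pb pv d A by (subst ln_le_cancel_iff) (auto simp: q_def intro!: add_pos_pos)
      moreover have "ln ((1 - d) * (word_prob v / word_prob (butlast v)))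
          = - e / 2 + ln (word_prob v) - ln (word_prob (butlast v))"
        using pb pv d by (simp add: ln_mult ln_div)
      ultimately have "- ln (q v) \<le> - ln (word_prob v) + ln (word_prob (butlast v)) + e / 2" by simp
      then have "word_prob v * (- ln (q v))
          \<le> word_prob v * (- ln (word_prob v) + ln (word_prob (butlast v)) + e / 2)"
        using pv by (intro mult_left_mono) auto
      then show ?thesis by (simp add: algebra_simps)
    qed simp
    have "- (\<integral>x. ln (q (word (Suc k) x)) \<partial>\<mu>) = (\<Sum>v | length v = Suc k. - (word_prob v * ln (q v)))"
      using integral_word[of "\<lambda>v. ln (q v)" "Suc k"] by (simp add: sum_negf)
    also have "\<dots> \<le> (\<Sum>v | length v = Suc k. - (word_prob v * ln (word_prob v))
        + word_prob v * ln (word_prob (butlast v)) + word_prob v * (e / 2))"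
      using le by (intro sum_mono) auto
    also have "\<dots> = rv_entropy \<mu> (word (Suc k))
        + (\<Sum>v | length v = Suc k. word_prob v * ln (word_prob (butlast v))) + e / 2"
      by (simp add: sum.distrib sum_subtractf rv_entropy_word sum_negf sum_word_prob flip: sum_distrib_right sum_divide_distrib)
    also have "(\<Sum>v | length v = Suc k. word_prob v * ln (word_prob (butlast v))) = - rv_entropy \<mu> (word k)"
      by (simp add: sum_words_Suc rv_entropy_word sum_word_prob_snoc flip: sum_distrib_right)
    finally show ?thesis using k by simp
  qed
  ultimately show ?thesis using q by blast
qed

end

text \<open>The probability of \<open>u\<close> under the order-\<open>k\<close> Markov chain with
  transition weights \<open>q\<close>, except that the first \<open>k\<close> letters carry no
  initial distribution: they receive weight \<open>1\<close>.\<close>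

definition markov_weight :: "nat \<Rightarrow> ('a list \<Rightarrow> real) \<Rightarrow> 'a list \<Rightarrow> real" where
  "markov_weight k q u = (\<Prod>i<length u - k. q (take (Suc k) (drop i u)))"

lemma markov_weight_pos: "(\<And>w. 0 < q w) \<Longrightarrow> 0 < markov_weight k q u"
  by (simp add: markov_weight_def prod_pos)

text \<open>Beyond length \<open>k\<close>, appending a letter adds exactly one window, whose
  weights sum to \<open>1\<close> over that letter. The total thus stays at the number of words of
  length \<open>k\<close>, the price of the missing initial distribution.\<close>

lemma sum_markov_weight_le:
  fixes q :: "'a::finite list \<Rightarrow> real"
  assumes q: "\<And>w. 0 < q w" "\<And>w. length w = k \<Longrightarrow> (\<Sum>s\<in>UNIV. q (w @ [s])) = 1"
  shows "(\<Sum>u | length u = n. markov_weight k q u) \<le> real CARD('a) ^ k"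
proof (induction n)
  case 0
  have "{u :: 'a list. length u = 0} = {[]}" by auto
  moreover have "real CARD('a) \<ge> 1" using card_gt_0_iff[of "UNIV :: 'a set"] by simp
  ultimately show ?case by (simp add: markov_weight_def one_le_power)
next
  case (Suc n)
  show ?case
  proof (cases "n < k")
    case True
    then have "(\<Sum>u :: 'a list | length u = Suc n. markov_weight k q u) = real CARD('a) ^ Suc n"
      by (simp add: markov_weight_def card_words)
    also have "\<dots> \<le> real CARD('a) ^ k"
      using True card_gt_0_iff[of "UNIV :: 'a set"] by (intro power_increasing) auto
    finally show ?thesis .
  next
    case False
    have "markov_weight k q (u @ [s]) = markov_weight k q u * q (drop (n - k) u @ [s])"
      if u: "length u = n" for u s
    proof -
      have "length (u @ [s]) - k = Suc (n - k)" using u False by simp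
      then have "markov_weight k q (u @ [s])
          = (\<Prod>i<n - k. q (take (Suc k) (drop i (u @ [s])))) * q (take (Suc k) (drop (n - k) (u @ [s])))"
        by (simp add: markov_weight_def)
      also have "(\<Prod>i<n - k. q (take (Suc k) (drop i (u @ [s])))) = markov_weight k q u"
        unfolding markov_weight_def u using u by (intro prod.cong) auto
      also have "take (Suc k) (drop (n - k) (u @ [s])) = drop (n - k) u @ [s]"
        using u False by simp
      finally show ?thesis .
    qed
    then have "(\<Sum>u | length u = Suc n. markov_weight k q u)
        = (\<Sum>u | length u = n. markov_weight k q u * (\<Sum>s\<in>UNIV. q (drop (n - k) u @ [s])))"
      by (simp add: sum_words_Suc sum_distrib_left)
    also have "\<dots> = (\<Sum>u | length u = n. markov_weight k q u)"
      using False by (intro sum.cong) (auto simp: q(2))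
    finally show ?thesis using Suc by simp
  qed
qed

lemma ln_markov_weight_word:
  assumes "\<And>w. 0 < q w"
  shows "ln (markov_weight k q (word l ((left_shift ^^ n) x)))
      = (\<Sum>i<l - k. ln (q (word (Suc k) ((left_shift ^^ (n + i)) x))))"
proof -
  have "take (Suc k) (drop i (word l ((left_shift ^^ n) x))) = word (Suc k) ((left_shift ^^ (n + i)) x)"
    if "i < l - k" for i
    using that by (intro nth_equalityI) (auto simp: ac_simps)
  then show ?thesis
    unfolding markov_weight_def by (subst ln_prod) (simp_all add: less_imp_neq[OF assms, symmetric])
qed

lemma sum_lessThan_add:
  fixes g :: "nat \<Rightarrow> 'b::comm_monoid_add"
  shows "(\<Sum>i<n + l. g i) = (\<Sum>i<n. g i) + (\<Sum>i<l. g (n + i))"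
  by (induction l) (simp_all add: ac_simps)

text \<open>The weight omits only the windows starting in the last \<open>k\<close> positions of the
  word. They contribute at most \<open>k\<close> bounded terms, so the error is uniform in the
  position, the length and the point.\<close>

lemma ln_markov_weight_birkhoff:
  fixes q :: "'a::finite list \<Rightarrow> real"
  assumes q: "\<And>w. 0 < q w"
  obtains C where "\<And>n l x. \<bar>ln (markov_weight k q (word l ((left_shift ^^ n) x)))
    - ((\<Sum>i<n + l. ln (q (word (Suc k) ((left_shift ^^ i) x))))
       - (\<Sum>i<n. ln (q (word (Suc k) ((left_shift ^^ i) x)))))\<bar> \<le> C"
proof -
  define B where "B = Max ((\<lambda>w. \<bar>ln (q w)\<bar>) ` {w. length w = Suc k})"
  have B: "\<bar>ln (q (word (Suc k) y))\<bar> \<le> B" for y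
    by (auto simp: B_def intro!: Max_ge)
  then have B0: "0 \<le> B" by (meson abs_ge_zero order_trans)
  have "\<bar>ln (markov_weight k q (word l ((left_shift ^^ n) x)))
    - ((\<Sum>i<n + l. ln (q (word (Suc k) ((left_shift ^^ i) x))))
       - (\<Sum>i<n. ln (q (word (Suc k) ((left_shift ^^ i) x)))))\<bar> \<le> real k * B" for n l x
  proof -
    let ?g = "\<lambda>i. ln (q (word (Suc k) ((left_shift ^^ i) x)))"
    have "(\<Sum>i<l. ?g (n + i)) = (\<Sum>i<l - k. ?g (n + i)) + (\<Sum>i\<in>{l - k..<l}. ?g (n + i))"
      by (subst sum.union_disjoint[symmetric]) (auto intro!: sum.cong)
    moreover have "\<bar>\<Sum>i\<in>{l - k..<l}. ?g (n + i)\<bar> \<le> (\<Sum>i\<in>{l - k..<l}. B)"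
      by (rule order_trans[OF sum_abs]) (intro sum_mono B)
    moreover have "(\<Sum>i\<in>{l - k..<l}. B) \<le> real k * B"
      using B0 by (auto intro!: mult_right_mono)
    ultimately show ?thesis
      unfolding ln_markov_weight_word[OF q] sum_lessThan_add by linarith
  qed
  then show thesis by (rule that)
qed

section \<open>The upper bound\<close>

text \<open>Each point is covered at every sufficiently late level, so for any \<open>N\<close> the
  sets of all levels from \<open>N\<close> on cover \<open>E\<close>. Their total gauge is bounded
  by a tail of the convergent series.\<close>

lemma hausdorff_measure_eq_0I:
  fixes d :: "'x \<Rightarrow> 'x \<Rightarrow> real" and U :: "nat \<Rightarrow> 'k \<Rightarrow> 'x set"
  assumes s: "s > 0" and r: "r \<longlonglongrightarrow> 0" "\<And>n. 0 \<le> r n"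
    and fin: "\<And>n. finite (K n)"
    and diam: "\<And>n k. k \<in> K n \<Longrightarrow> ediam d (U n k) \<le> ennreal (r n)"
    and cover: "\<And>x. x \<in> E \<Longrightarrow> \<forall>\<^sub>F n in sequentially. \<exists>k\<in>K n. x \<in> U n k"
    and summable: "summable (\<lambda>n. real (card (K n)) * r n powr s)"
  shows "hausdorff_measure d s E = 0"
proof -
  have "hausdorff_content d s \<delta> E \<le> ennreal e" if \<delta>: "\<delta> > 0" and e: "e > 0" for \<delta> e
  proof -
    let ?w = "\<lambda>n. real (card (K n)) * r n powr s"
    have "\<forall>\<^sub>F n in sequentially. r n < \<delta>"
      using r \<delta> by (intro order_tendstoD) auto
    then have small: "\<forall>\<^sub>F N in sequentially. \<forall>n\<ge>N. r n < \<delta>"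
      by (rule eventually_all_ge_at_top)
    have "(\<lambda>N. \<Sum>n. ?w (n + N)) \<longlonglongrightarrow> 0"
      by (rule suminf_exist_split2[OF summable])
    then have "\<forall>\<^sub>F N in sequentially. (\<Sum>n. ?w (n + N)) < e"
      using e by (intro order_tendstoD) auto
    then obtain N where N: "\<And>n. n \<ge> N \<Longrightarrow> r n < \<delta>" "(\<Sum>n. ?w (n + N)) < e"
      using eventually_happens[OF eventually_conj[OF small]] sequentially_bot by blast
    have "\<exists>f. bij_betw f {..<card (K n)} (K n)" for n
      using ex_bij_betw_nat_finite[OF fin[of n]] by (simp add: lessThan_atLeast0)
    then obtain f where f: "\<And>n. bij_betw (f n) {..<card (K n)} (K n)" by metis
    \<comment> \<open>Each level is padded with empty sets, whose gauge is \<open>0\<close>, to an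
      infinite row; \<open>prod_decode\<close> then arranges the double array as one
      sequence.\<close>
    define V where "V = (\<lambda>(n, i). if i < card (K (n + N)) then U (n + N) (f (n + N) i) else {})"
    have V: "ediam d (V (n, i)) \<le> ennreal (r (n + N))" for n i
    proof (cases "i < card (K (n + N))")
      case True
      then show ?thesis
        using diam[of "f (n + N) i" "n + N"] bij_betwE[OF f[of "n + N"]] by (simp add: V_def)
    qed (simp add: V_def ediam_def)
    have dp: "diam_power d s (V (n, i)) \<le> (if i < card (K (n + N)) then ennreal (r (n + N) powr s) else 0)"
      for n i
    proof (cases "i < card (K (n + N)) \<and> V (n, i) \<noteq> {}")
      case True
      have "enn2real (ediam d (V (n, i))) \<le> r (n + N)"
        using V[of n i] r(2) enn2real_mono[OF V[of n i]] by (simp add: ennreal_less_top)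
      then show ?thesis
        using True s by (simp add: diam_power_def ennreal_leI powr_mono2)
    next
      case False
      then show ?thesis by (auto simp: diam_power_def V_def)
    qed
    have "E \<subseteq> (\<Union>j. V (prod_decode j))"
    proof
      fix x assume "x \<in> E"
      then obtain n k where nk: "n \<ge> N" "k \<in> K n" "x \<in> U n k"
        using cover[of x] unfolding eventually_sequentially by (meson le_cases)
      then obtain i where i: "i < card (K n)" "f n i = k"
        using f[of n] by (auto simp: bij_betw_def image_iff set_eq_iff) (metis image_eqI imageE lessThan_iff)
      have "x \<in> V (prod_decode (prod_encode (n - N, i)))"
        using nk i by (simp add: V_def)
      then show "x \<in> (\<Union>j. V (prod_decode j))" by blast
    qed
    moreover have "ediam d (V (prod_decode j)) \<le> ennreal \<delta>" for j
    proof (cases "prod_decode j")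
      case (Pair n i)
      then show ?thesis
        using V[of n i] N(1)[of "n + N"] by (auto intro: order_trans ennreal_leI less_imp_le)
    qed
    ultimately have "hausdorff_content d s \<delta> E \<le> (\<Sum>j. diam_power d s (V (prod_decode j)))"
      unfolding hausdorff_content_def by (intro INF_lower2[of "\<lambda>j. V (prod_decode j)"]) auto
    also have "\<dots> = (\<Sum>n. \<Sum>i. diam_power d s (V (n, i)))"
      by (rule suminf_ennreal_2dimen[of _ "\<lambda>p. diam_power d s (V p)"]) simp
    also have "\<dots> \<le> (\<Sum>n. ennreal (?w (n + N)))"
    proof (rule suminf_le)
      fix n
      have "(\<Sum>i. diam_power d s (V (n, i)))
          \<le> (\<Sum>i. if i < card (K (n + N)) then ennreal (r (n + N) powr s) else 0)"
        by (intro suminf_le dp) auto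
      also have "\<dots> = (\<Sum>i<card (K (n + N)). ennreal (r (n + N) powr s))"
        by (subst suminf_finite[of "{..<card (K (n + N))}"]) auto
      also have "\<dots> = ennreal (?w (n + N))"
        by (simp add: ennreal_mult ennreal_of_nat_eq_real_of_nat)
      finally show "(\<Sum>i. diam_power d s (V (n, i))) \<le> ennreal (?w (n + N))" .
    qed auto
    also have "\<dots> = ennreal (\<Sum>n. ?w (n + N))"
      using summable by (intro suminf_ennreal2) (auto simp: summable_iff_shift[of ?w])
    also have "\<dots> \<le> ennreal e" using N(2) by (intro ennreal_leI) simp
    finally show ?thesis .
  qed
  then have "hausdorff_content d s \<delta> E = 0" if "\<delta> > 0" for \<delta>
  proof -
    have "hausdorff_content d s \<delta> E \<le> 0"
      by (rule ennreal_le_epsilon) (simp add: that \<open>\<And>\<delta> e. \<lbrakk>0 < \<delta>; 0 < e\<rbrakk> \<Longrightarrow> hausdorff_content d s \<delta> E \<le> ennreal e\<close>)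
    then show ?thesis by simp
  qed
  then show ?thesis by (simp add: hausdorff_measure_def)
qed

text \<open>The least \<open>m\<close> with \<open>exp (- m / (a + b)) \<le> exp (- n / a)\<close>:
  the number of image letters that must agree for the second term of the metric to be at most
  \<open>exp (- n / a)\<close>.\<close>

definition factor_length :: "real \<Rightarrow> real \<Rightarrow> nat \<Rightarrow> nat" where
  "factor_length a b n = nat \<lceil>real n * (a + b) / a\<rceil>"

lemma factor_length_bounds:
  assumes "a > 0" "b \<ge> 0"
  shows "real n * (a + b) / a \<le> real (factor_length a b n)"
    and "real (factor_length a b n) \<le> real n * (a + b) / a + 1"
    and "n \<le> factor_length a b n"
proof -
  have nn: "0 \<le> real n * (a + b) / a" using assms by simp
  show 1: "real n * (a + b) / a \<le> real (factor_length a b n)"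
    unfolding factor_length_def by (rule real_nat_ceiling_ge)
  show "real (factor_length a b n) \<le> real n * (a + b) / a + 1"
    unfolding factor_length_def using nn by linarith
  have "real n * a / a \<le> real n * (a + b) / a"
    using assms by (intro divide_right_mono mult_left_mono) auto
  then have "real n \<le> real (factor_length a b n)" using 1 assms by simp
  then show "n \<le> factor_length a b n" by simp
qed

lemma factor_length_tendsto:
  assumes "a > 0" "b \<ge> 0"
  shows "(\<lambda>n. real (factor_length a b n) / real n) \<longlonglongrightarrow> (a + b) / a"
proof (rule tendsto_sandwich)
  show "(\<lambda>n. (a + b) / a) \<longlonglongrightarrow> (a + b) / a" by simp
  have "(\<lambda>n. (a + b) / a + 1 / real n) \<longlonglongrightarrow> (a + b) / a + 0"
    by (intro tendsto_intros lim_1_over_n)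
  then show "(\<lambda>n. (a + b) / a + 1 / real n) \<longlonglongrightarrow> (a + b) / a" by simp
  show "\<forall>\<^sub>F n in sequentially. (a + b) / a \<le> real (factor_length a b n) / real n"
  proof (rule eventually_sequentiallyI)
    fix n :: nat assume n: "1 \<le> n"
    then show "(a + b) / a \<le> real (factor_length a b n) / real n"
      using factor_length_bounds(1)[OF assms, of n] by (simp add: pos_le_divide_eq mult.commute)
  qed
  show "\<forall>\<^sub>F n in sequentially. real (factor_length a b n) / real n \<le> (a + b) / a + 1 / real n"
  proof (rule eventually_sequentiallyI)
    fix n :: nat assume n: "1 \<le> n"
    then have "real (factor_length a b n) / real n \<le> (real n * (a + b) / a + 1) / real n"
      using factor_length_bounds(2)[OF assms, of n] by (intro divide_right_mono) auto
    also have "\<dots> = (a + b) / a + 1 / real n" using n by (simp add: add_divide_distrib)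
    finally show "real (factor_length a b n) / real n \<le> (a + b) / a + 1 / real n" .
  qed
qed

lemma tendsto_average_factor_length:
  fixes S :: "nat \<Rightarrow> real"
  assumes ab: "a > 0" "b \<ge> 0" and S: "(\<lambda>n. S n / real n) \<longlonglongrightarrow> I"
  shows "(\<lambda>n. S (factor_length a b n) / real n) \<longlonglongrightarrow> (a + b) / a * I"
proof -
  let ?m = "factor_length a b"
  have "filterlim ?m at_top sequentially"
    by (rule filterlim_at_top_mono[OF filterlim_ident]) (simp add: factor_length_bounds(3)[OF ab])
  then have "(\<lambda>n. S (?m n) / real (?m n)) \<longlonglongrightarrow> I"
    using S by (rule filterlim_compose[rotated])
  then have "(\<lambda>n. real (?m n) / real n * (S (?m n) / real (?m n))) \<longlonglongrightarrow> (a + b) / a * I"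
    by (intro tendsto_intros factor_length_tendsto ab)
  moreover have "\<forall>\<^sub>F n in sequentially.
      real (?m n) / real n * (S (?m n) / real (?m n)) = S (?m n) / real n"
  proof (rule eventually_sequentiallyI)
    fix n :: nat assume "1 \<le> n"
    then have "?m n > 0" using factor_length_bounds(3)[OF ab, of n] by simp
    then show "real (?m n) / real n * (S (?m n) / real (?m n)) = S (?m n) / real n" by simp
  qed
  ultimately show ?thesis by (rule Lim_transform_eventually)
qed

lemma exp_minus_le:
  assumes "c > 0" "enat n \<le> k"
  shows "exp_minus k c \<le> exp (- real n / c)"
  using exp_minus_antimono[OF assms] by (simp add: exp_minus_def)

lemma (in shift_system) hausdorff_dim_generic_points_le:
  fixes \<pi> :: "(nat \<Rightarrow> 'a) \<Rightarrow> nat \<Rightarrow> 'd::finite"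
  assumes \<pi>: "one_block_factor_map \<pi>" and ab: "a > 0" "b \<ge> 0"
  shows "hausdorff_dim (weighted_dist \<pi> a b) (generic_points \<mu>)
    \<le> ereal (a * word_entropy_rate + b * shift_system.word_entropy_rate (distr \<mu> shift_borel \<pi>))"
proof -
  interpret \<nu>: shift_system "distr \<mu> shift_borel \<pi>" using \<pi> by (rule shift_system_factor)
  obtain p where p: "\<And>x n. \<pi> x n = p (x n)"
    using \<pi> unfolding one_block_factor_map_def by blast
  have \<pi>_cont: "continuous_map shift_topology shift_topology \<pi>"
    using \<pi> by (simp add: one_block_factor_map_def)
  have \<pi>_shift: "\<pi> ((left_shift ^^ i) x) = (left_shift ^^ i) (\<pi> x)" for i x
    by (rule ext) (simp add: p)
  let ?m = "factor_length a b"
  let ?d = "weighted_dist \<pi> a b"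
  define s0 where "s0 = a * word_entropy_rate + b * \<nu>.word_entropy_rate"
  have s0: "0 \<le> s0"
    unfolding s0_def using ab word_entropy_rate_nonneg \<nu>.word_entropy_rate_nonneg by simp
  have "hausdorff_measure ?d (s0 + e) (generic_points \<mu>) = 0" if e: "e > 0" for e
  proof -
    \<comment> \<open>The two approximations together cost \<open>a * h + b * h = e / 4\<close>,
      less than the \<open>e / 2\<close> allowed by the exponent \<open>t\<close> below.\<close>
    define h where "h = e / (4 * (a + b))"
    have h: "h > 0" using e ab by (simp add: h_def)
    obtain k q where q: "\<And>w. 0 < q w" "\<And>w. length w = k \<Longrightarrow> (\<Sum>s\<in>UNIV. q (w @ [s])) = 1"
      "- (\<integral>x. ln (q (word (Suc k) x)) \<partial>\<mu>) \<le> word_entropy_rate + h"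
      using exists_markov_weight[OF h] by blast
    obtain k' q' where q': "\<And>w. 0 < q' w" "\<And>w. length w = k' \<Longrightarrow> (\<Sum>s\<in>UNIV. q' (w @ [s])) = 1"
      "- (\<integral>x. ln (q' (word (Suc k') x)) \<partial>distr \<mu> shift_borel \<pi>) \<le> \<nu>.word_entropy_rate + h"
      using \<nu>.exists_markov_weight[OF h] by blast
    define g where "g x = ln (q (word (Suc k) x))" for x
    define g' where "g' y = ln (q' (word (Suc k') y))" for y
    have g_cont: "continuous_map shift_topology euclideanreal g"
      by (rule continuous_map_finite_coordinates[of "Suc k"]) (simp add: g_def)
    have g'_cont: "continuous_map shift_topology euclideanreal g'"
      by (rule continuous_map_finite_coordinates[of "Suc k'"]) (simp add: g'_def)
    define I where "I = (\<integral>x. g x \<partial>\<mu>)"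
    define I' where "I' = (\<integral>x. g' (\<pi> x) \<partial>\<mu>)"
    have "\<pi> \<in> measurable \<mu> shift_borel"
      using measurable_continuous_shift[OF \<pi>_cont] by (simp only: measurable_cong_sets[OF sets_eq refl])
    then have "I' = (\<integral>y. g' y \<partial>distr \<mu> shift_borel \<pi>)"
      unfolding I'_def by (rule integral_distr[symmetric]) (rule measurable_continuous_real[OF g'_cont])
    then have I': "- I' \<le> \<nu>.word_entropy_rate + h" using q'(3) by (simp add: g'_def)
    have I: "- I \<le> word_entropy_rate + h" using q(3) by (simp add: I_def g_def)
    define W where "W u v = markov_weight k q u * markov_weight k' q' v" for u v
    have W: "0 < W u v" for u v
      unfolding W_def using q(1) q'(1) by (simp add: markov_weight_pos)
    \<comment> \<open>Half of \<open>e\<close> is used for the lower bound on the weights; the other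
      half makes the covering sums decay geometrically.\<close>
    define t where "t = s0 + e / 2"
    \<comment> \<open>Only the image letters from position \<open>n\<close> on need a separate
      prescription; the earlier ones are determined by the first \<open>n\<close> letters of the
      point.\<close>
    define z where "z n x = (left_shift ^^ n) (\<pi> x)" for n x
    have large: "\<forall>\<^sub>F n in sequentially. exp (- real n * t / a) \<le> W (word n x) (word (?m n - n) (z n x))"
      if x: "x \<in> generic_points \<mu>" for x
    proof -
      define S where "S n = (\<Sum>i<n. g ((left_shift ^^ i) x))" for n
      define S' where "S' n = (\<Sum>i<n. g' ((left_shift ^^ i) (\<pi> x)))" for n
      have S: "(\<lambda>n. S n / real n) \<longlonglongrightarrow> I"
        using x g_cont by (simp add: generic_points_def S_def I_def)
      have "continuous_map shift_topology euclideanreal (g' \<circ> \<pi>)"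
        by (rule continuous_map_compose[OF \<pi>_cont g'_cont])
      then have "(\<lambda>n. (\<Sum>i<n. (g' \<circ> \<pi>) ((left_shift ^^ i) x)) / real n) \<longlonglongrightarrow> (\<integral>x. (g' \<circ> \<pi>) x \<partial>\<mu>)"
        using x unfolding generic_points_def by blast
      then have S': "(\<lambda>n. S' n / real n) \<longlonglongrightarrow> I'"
        by (simp add: S'_def I'_def \<pi>_shift)
      obtain C where C: "\<And>n l x. \<bar>ln (markov_weight k q (word l ((left_shift ^^ n) x)))
          - ((\<Sum>i<n + l. g ((left_shift ^^ i) x)) - (\<Sum>i<n. g ((left_shift ^^ i) x)))\<bar> \<le> C"
        using ln_markov_weight_birkhoff[of q k] q(1) unfolding g_def by metis
      obtain C' where C': "\<And>n l x. \<bar>ln (markov_weight k' q' (word l ((left_shift ^^ n) x)))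
          - ((\<Sum>i<n + l. g' ((left_shift ^^ i) x)) - (\<Sum>i<n. g' ((left_shift ^^ i) x)))\<bar> \<le> C'"
        using ln_markov_weight_birkhoff[of q' k'] q'(1) unfolding g'_def by metis
      have lower: "S n + (S' (?m n) - S' n) - (C + C') \<le> ln (W (word n x) (word (?m n - n) (z n x)))" for n
      proof -
        have "ln (W (word n x) (word (?m n - n) (z n x)))
            = ln (markov_weight k q (word n x)) + ln (markov_weight k' q' (word (?m n - n) (z n x)))"
          unfolding W_def using markov_weight_pos[of q, OF q(1)] markov_weight_pos[of q', OF q'(1)]
          by (intro ln_mult_pos)
        moreover have "S n - C \<le> ln (markov_weight k q (word n x))"
          using C[of n 0 x] by (simp add: S_def)
        moreover have "S' (?m n) - S' n - C' \<le> ln (markov_weight k' q' (word (?m n - n) (z n x)))"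
          using C'[of "?m n - n" n "\<pi> x"] factor_length_bounds(3)[OF ab, of n] by (simp add: S'_def z_def)
        ultimately show ?thesis by linarith
      qed
      have "(\<lambda>n. S n / real n + (S' (?m n) / real n - S' n / real n) - (C + C') / real n)
          \<longlonglongrightarrow> I + ((a + b) / a * I' - I') - 0"
        by (intro tendsto_intros S S' tendsto_average_factor_length[OF ab]
          real_tendsto_divide_at_top[OF tendsto_const filterlim_real_sequentially])
      \<comment> \<open>The limit is the growth rate of \<open>ln W\<close>. Since
        \<open>(a + b) / a - 1 = b / a\<close>, multiplying it by \<open>a\<close> gives
        \<open>a * I + b * I'\<close>, which is at least \<open>- s0 - e / 4\<close>.\<close>
      moreover have "- t / a < I + ((a + b) / a * I' - I') - 0"
      proof -
        have "a * (I + ((a + b) / a * I' - I')) = a * I + b * I'"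
          using ab by (simp add: field_simps)
        moreover have "- (a * I) \<le> a * (word_entropy_rate + h)"
          using mult_left_mono[OF I, of a] ab by simp
        moreover have "- (b * I') \<le> b * (\<nu>.word_entropy_rate + h)"
          using mult_left_mono[OF I', of b] ab by simp
        moreover have cancel: "c * (e / (4 * c)) = e / 4" if "c \<noteq> 0" for c :: real
          using that by simp
        have "(a + b) * h = e / 4" unfolding h_def by (rule cancel) (use ab in simp)
        ultimately have "- t < a * (I + ((a + b) / a * I' - I'))"
          using e by (simp add: t_def s0_def algebra_simps)
        from divide_strict_right_mono[OF this ab(1)] show ?thesis using ab(1) by simp
      qed
      ultimately have "\<forall>\<^sub>F n in sequentially.
          - t / a < S n / real n + (S' (?m n) / real n - S' n / real n) - (C + C') / real n"
        by (rule order_tendstoD)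
      then show ?thesis
        using eventually_gt_at_top[of 0]
      proof eventually_elim
        case (elim n)
        have "S n / real n + (S' (?m n) / real n - S' n / real n) - (C + C') / real n
            = (S n + (S' (?m n) - S' n) - (C + C')) / real n"
          by (simp add: add_divide_distrib diff_divide_distrib)
        with elim have "- t / a * real n < S n + (S' (?m n) - S' n) - (C + C')"
          by (simp add: pos_less_divide_eq)
        then have "- real n * t / a \<le> ln (W (word n x) (word (?m n - n) (z n x)))"
          using lower[of n] by (simp add: mult.commute)
        then show ?case using W by (simp add: ln_ge_iff)
      qed
    qed
    \<comment> \<open>Only pairs of large weight are kept: every generic point eventually produces
      such pairs, and there are at most \<open>B * exp (n * t / a)\<close> of them because the
      weights have bounded sum.\<close>
    define K where "K n = {(u, v). length u = n \<and> length v = ?m n - n \<and> exp (- real n * t / a) \<le> W u v}" for n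
    define U where "U n = (\<lambda>(u, v). {x. word n x = u \<and> word (?m n - n) (z n x) = v})" for n
    define r where "r n = exp (- real n / a)" for n
    have KK: "K n \<subseteq> {u. length u = n} \<times> {v. length v = ?m n - n}" for n
      by (auto simp: K_def)
    have fin: "finite (K n)" for n
      by (rule finite_subset[OF KK]) simp
    \<comment> \<open>The product of the bounds for the two weight sums, independent of
      \<open>n\<close>.\<close>
    define B where "B = real CARD('a) ^ k * real CARD('d) ^ k'"
    have card: "real (card (K n)) * exp (- real n * t / a) \<le> B" for n
    proof -
      have "real (card (K n)) * exp (- real n * t / a) = (\<Sum>_\<in>K n. exp (- real n * t / a))" by simp
      also have "\<dots> \<le> (\<Sum>(u, v)\<in>K n. W u v)" by (intro sum_mono) (auto simp: K_def)
      also have "\<dots> \<le> (\<Sum>(u, v)\<in>{u. length u = n} \<times> {v. length v = ?m n - n}. W u v)"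
        using W by (intro sum_mono2 KK) (auto intro: less_imp_le)
      also have "\<dots> = (\<Sum>u | length u = n. markov_weight k q u) * (\<Sum>v | length v = ?m n - n. markov_weight k' q' v)"
        by (simp add: W_def sum_product flip: sum.cartesian_product)
      also have "\<dots> \<le> B"
        unfolding B_def
      proof (rule mult_mono)
        show "0 \<le> (\<Sum>v | length v = ?m n - n. markov_weight k' q' v)"
          by (intro sum_nonneg less_imp_le markov_weight_pos q'(1))
      qed (rule sum_markov_weight_le[OF q(1,2)] sum_markov_weight_le[OF q'(1,2)], assumption?, simp?)+
      finally show ?thesis .
    qed
    show ?thesis
    proof (rule hausdorff_measure_eq_0I[where r = r and K = K and U = U])
      show "s0 + e > 0" using s0 e by simp
      show "r \<longlonglongrightarrow> 0" unfolding r_def using ab by real_asymp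
      show "0 \<le> r n" for n by (simp add: r_def)
      show "finite (K n)" for n by (rule fin)
      show "ediam ?d (U n uv) \<le> ennreal (r n)" if "uv \<in> K n" for n uv
      proof -
        have "?d x y \<le> r n" if "x \<in> U n uv" "y \<in> U n uv" for x y
        proof -
          have 1: "x i = y i" if "i < n" for i
            using \<open>x \<in> U n uv\<close> \<open>y \<in> U n uv\<close> that by (auto simp: U_def word_eq_iff split: prod.splits)
          have "word (?m n - n) (z n x) = word (?m n - n) (z n y)"
            using that by (auto simp: U_def split: prod.splits)
          then have 2: "\<pi> x (i + n) = \<pi> y (i + n)" if "i < ?m n - n" for i
            using that by (simp add: word_eq_iff z_def)
          have "\<pi> x i = \<pi> y i" if "i < ?m n" for i
            using 1[of i] 2[of "i - n"] that by (cases "i < n") (auto simp: p)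
          then have "enat (?m n) \<le> common_prefix (\<pi> x) (\<pi> y)" "enat n \<le> common_prefix x y"
            using 1 by (auto simp: common_prefix_ge_iff)
          then have "exp_minus (common_prefix x y) a \<le> r n"
            "exp_minus (common_prefix (\<pi> x) (\<pi> y)) (a + b) \<le> exp (- real (?m n) / (a + b))"
            unfolding r_def using ab exp_minus_le[of a n "common_prefix x y"]
              exp_minus_le[of "a + b" "?m n" "common_prefix (\<pi> x) (\<pi> y)"] by simp_all
          moreover have "real n / a \<le> real (?m n) / (a + b)"
            using factor_length_bounds(1)[OF ab, of n] ab by (simp add: field_simps)
          then have "exp (- real (?m n) / (a + b)) \<le> r n" by (simp add: r_def)
          ultimately show ?thesis by (simp add: weighted_dist_def)
        qed
        then show ?thesis
          unfolding ediam_def by (intro SUP_least ennreal_leI)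
      qed
      show "\<forall>\<^sub>F n in sequentially. \<exists>uv\<in>K n. x \<in> U n uv" if "x \<in> generic_points \<mu>" for x
        using large[OF that]
      proof eventually_elim
        case (elim n)
        then have "(word n x, word (?m n - n) (z n x)) \<in> K n" by (simp add: K_def)
        moreover have "x \<in> U n (word n x, word (?m n - n) (z n x))" by (simp add: U_def)
        ultimately show ?case by blast
      qed
      have le: "norm (real (card (K n)) * r n powr (s0 + e)) \<le> B * exp (- (e / (2 * a))) ^ n" for n
      proof -
        have "r n powr (s0 + e) = exp (- real n * t / a) * exp (- (e / (2 * a))) ^ n"
          using ab by (simp add: r_def t_def powr_def field_simps flip: exp_of_nat_mult exp_add)
        then show ?thesis
          using mult_right_mono[OF card[of n], of "exp (- (e / (2 * a))) ^ n"] by (simp add: mult.assoc)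
      qed
      have "summable (\<lambda>n. B * exp (- (e / (2 * a))) ^ n)"
        using e ab by (intro summable_mult summable_geometric) simp
      then show "summable (\<lambda>n. real (card (K n)) * r n powr (s0 + e))"
        by (rule summable_comparison_test'[where N = 0]) (rule le)
    qed
  qed
  then have "hausdorff_dim ?d (generic_points \<mu>) \<le> ereal s0 + ereal e" if "e > 0" for e
    unfolding hausdorff_dim_def plus_ereal.simps using that s0 by (intro Inf_lower) force
  then have "hausdorff_dim ?d (generic_points \<mu>) \<le> ereal s0"
    using ereal_le_epsilon2 by blast
  then show ?thesis by (simp add: s0_def)
qed

section \<open>Concatenation of independent blocks\<close>

text \<open>
  Block \<open>j\<close> occupies the positions from \<open>triangle j\<close> on and consists of the first \<open>j + 1\<close> letters
  of \<open>\<omega> j\<close>; since \<open>prod_encode (i, j - i) = triangle j + i\<close>, the pair decoded from a position gives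
  its offset and its block.
\<close>

definition block_index :: "nat \<Rightarrow> nat" where
  "block_index n = (case prod_decode n of (i, k) \<Rightarrow> i + k)"

definition concat_blocks :: "(nat \<Rightarrow> nat \<Rightarrow> 'a) \<Rightarrow> nat \<Rightarrow> 'a" where
  "concat_blocks \<omega> n = (case prod_decode n of (i, k) \<Rightarrow> \<omega> (i + k) i)"

lemma concat_blocks_triangle: "i \<le> j \<Longrightarrow> concat_blocks \<omega> (triangle j + i) = \<omega> j i"
proof -
  assume "i \<le> j"
  then have "triangle j + i = prod_encode (i, j - i)" by (simp add: prod_encode_def)
  then show ?thesis using \<open>i \<le> j\<close> by (simp only: concat_blocks_def prod_encode_inverse) simp
qed

lemma block_index_bounds: "triangle (block_index n) \<le> n" "n < triangle (Suc (block_index n))"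
proof -
  obtain i k where ik: "prod_decode n = (i, k)" by (cases "prod_decode n")
  then have "n = prod_encode (i, k)" using prod_decode_inverse[of n] by simp
  then have "n = triangle (i + k) + i" by (simp add: prod_encode_def)
  then show "triangle (block_index n) \<le> n" "n < triangle (Suc (block_index n))"
    using ik by (auto simp: block_index_def)
qed

lemma triangle_mono: "i \<le> j \<Longrightarrow> triangle i \<le> triangle j"
  by (rule lift_Suc_mono_le[of triangle]) auto

lemma real_triangle: "real (triangle n) = real n * (real n + 1) / 2"
  by (induction n) (simp_all add: field_simps)

lemma triangle_eq_sum: "real (triangle n) = (\<Sum>j<n. real (Suc j))"
  by (induction n) simp_all

lemma filterlim_block_index: "filterlim block_index at_top sequentially"
proof -
  have "K \<le> block_index n" if "triangle K \<le> n" for K n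
  proof (rule ccontr)
    assume "\<not> K \<le> block_index n"
    then have "triangle (Suc (block_index n)) \<le> triangle K" by (intro triangle_mono) auto
    with block_index_bounds(2)[of n] that show False by linarith
  qed
  then show ?thesis
    unfolding filterlim_at_top eventually_sequentially by blast
qed

text \<open>The first \<open>j\<close> blocks fill about \<open>j^2 / 2\<close> positions, so
  position \<open>n\<close> lies in a block of index at most \<open>sqrt (2 * n)\<close>. Errors of
  constant size per block, and one incomplete block, are therefore negligible against
  \<open>n\<close>.\<close>

lemma block_index_small: "(\<lambda>n. real (block_index n) / real n) \<longlonglongrightarrow> 0"
proof (rule tendsto_sandwich[of "\<lambda>_. 0" _ _ "\<lambda>n. sqrt (2 * real n) / real n"])
  have "real (block_index n) \<le> sqrt (2 * real n)" for n
  proof (rule real_le_rsqrt)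
    have "(real (block_index n))\<^sup>2 \<le> 2 * real (triangle (block_index n))"
      by (simp add: real_triangle power2_eq_square algebra_simps)
    also have "\<dots> \<le> 2 * real n" using block_index_bounds(1)[of n] by simp
    finally show "(real (block_index n))\<^sup>2 \<le> 2 * real n" .
  qed
  then show "\<forall>\<^sub>F n in sequentially. real (block_index n) / real n \<le> sqrt (2 * real n) / real n"
    by (intro always_eventually allI divide_right_mono) auto
  show "(\<lambda>n. sqrt (2 * real n) / real n) \<longlonglongrightarrow> 0" by real_asymp
qed auto

lemma triangle_block_index_tendsto:
  "(\<lambda>n. real (triangle (block_index n)) / real n) \<longlonglongrightarrow> 1"
  "(\<lambda>n. real (triangle (Suc (block_index n))) / real n) \<longlonglongrightarrow> 1"
proof -
  let ?q = "\<lambda>n. real (block_index n) / real n"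
  have l: "(\<lambda>n. 1 - ?q n) \<longlonglongrightarrow> 1" "(\<lambda>n. 1 + (?q n + 1 / real n)) \<longlonglongrightarrow> 1"
    using tendsto_diff[OF tendsto_const block_index_small, of 1]
      tendsto_add[OF tendsto_const tendsto_add[OF block_index_small lim_1_over_n], of 1] by simp_all
  have b: "1 - ?q n \<le> real (triangle (block_index n)) / real n"
    "real (triangle (block_index n)) / real n \<le> 1"
    "1 \<le> real (triangle (Suc (block_index n))) / real n"
    "real (triangle (Suc (block_index n))) / real n \<le> 1 + (?q n + 1 / real n)" if "1 \<le> n" for n
  proof -
    let ?J = "block_index n" and ?n = "real n"
    have n: "?n > 0" using that by simp
    have T: "?n \<le> real ?J + real (triangle ?J)" "real (triangle ?J) \<le> ?n"
      "?n \<le> real (triangle (Suc ?J))" "real (triangle (Suc ?J)) \<le> ?n + (real ?J + 1)"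
      using block_index_bounds[of n] by simp_all
    have "1 - ?q n = (?n - real ?J) / ?n" using n by (simp add: diff_divide_distrib)
    also have "\<dots> \<le> real (triangle ?J) / ?n" using T(1) by (intro divide_right_mono) auto
    finally show "1 - ?q n \<le> real (triangle ?J) / ?n" .
    show "real (triangle ?J) / ?n \<le> 1" using T(2) n by simp
    show "1 \<le> real (triangle (Suc ?J)) / ?n" using T(3) n by (simp del: triangle_Suc)
    have "real (triangle (Suc ?J)) / ?n \<le> (?n + (real ?J + 1)) / ?n"
      using T(4) by (intro divide_right_mono) auto
    also have "\<dots> = 1 + (?q n + 1 / ?n)" using n by (simp add: add_divide_distrib)
    finally show "real (triangle (Suc ?J)) / ?n \<le> 1 + (?q n + 1 / ?n)" .
  qed
  show "(\<lambda>n. real (triangle (block_index n)) / real n) \<longlonglongrightarrow> 1"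
    by (rule tendsto_sandwich[OF _ _ l(1) tendsto_const]) (auto intro!: eventually_sequentiallyI b)
  show "(\<lambda>n. real (triangle (Suc (block_index n))) / real n) \<longlonglongrightarrow> 1"
    by (rule tendsto_sandwich[OF _ _ tendsto_const l(2)]) (rule eventually_sequentiallyI, erule b)+
qed

text \<open>Turns averages taken at block ends into averages along all positions. Both ends of the
  block containing \<open>n\<close> are covered: the lower bound adds sums over complete blocks and
  subtracts one that includes the cut block.\<close>

lemma block_sum_tendsto:
  fixes S :: "nat \<Rightarrow> real"
  assumes "(\<lambda>J. S J / real (triangle J)) \<longlonglongrightarrow> c"
  shows "(\<lambda>n. S (block_index n) / real n) \<longlonglongrightarrow> c"
    and "(\<lambda>n. S (Suc (block_index n)) / real n) \<longlonglongrightarrow> c"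
proof -
  have ev: "\<forall>\<^sub>F n in sequentially. 0 < triangle (block_index n)"
    using filterlim_block_index[unfolded filterlim_at_top, rule_format, of 1]
  proof eventually_elim
    case (elim n)
    then show ?case using triangle_mono[of 1 "block_index n"] by simp
  qed
  have "(\<lambda>n. S (block_index n) / real (triangle (block_index n)) * (real (triangle (block_index n)) / real n))
      \<longlonglongrightarrow> c * 1"
    by (intro tendsto_mult triangle_block_index_tendsto filterlim_compose[OF assms filterlim_block_index])
  moreover have "\<forall>\<^sub>F n in sequentially. S (block_index n) / real (triangle (block_index n)) *
      (real (triangle (block_index n)) / real n) = S (block_index n) / real n"
    using ev by eventually_elim simp
  ultimately show "(\<lambda>n. S (block_index n) / real n) \<longlonglongrightarrow> c"
    by (simp add: Lim_transform_eventually)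
  have "filterlim (\<lambda>n. Suc (block_index n)) at_top sequentially"
    by (rule filterlim_compose[OF filterlim_Suc filterlim_block_index])
  then have "(\<lambda>n. S (Suc (block_index n)) / real (triangle (Suc (block_index n))) *
      (real (triangle (Suc (block_index n))) / real n)) \<longlonglongrightarrow> c * 1"
    by (intro tendsto_mult triangle_block_index_tendsto filterlim_compose[OF assms])
  moreover have "S (Suc (block_index n)) / real (triangle (Suc (block_index n))) *
      (real (triangle (Suc (block_index n))) / real n) = S (Suc (block_index n)) / real n" for n
    by (simp del: of_nat_Suc of_nat_add)
  ultimately show "(\<lambda>n. S (Suc (block_index n)) / real n) \<longlonglongrightarrow> c" by simp
qed

text \<open>The Cesaro mean with weights \<open>j + 1\<close>, whose partial sums are the triangular
  numbers; \<open>B\<close> collects the finitely many terms before the ratios come close to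
  \<open>c\<close>.\<close>

lemma triangle_cesaro:
  fixes u :: "nat \<Rightarrow> real"
  assumes "(\<lambda>j. u j / real (Suc j)) \<longlonglongrightarrow> c"
  shows "(\<lambda>J. (\<Sum>j<J. u j) / real (triangle J)) \<longlonglongrightarrow> c"
proof (rule LIMSEQ_I)
  fix e :: real assume e: "e > 0"
  obtain N where N: "\<And>j. j \<ge> N \<Longrightarrow> \<bar>u j / real (Suc j) - c\<bar> < e / 2"
    using LIMSEQ_D[OF assms, of "e / 2"] e by auto
  define B where "B = (\<Sum>j<N. \<bar>u j - c * real (Suc j)\<bar>)"
  have termwise: "\<bar>u j - c * real (Suc j)\<bar> \<le> (if j < N then \<bar>u j - c * real (Suc j)\<bar> else 0) + e / 2 * real (Suc j)" for j
  proof (cases "j < N")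
    case False
    have "\<bar>u j - c * real (Suc j)\<bar> = \<bar>u j / real (Suc j) - c\<bar> * real (Suc j)"
      by (simp add: abs_mult[symmetric, of _ "real (Suc j)", simplified] field_simps del: of_nat_Suc)
    also have "\<dots> \<le> e / 2 * real (Suc j)"
      using N[of j] False by (intro mult_right_mono) auto
    finally show ?thesis using False by simp
  qed (use e in simp)
  have bound: "\<bar>(\<Sum>j<J. u j) - c * real (triangle J)\<bar> \<le> B + e / 2 * real (triangle J)" for J
  proof -
    have "(\<Sum>j<J. u j) - c * real (triangle J) = (\<Sum>j<J. u j - c * real (Suc j))"
      by (simp only: triangle_eq_sum sum_subtractf sum_distrib_left)
    then have "\<bar>(\<Sum>j<J. u j) - c * real (triangle J)\<bar> \<le> (\<Sum>j<J. \<bar>u j - c * real (Suc j)\<bar>)"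
      by (simp only: sum_abs)
    also have "\<dots> \<le> (\<Sum>j<J. (if j < N then \<bar>u j - c * real (Suc j)\<bar> else 0) + e / 2 * real (Suc j))"
      by (intro sum_mono termwise)
    also have "\<dots> = (\<Sum>j<J. if j < N then \<bar>u j - c * real (Suc j)\<bar> else 0) + e / 2 * real (triangle J)"
      by (simp only: triangle_eq_sum sum.distrib sum_distrib_left)
    also have "(\<Sum>j<J. if j < N then \<bar>u j - c * real (Suc j)\<bar> else 0) \<le> B"
    proof -
      have "(\<Sum>j<J. if j < N then \<bar>u j - c * real (Suc j)\<bar> else 0)
          = (\<Sum>j\<in>{j \<in> {..<J}. j < N}. \<bar>u j - c * real (Suc j)\<bar>)"
        by (rule sum.inter_filter[symmetric]) simp
      also have "\<dots> \<le> B" unfolding B_def by (rule sum_mono2) auto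
      finally show ?thesis .
    qed
    finally show ?thesis by simp
  qed
  have "(\<lambda>J. B / (real J * (real J + 1) / 2)) \<longlonglongrightarrow> 0" by real_asymp
  then have "\<forall>\<^sub>F J in sequentially. B / real (triangle J) < e / 2"
    unfolding real_triangle using e by (intro order_tendstoD) auto
  then obtain M where M: "\<And>J. J \<ge> M \<Longrightarrow> B / real (triangle J) < e / 2"
    unfolding eventually_sequentially by blast
  have "norm ((\<Sum>j<J. u j) / real (triangle J) - c) < e" if J: "J \<ge> max M 1" for J
  proof -
    have "triangle J > 0" using triangle_mono[of 1 J] J by simp
    then have T: "real (triangle J) > 0" by simp
    have "(\<Sum>j<J. u j) / real (triangle J) - c = ((\<Sum>j<J. u j) - c * real (triangle J)) / real (triangle J)"
      using T by (simp add: diff_divide_distrib)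
    then have "norm ((\<Sum>j<J. u j) / real (triangle J) - c)
        = \<bar>(\<Sum>j<J. u j) - c * real (triangle J)\<bar> / real (triangle J)"
      by (simp only: real_norm_def abs_divide abs_of_nat)
    also have "\<dots> \<le> (B + e / 2 * real (triangle J)) / real (triangle J)"
      using T by (intro divide_right_mono bound) auto
    also have "\<dots> = B / real (triangle J) + e / 2" using T by (simp add: add_divide_distrib)
    also have "\<dots> < e / 2 + e / 2" using M[of J] J by (intro add_strict_right_mono) auto
    also have "\<dots> = e" by simp
    finally show ?thesis .
  qed
  then show "\<exists>no. \<forall>J\<ge>no. norm ((\<Sum>j<J. u j) / real (triangle J) - c) < e" by blast
qed

section \<open>A strong law for independent blocks of growing length\<close>

context shift_system
begin

abbreviation block_space :: "(nat \<Rightarrow> nat \<Rightarrow> 'a) measure" where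
  "block_space \<equiv> Pi\<^sub>M UNIV (\<lambda>_. \<mu>)"

lemma product_prob_space_blocks: "product_prob_space (\<lambda>_ :: nat. \<mu>)"
  by (intro product_prob_spaceI prob_space_axioms)

lemma prob_space_block_space: "prob_space block_space"
  by (intro prob_space_PiM prob_space_axioms)

lemma space_block_space: "space block_space = UNIV"
  by (simp add: space_PiM)

lemma measurable_block: "(\<lambda>\<omega>. \<omega> j) \<in> measurable block_space \<mu>"
  by (rule measurable_component_singleton) simp

lemma distr_block: "distr block_space \<mu> (\<lambda>\<omega>. \<omega> j) = \<mu>"
  using product_prob_space.PiM_component[OF product_prob_space_blocks, of j UNIV] by simp

text \<open>The joint law of finitely many coordinates is the product of their laws, so the
  coordinates are independent, and this passes to functions of each of them.\<close>

lemma indep_vars_blocks: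
  assumes "J > 0" and F: "\<And>j. F j \<in> borel_measurable \<mu>"
  shows "prob_space.indep_vars block_space (\<lambda>_. borel) (\<lambda>j \<omega>. F j (\<omega> j) :: real) {..<J :: nat}"
proof -
  interpret \<Omega>: prob_space block_space by (rule prob_space_block_space)
  have "\<Omega>.indep_vars (\<lambda>_. \<mu>) (\<lambda>j \<omega>. \<omega> j) {..<J}"
  proof (subst \<Omega>.indep_vars_iff_distr_eq_PiM')
    show "{..<J} \<noteq> {}" using assms(1) by auto
    show "(\<lambda>\<omega>. \<omega> j) \<in> measurable block_space \<mu>" for j by (rule measurable_block)
    have "distr block_space (Pi\<^sub>M {..<J} (\<lambda>_. \<mu>)) (\<lambda>\<omega>. restrict \<omega> {..<J}) = Pi\<^sub>M {..<J} (\<lambda>_. \<mu>)"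
      using product_prob_space.distr_PiM_restrict_finite[OF product_prob_space_blocks, of "{..<J}" UNIV] by simp
    then show "distr block_space (Pi\<^sub>M {..<J} (\<lambda>_. \<mu>)) (\<lambda>\<omega>. \<lambda>j\<in>{..<J}. \<omega> j)
        = Pi\<^sub>M {..<J} (\<lambda>j. distr block_space \<mu> (\<lambda>\<omega>. \<omega> j))"
      by (simp only: distr_block)
  qed
  then show ?thesis
    by (rule \<Omega>.indep_vars_compose2) (rule F)
qed

text \<open>The summands are independent but neither identically distributed nor uniformly bounded.
  Hoeffding's inequality suits the linear growth of their ranges and yields deviation probabilities
  geometric in \<open>J\<close>; Borel-Cantelli concludes.\<close>

lemma block_strong_law:
  fixes F :: "nat \<Rightarrow> (nat \<Rightarrow> 'a) \<Rightarrow> real"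
  assumes F: "\<And>j. F j \<in> borel_measurable \<mu>" and C: "\<And>j x. \<bar>F j x\<bar> \<le> C * real (Suc j)"
    and lim: "(\<lambda>j. (\<integral>x. F j x \<partial>\<mu>) / real (Suc j)) \<longlonglongrightarrow> c"
  shows "AE \<omega> in block_space. (\<lambda>J. (\<Sum>j<J. F j (\<omega> j)) / real (triangle J)) \<longlonglongrightarrow> c"
proof -
  interpret \<Omega>: prob_space block_space by (rule prob_space_block_space)
  \<comment> \<open>A strictly positive replacement for \<open>C\<close>: Hoeffding's inequality is
    applied with a positive sum of squared ranges, and \<open>C\<close> may be zero.\<close>
  define D where "D = \<bar>C\<bar> + 1"
  have D: "D > 0" by (simp add: D_def)
  have FD: "\<bar>F j x\<bar> \<le> D * real (Suc j)" for j x
  proof -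
    have "C * real (Suc j) \<le> D * real (Suc j)" by (intro mult_right_mono) (auto simp: D_def)
    with C[of j x] show ?thesis by linarith
  qed
  have meas: "(\<lambda>\<omega>. F j (\<omega> j)) \<in> borel_measurable block_space" for j
    by (rule measurable_compose[OF measurable_block F])
  define E where "E J = (\<Sum>j<J. \<integral>x. F j x \<partial>\<mu>)" for J
  have exp: "\<Omega>.expectation (\<lambda>\<omega>. F j (\<omega> j)) = (\<integral>x. F j x \<partial>\<mu>)" for j
  proof -
    have "(\<integral>x. F j x \<partial>\<mu>) = (\<integral>x. F j x \<partial>distr block_space \<mu> (\<lambda>\<omega>. \<omega> j))"
      by (simp only: distr_block)
    also have "\<dots> = \<Omega>.expectation (\<lambda>\<omega>. F j (\<omega> j))"
      by (rule integral_distr[OF measurable_block F])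
    finally show ?thesis ..
  qed
  define A where "A e J = {\<omega> \<in> space block_space. \<bar>(\<Sum>j<J. F j (\<omega> j)) - E J\<bar> \<ge> e * real (triangle J)}" for e J
  have A: "A e J \<in> sets block_space" for e J
    unfolding A_def using meas by measurable
  have bound: "\<Omega>.prob (A e J) \<le> 2 * exp (- (e\<^sup>2 / (8 * D\<^sup>2))) ^ J" if e: "e > 0" for e J
  proof (cases "J = 0")
    case True
    then show ?thesis using \<Omega>.prob_le_1[of "A e J"] by (simp add: order_trans[OF \<Omega>.prob_le_1])
  next
    case False
    define V where "V = (\<Sum>j<J. (D * real (Suc j) - - D * real (Suc j))\<^sup>2)"
    interpret H: Hoeffding_ineq block_space "{..<J}" "\<lambda>j \<omega>. F j (\<omega> j)"
      "\<lambda>j. - D * real (Suc j)" "\<lambda>j. D * real (Suc j)" "E J"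
    proof -
      have "indep_interval_bounded_random_variables block_space {..<J} (\<lambda>j \<omega>. F j (\<omega> j))
          (\<lambda>j. - D * real (Suc j)) (\<lambda>j. D * real (Suc j))"
      proof (intro indep_interval_bounded_random_variables.intro
          indep_interval_bounded_random_variables_axioms.intro prob_space_block_space)
        show "\<Omega>.indep_vars (\<lambda>_. borel) (\<lambda>j \<omega>. F j (\<omega> j)) {..<J}"
          using False by (intro indep_vars_blocks F) simp
        show "AE \<omega> in block_space. F j (\<omega> j) \<in> {- D * real (Suc j)..D * real (Suc j)}" for j
          using FD[of j] by (intro always_eventually) (simp add: abs_le_iff minus_le_iff del: of_nat_Suc)
      qed simp
      then show "Hoeffding_ineq block_space {..<J} (\<lambda>j \<omega>. F j (\<omega> j))
          (\<lambda>j. - D * real (Suc j)) (\<lambda>j. D * real (Suc j))"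
        by (rule Hoeffding_ineq.intro)
      show "E J \<equiv> \<Sum>j<J. \<Omega>.expectation (\<lambda>\<omega>. F j (\<omega> j))"
        unfolding exp E_def .
    qed
    have J: "real J \<ge> 1" using False by simp
    have V0: "V > 0"
      unfolding V_def using D False by (intro sum_pos) (auto simp del: of_nat_Suc)
    have "V \<le> (\<Sum>j<J. (2 * D * real J)\<^sup>2)"
      unfolding V_def using D by (intro sum_mono power_mono) (auto simp del: of_nat_Suc intro!: add_nonneg_nonneg)
    then have V: "V \<le> 4 * D\<^sup>2 * real J ^ 3"
      by (simp add: power2_eq_square power3_eq_cube algebra_simps)
    have "\<Omega>.prob (A e J) \<le> 2 * exp (-2 * (e * real (triangle J))\<^sup>2 / V)"
      unfolding A_def V_def using e V0 by (intro H.Hoeffding_ineq_abs_ge) (auto simp: V_def)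
    also have "\<dots> \<le> 2 * exp (- (e\<^sup>2 / (8 * D\<^sup>2))) ^ J"
    proof -
      have "(real J)\<^sup>2 / 2 \<le> real (triangle J)"
        by (simp add: real_triangle power2_eq_square field_simps)
      then have T: "e * ((real J)\<^sup>2 / 2) \<le> e * real (triangle J)" using e by (intro mult_left_mono) auto
      \<comment> \<open>The constant 8 arises from \<open>triangle J \<ge> J^2 / 2\<close> and
        \<open>V \<le> 4 * D^2 * J^3\<close>: the Hoeffding exponent is at least
        \<open>2 * (e * J^2 / 2)^2 / (4 * D^2 * J^3)\<close>.\<close>
      have "real J * (e\<^sup>2 / (8 * D\<^sup>2)) = 2 * (e * ((real J)\<^sup>2 / 2))\<^sup>2 / (4 * D\<^sup>2 * real J ^ 3)"
        using J D by (simp add: field_simps power2_eq_square power3_eq_cube)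
      also have "\<dots> \<le> 2 * (e * real (triangle J))\<^sup>2 / V"
        using V V0 e T by (intro frac_le mult_left_mono power_mono) auto
      finally show ?thesis by (simp add: exp_of_nat_mult[symmetric])
    qed
    finally show ?thesis .
  qed
  \<comment> \<open>Countably many thresholds \<open>1 / (m + 1)\<close> suffice for convergence and
    allow their null sets to be merged.\<close>
  have "AE \<omega> in block_space. \<forall>\<^sub>F J in sequentially. \<omega> \<in> space block_space - A (1 / real (Suc m)) J" for m
  proof (rule borel_cantelli_AE1)
    show "A (1 / real (Suc m)) J \<in> sets block_space" for J by (rule A)
    show "emeasure block_space (A (1 / real (Suc m)) J) < \<infinity>" for J
      by (simp add: \<Omega>.emeasure_eq_measure)
    have "summable (\<lambda>J. 2 * exp (- ((1 / real (Suc m))\<^sup>2 / (8 * D\<^sup>2))) ^ J)"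
      using D by (intro summable_mult summable_geometric) (simp del: of_nat_Suc)
    then show "summable (\<lambda>J. \<Omega>.prob (A (1 / real (Suc m)) J))"
    proof (rule summable_comparison_test'[where N = 0])
      show "norm (\<Omega>.prob (A (1 / real (Suc m)) J)) \<le> 2 * exp (- ((1 / real (Suc m))\<^sup>2 / (8 * D\<^sup>2))) ^ J" for J
        using bound[of "1 / real (Suc m)" J] by (simp del: of_nat_Suc)
    qed
  qed
  then have "AE \<omega> in block_space. \<forall>m. \<forall>\<^sub>F J in sequentially. \<omega> \<in> space block_space - A (1 / real (Suc m)) J"
    unfolding AE_all_countable by blast
  then show ?thesis
  proof eventually_elim
    case (elim \<omega>)
    let ?S = "\<lambda>J. \<Sum>j<J. F j (\<omega> j)"
    have "(\<lambda>J. (?S J - E J) / real (triangle J)) \<longlonglongrightarrow> 0"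
    proof (rule LIMSEQ_I)
      fix r :: real assume "r > 0"
      then obtain m where m: "1 / real (Suc m) < r" using nat_approx_posE by blast
      obtain N where N: "\<And>J. J \<ge> N \<Longrightarrow> \<omega> \<notin> A (1 / real (Suc m)) J"
        using elim[rule_format, of m] unfolding eventually_sequentially by blast
      have "norm ((?S J - E J) / real (triangle J) - 0) < r" if J: "J \<ge> max N 1" for J
      proof -
        have "triangle J > 0" using triangle_mono[of 1 J] J by simp
        then have T: "real (triangle J) > 0" by simp
        have "\<omega> \<notin> A (1 / real (Suc m)) J" using N J by simp
        then have "\<bar>?S J - E J\<bar> < 1 / real (Suc m) * real (triangle J)"
          unfolding A_def space_block_space by simp
        then have "\<bar>?S J - E J\<bar> / real (triangle J) < 1 / real (Suc m)"
          using T by (simp only: pos_divide_less_eq)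
        then show ?thesis using m by (simp add: abs_divide del: of_nat_Suc)
      qed
      then show "\<exists>no. \<forall>J\<ge>no. norm ((?S J - E J) / real (triangle J) - 0) < r" by blast
    qed
    moreover have "(\<lambda>J. E J / real (triangle J)) \<longlonglongrightarrow> c"
      unfolding E_def using lim by (rule triangle_cesaro)
    ultimately have "(\<lambda>J. (?S J - E J) / real (triangle J) + E J / real (triangle J)) \<longlonglongrightarrow> 0 + c"
      by (rule tendsto_add)
    then show ?case by (simp add: diff_divide_distrib)
  qed
qed

end

lemma word_concat_blocks:
  assumes "i + k \<le> Suc j"
  shows "word k ((left_shift ^^ (triangle j + i)) (concat_blocks \<omega>)) = word k ((left_shift ^^ i) (\<omega> j))"
proof -
  have "concat_blocks \<omega> (l + (triangle j + i)) = \<omega> j (l + i)" if "l < k" for l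
  proof -
    have "concat_blocks \<omega> (triangle j + (l + i)) = \<omega> j (l + i)"
      using that assms by (intro concat_blocks_triangle) simp
    then show ?thesis by (simp only: ac_simps)
  qed
  then show ?thesis by (simp add: word_eq_iff)
qed

text \<open>
  Of the \<open>j + 1\<close> windows of length \<open>k\<close> starting in block \<open>j\<close>, at most \<open>k\<close> leave the block.
\<close>

lemma birkhoff_sum_concat_blocks:
  fixes f :: "(nat \<Rightarrow> 'a) \<Rightarrow> real"
  assumes f: "\<And>x y. word k x = word k y \<Longrightarrow> f x = f y" and B: "\<And>x. \<bar>f x\<bar> \<le> B"
  shows "\<bar>(\<Sum>i<n. f ((left_shift ^^ i) (concat_blocks \<omega>)))
      - (\<Sum>j<block_index n. \<Sum>i<Suc j - k. f ((left_shift ^^ i) (\<omega> j)))\<bar>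
    \<le> (real k + 1) * B * real (block_index n)"
proof -
  define g where "g i = f ((left_shift ^^ i) (concat_blocks \<omega>))" for i
  define F where "F j = (\<Sum>i<Suc j - k. f ((left_shift ^^ i) (\<omega> j)))" for j
  have gB: "\<bar>g i\<bar> \<le> B" for i by (simp add: g_def B)
  then have B0: "0 \<le> B" by (meson abs_ge_zero order_trans)
  have sumB: "\<bar>\<Sum>i\<in>A. g (c i)\<bar> \<le> real m * B" if "finite A" "card A \<le> m" for A m and c :: "nat \<Rightarrow> nat"
  proof -
    have "\<bar>\<Sum>i\<in>A. g (c i)\<bar> \<le> (\<Sum>i\<in>A. \<bar>g (c i)\<bar>)" by (rule sum_abs)
    also have "\<dots> \<le> real (card A) * B" using sum_bounded_above[of A "\<lambda>i. \<bar>g (c i)\<bar>" B] gB by simp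
    also have "\<dots> \<le> real m * B" using that B0 by (intro mult_right_mono) auto
    finally show ?thesis .
  qed
  have block: "\<bar>(\<Sum>i<Suc j. g (triangle j + i)) - F j\<bar> \<le> real k * B" for j
  proof -
    have "{..<Suc j} = {..<Suc j - k} \<union> {Suc j - k..<Suc j}" by auto
    then have "(\<Sum>i<Suc j. g (triangle j + i))
        = (\<Sum>i<Suc j - k. g (triangle j + i)) + (\<Sum>i\<in>{Suc j - k..<Suc j}. g (triangle j + i))"
      by (metis (no_types, lifting) finite_atLeastLessThan finite_lessThan ivl_disj_int_one(2)
          sum.union_disjoint)
    also have "(\<Sum>i<Suc j - k. g (triangle j + i)) = F j"
      unfolding F_def g_def by (intro sum.cong refl f word_concat_blocks) auto
    finally show ?thesis using sumB[of "{Suc j - k..<Suc j}" k "\<lambda>i. triangle j + i"] by simp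
  qed
  have blocks: "\<bar>(\<Sum>i<triangle J. g i) - (\<Sum>j<J. F j)\<bar> \<le> real k * B * real J" for J
  proof (induction J)
    case (Suc J)
    have "(\<Sum>i<triangle (Suc J). g i) = (\<Sum>i<triangle J. g i) + (\<Sum>i<Suc J. g (triangle J + i))"
      unfolding triangle_Suc by (rule sum_lessThan_add)
    moreover have "(\<Sum>j<Suc J. F j) = (\<Sum>j<J. F j) + F J" by simp
    moreover have "real k * B * real (Suc J) = real k * B * real J + real k * B" by (simp add: algebra_simps)
    ultimately show ?case using Suc block[of J] by linarith
  qed simp
  \<comment> \<open>The incomplete last block has at most \<open>J\<close> letters, an error of
    \<open>J * B\<close>; together with \<open>k\<close> lost windows in each complete block this
    accounts for the factor \<open>k + 1\<close>.\<close>
  define J where "J = block_index n"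
  have n: "triangle J \<le> n" "n - triangle J \<le> J"
    using block_index_bounds[of n] by (auto simp: J_def)
  have "(\<Sum>i<n. g i) = (\<Sum>i<triangle J. g i) + (\<Sum>i<n - triangle J. g (triangle J + i))"
    using sum_lessThan_add[of g "triangle J" "n - triangle J"] n(1) by simp
  moreover have "\<bar>\<Sum>i<n - triangle J. g (triangle J + i)\<bar> \<le> real J * B"
    using n(2) by (intro sumB) auto
  moreover have "(real k + 1) * B * real J = real k * B * real J + real J * B" by (simp add: algebra_simps)
  ultimately have "\<bar>(\<Sum>i<n. g i) - (\<Sum>j<J. F j)\<bar> \<le> (real k + 1) * B * real J"
    using blocks[of J] by linarith
  then show ?thesis by (simp only: g_def F_def J_def)
qed

context shift_system
begin

text \<open>By invariance, the windows inside block \<open>j\<close> have total mean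
  \<open>j + 1 - k\<close> times the integral of \<open>f\<close> once \<open>j + 1 \<ge> k\<close>.
  Averaging over independent blocks thus recovers the integral even where
  \<open>\<mu>\<close>-typical points would see only one ergodic component.\<close>

lemma AE_birkhoff_finite_coordinates:
  fixes f :: "(nat \<Rightarrow> 'a) \<Rightarrow> real"
  assumes f: "\<And>x y. word k x = word k y \<Longrightarrow> f x = f y"
  shows "AE \<omega> in block_space.
    (\<lambda>n. (\<Sum>i<n. f ((left_shift ^^ i) (concat_blocks \<omega>))) / real n) \<longlonglongrightarrow> (\<integral>x. f x \<partial>\<mu>)"
proof -
  have cont: "continuous_map shift_topology euclideanreal (\<lambda>x. f ((left_shift ^^ i) x))" for i
    by (rule continuous_map_finite_coordinates[of "i + k"], rule f) (simp add: word_eq_iff)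
  have f_meas: "f \<in> borel_measurable shift_borel"
    using measurable_continuous_real[OF cont[of 0]] by simp
  obtain B where B: "\<And>x. \<bar>f x\<bar> \<le> B" using continuous_bounded_shift[OF cont[of 0]] by auto
  then have B0: "0 \<le> B" by (meson abs_ge_zero order_trans)
  define F where "F j x = (\<Sum>i<Suc j - k. f ((left_shift ^^ i) x))" for j x
  have "AE \<omega> in block_space. (\<lambda>J. (\<Sum>j<J. F j (\<omega> j)) / real (triangle J)) \<longlonglongrightarrow> (\<integral>x. f x \<partial>\<mu>)"
  proof (rule block_strong_law)
    show "F j \<in> borel_measurable \<mu>" for j
      unfolding F_def
    proof (rule borel_measurable_sum)
      show "(\<lambda>x. f ((left_shift ^^ i) x)) \<in> borel_measurable \<mu>" for i
        using measurable_continuous_real[OF cont] by (simp only: measurable_cong_sets[OF sets_eq refl])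
    qed
    show "\<bar>F j x\<bar> \<le> B * real (Suc j)" for j x
    proof -
      have "\<bar>F j x\<bar> \<le> (\<Sum>i<Suc j - k. B)"
        unfolding F_def by (rule order_trans[OF sum_abs]) (intro sum_mono B)
      also have "\<dots> \<le> B * real (Suc j)"
        using B0 by (simp add: mult.commute[of B] del: of_nat_Suc) (intro mult_right_mono, auto)
      finally show ?thesis .
    qed
    have int: "(\<integral>x. F j x \<partial>\<mu>) = real (Suc j - k) * (\<integral>x. f x \<partial>\<mu>)" for j
    proof -
      have "(\<integral>x. F j x \<partial>\<mu>) = (\<Sum>i<Suc j - k. \<integral>x. f ((left_shift ^^ i) x) \<partial>\<mu>)"
        unfolding F_def by (intro Bochner_Integration.integral_sum integrable_continuous cont)
      then show ?thesis by (simp only: integral_funpow[OF f_meas] sum_constant card_lessThan)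
    qed
    have "(\<lambda>n. real k / real n) \<longlonglongrightarrow> 0"
      by (rule real_tendsto_divide_at_top[OF tendsto_const filterlim_real_sequentially])
    from tendsto_diff[OF tendsto_const LIMSEQ_Suc[OF this]]
    have "(\<lambda>j. 1 - real k / real (Suc j)) \<longlonglongrightarrow> 1 - 0" .
    moreover have "\<forall>\<^sub>F j in sequentially. 1 - real k / real (Suc j) = real (Suc j - k) / real (Suc j)"
      by (rule eventually_sequentiallyI[of k]) (simp add: of_nat_diff diff_divide_distrib del: of_nat_Suc)
    ultimately have "(\<lambda>j. real (Suc j - k) / real (Suc j)) \<longlonglongrightarrow> 1"
      by (simp add: Lim_transform_eventually del: of_nat_Suc)
    then have "(\<lambda>j. real (Suc j - k) / real (Suc j) * (\<integral>x. f x \<partial>\<mu>)) \<longlonglongrightarrow> 1 * (\<integral>x. f x \<partial>\<mu>)"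
      by (intro tendsto_mult tendsto_const)
    then show "(\<lambda>j. (\<integral>x. F j x \<partial>\<mu>) / real (Suc j)) \<longlonglongrightarrow> (\<integral>x. f x \<partial>\<mu>)"
      by (simp add: int del: of_nat_Suc)
  qed
  then show ?thesis
  proof eventually_elim
    case (elim \<omega>)
    let ?S = "\<lambda>n. \<Sum>i<n. f ((left_shift ^^ i) (concat_blocks \<omega>))"
    let ?T = "\<lambda>n. \<Sum>j<block_index n. F j (\<omega> j)"
    have T: "(\<lambda>n. ?T n / real n) \<longlonglongrightarrow> (\<integral>x. f x \<partial>\<mu>)"
      using elim by (rule block_sum_tendsto(1))
    have "(\<lambda>n. ?S n / real n - ?T n / real n) \<longlonglongrightarrow> 0"
    proof (rule Lim_null_comparison[OF always_eventually])
      show "\<forall>n. norm (?S n / real n - ?T n / real n)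
          \<le> (real k + 1) * B * (real (block_index n) / real n)"
      proof
        fix n
        have "norm (?S n / real n - ?T n / real n) = \<bar>?S n - ?T n\<bar> / real n"
          by (simp only: diff_divide_distrib[symmetric] real_norm_def abs_divide abs_of_nat)
        also have "\<dots> \<le> (real k + 1) * B * real (block_index n) / real n"
          unfolding F_def by (rule divide_right_mono[OF birkhoff_sum_concat_blocks[OF f B]]) simp_all
        finally show "norm (?S n / real n - ?T n / real n) \<le> (real k + 1) * B * (real (block_index n) / real n)"
          by simp
      qed
      show "(\<lambda>n. (real k + 1) * B * (real (block_index n) / real n)) \<longlonglongrightarrow> 0"
        using tendsto_mult[OF tendsto_const block_index_small, of "(real k + 1) * B"] by simp
    qed
    from tendsto_add[OF this T] show ?case by simp
  qed
qed

text \<open>There are countably many words, so one null set serves all word frequencies. Outside it,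
  uniform continuity reduces every continuous function to finitely many of these
  frequencies.\<close>

lemma AE_concat_blocks_generic: "AE \<omega> in block_space. concat_blocks \<omega> \<in> generic_points \<mu>"
proof -
  define f where "f w x = (if word (length w) x = w then 1 else 0 :: real)" for w :: "'a list" and x
  have int: "(\<integral>x. f w x \<partial>\<mu>) = word_prob w" for w
  proof -
    have "f w = indicator {x. word (length w) x = w}" by (auto simp: f_def indicator_def)
    then show ?thesis by (simp add: word_prob_def)
  qed
  have "AE \<omega> in block_space. (\<lambda>n. (\<Sum>i<n. f w ((left_shift ^^ i) (concat_blocks \<omega>))) / real n)
      \<longlonglongrightarrow> word_prob w" for w
    unfolding int[symmetric] by (rule AE_birkhoff_finite_coordinates[of "length w"]) (simp add: f_def)
  then have "AE \<omega> in block_space. \<forall>w. (\<lambda>n. (\<Sum>i<n. f w ((left_shift ^^ i) (concat_blocks \<omega>))) / real n)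
      \<longlonglongrightarrow> word_prob w"
    unfolding AE_all_countable by blast
  then show ?thesis
  proof eventually_elim
    case (elim \<omega>)
    define y where "y i = (left_shift ^^ i) (concat_blocks \<omega>)" for i
    have freq: "(\<lambda>n. (\<Sum>i<n. f w (y i)) / real n) \<longlonglongrightarrow> word_prob w" for w
      using elim by (simp add: y_def)
    have "(\<lambda>n. (\<Sum>i<n. g (y i)) / real n) \<longlonglongrightarrow> (\<integral>x. g x \<partial>\<mu>)"
      if g: "continuous_map shift_topology euclideanreal g" for g
    proof (rule LIMSEQ_I)
      fix r :: real assume r: "r > 0"
      \<comment> \<open>The three thirds of \<open>r\<close> pay for replacing \<open>g\<close> by a
        function of words in the average, for the same replacement in the integral, and for the
        convergence of the word frequencies.\<close>
      obtain k where k: "\<And>x y. word k x = word k y \<Longrightarrow> \<bar>g x - g y\<bar> < r / 3"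
        using uniformly_continuous_shift[OF g, of "r / 3"] r by auto
      define G where "G w = g (extend w)" for w
      have G: "\<bar>g x - G (word k x)\<bar> \<le> r / 3" for x
        unfolding G_def by (rule less_imp_le, rule k) simp
      have Gf: "G (word k x) = (\<Sum>w | length w = k. G w * f w x)" for x
      proof -
        have "(\<Sum>w | length w = k. G w * f w x) = (\<Sum>w | length w = k. if word k x = w then G w else 0)"
          by (intro sum.cong) (auto simp: f_def)
        then show ?thesis by (simp add: sum.delta')
      qed
      define I where "I = (\<integral>x. G (word k x) \<partial>\<mu>)"
      define a where "a n = (\<Sum>i<n. G (word k (y i))) / real n" for n
      have a: "a n = (\<Sum>w | length w = k. G w * ((\<Sum>i<n. f w (y i)) / real n))" for n
      proof -
        have "(\<Sum>i<n. G (word k (y i))) = (\<Sum>w | length w = k. \<Sum>i<n. G w * f w (y i))"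
          unfolding Gf by (rule sum.swap)
        then show ?thesis by (simp add: a_def sum_divide_distrib sum_distrib_left)
      qed
      have "a \<longlonglongrightarrow> (\<Sum>w | length w = k. G w * word_prob w)"
        unfolding a by (intro tendsto_sum tendsto_mult tendsto_const freq)
      also have "(\<Sum>w | length w = k. G w * word_prob w) = I"
        unfolding I_def integral_word by (simp add: mult.commute)
      finally obtain N where N: "\<And>n. n \<ge> N \<Longrightarrow> \<bar>a n - I\<bar> < r / 3"
        using LIMSEQ_D[of a I "r / 3"] r by auto
      have "continuous_map shift_topology euclideanreal (\<lambda>x. G (word k x))"
        by (rule continuous_map_finite_coordinates[of k]) simp
      then have iG: "integrable \<mu> (\<lambda>x. G (word k x))" by (rule integrable_continuous)
      have ig: "integrable \<mu> g" using g by (rule integrable_continuous)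
      have "\<bar>(\<integral>x. g x \<partial>\<mu>) - I\<bar> = \<bar>\<integral>x. g x - G (word k x) \<partial>\<mu>\<bar>"
        unfolding I_def by (simp add: ig iG)
      also have "\<dots> \<le> (\<integral>x. \<bar>g x - G (word k x)\<bar> \<partial>\<mu>)" by (rule integral_abs_bound)
      also have "\<dots> \<le> (\<integral>x. r / 3 \<partial>\<mu>)"
        by (intro integral_mono integrable_abs Bochner_Integration.integrable_diff ig iG integrable_const G)
      also have "\<dots> = r / 3" using prob_space by simp
      finally have I: "\<bar>(\<integral>x. g x \<partial>\<mu>) - I\<bar> \<le> r / 3" .
      have "norm ((\<Sum>i<n. g (y i)) / real n - (\<integral>x. g x \<partial>\<mu>)) < r" if n: "n \<ge> max N 1" for n
      proof -
        have "\<bar>(\<Sum>i<n. g (y i)) - (\<Sum>i<n. G (word k (y i)))\<bar> \<le> (\<Sum>i<n. \<bar>g (y i) - G (word k (y i))\<bar>)"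
          unfolding sum_subtractf[symmetric] by (rule sum_abs)
        also have "\<dots> \<le> real n * (r / 3)"
          using sum_bounded_above[of "{..<n}" "\<lambda>i. \<bar>g (y i) - G (word k (y i))\<bar>" "r / 3"] G by simp
        finally have "\<bar>(\<Sum>i<n. g (y i)) - (\<Sum>i<n. G (word k (y i)))\<bar> / real n \<le> r / 3"
          using n by (simp add: pos_divide_le_eq mult.commute)
        then have "\<bar>(\<Sum>i<n. g (y i)) / real n - a n\<bar> \<le> r / 3"
          by (simp add: a_def abs_divide flip: diff_divide_distrib)
        moreover have "\<bar>a n - I\<bar> < r / 3" using N n by simp
        ultimately show ?thesis using I unfolding real_norm_def by linarith
      qed
      then show "\<exists>no. \<forall>n\<ge>no. norm ((\<Sum>i<n. g (y i)) / real n - (\<integral>x. g x \<partial>\<mu>)) < r" by blast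
    qed
    then show ?case by (simp add: generic_points_def y_def)
  qed
qed

text \<open>
  Truncation bounds the information function, as the strong law requires; the floor is so small that
  by Gibbs' inequality it changes the mean by at most \<open>1\<close>.
\<close>

definition truncated_info :: "'a list \<Rightarrow> real" where
  "truncated_info w = - ln (max (word_prob w) (1 / real CARD('a) ^ (2 * length w)))"

lemma card_alphabet_ge_1: "real CARD('a) \<ge> 1"
  using card_gt_0_iff[of "UNIV :: 'a set"] by simp

text \<open>Truncation can only lower the information, so \<open>exp (- truncated_info w)\<close>
  still dominates the word probability. This is the direction needed to bound the mass of a ball
  from above.\<close>

lemma truncated_info_bounds:
  shows truncated_info_nonneg: "0 \<le> truncated_info w"
    and truncated_info_le: "truncated_info w \<le> 2 * ln (real CARD('a)) * real (length w)"
    and word_prob_le_truncated_info: "word_prob w \<le> exp (- truncated_info w)"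
proof -
  let ?m = "max (word_prob w) (1 / real CARD('a) ^ (2 * length w))"
  have fl: "0 < 1 / real CARD('a) ^ (2 * length w)" "1 / real CARD('a) ^ (2 * length w) \<le> 1"
    using card_alphabet_ge_1 by (auto simp: one_le_power)
  have m: "0 < ?m" by (rule less_le_trans[OF fl(1) max.cobounded2])
  have "?m \<le> 1" using fl(2) word_prob_le_1[of w] by (intro max.boundedI)
  with m show "0 \<le> truncated_info w" by (simp add: truncated_info_def)
  show "word_prob w \<le> exp (- truncated_info w)" using m by (simp add: truncated_info_def)
  have "ln (1 / real CARD('a) ^ (2 * length w)) \<le> ln ?m" using fl m by (subst ln_le_cancel_iff) auto
  moreover have "ln (1 / real CARD('a) ^ (2 * length w)) = - (2 * ln (real CARD('a)) * real (length w))"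
    using card_alphabet_ge_1 by (simp add: ln_div ln_realpow)
  ultimately show "truncated_info w \<le> 2 * ln (real CARD('a)) * real (length w)"
    by (simp add: truncated_info_def)
qed

text \<open>Since \<open>ln t \<le> t - 1\<close>, truncating a word of probability \<open>p\<close>
  loses at most \<open>max p fl - p \<le> fl\<close>, where \<open>fl\<close> is the floor. With an
  alphabet of \<open>A\<close> letters there are \<open>A ^ n\<close> words and
  \<open>fl = A ^ (- 2 n)\<close>, so the total loss is at most
  \<open>A ^ (- n) \<le> 1\<close>.\<close>

lemma integral_truncated_info:
  "rv_entropy \<mu> (word n) - 1 \<le> (\<integral>x. truncated_info (word n x) \<partial>\<mu>)"
  "(\<integral>x. truncated_info (word n x) \<partial>\<mu>) \<le> rv_entropy \<mu> (word n)"
proof -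
  let ?fl = "1 / real CARD('a) ^ (2 * n)"
  have fl: "0 < ?fl" using card_alphabet_ge_1 by simp
  have w: "word_prob w * truncated_info w \<le> - (word_prob w * ln (word_prob w))"
    "- (word_prob w * ln (word_prob w)) - ?fl \<le> word_prob w * truncated_info w" if "length w = n" for w
  proof -
    let ?p = "word_prob w"
    have t: "truncated_info w = - ln (max ?p ?fl)" using that by (simp add: truncated_info_def)
    show "?p * truncated_info w \<le> - (?p * ln ?p)"
    proof (cases "?p = 0")
      case False
      then have p: "?p > 0" using word_prob_nonneg[of w] by simp
      then have "ln ?p \<le> ln (max ?p ?fl)" by (subst ln_le_cancel_iff) auto
      then have "?p * ln ?p \<le> ?p * ln (max ?p ?fl)" using p by (intro mult_left_mono) auto
      then show ?thesis by (simp add: t)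
    qed simp
    show "- (?p * ln ?p) - ?fl \<le> ?p * truncated_info w"
    proof (cases "?p = 0")
      case True
      then show ?thesis using fl by simp
    next
      case False
      then have p: "?p > 0" using word_prob_nonneg[of w] by simp
      have "ln (max ?p ?fl) - ln ?p = ln (max ?p ?fl / ?p)" using p fl by (simp add: ln_div)
      also have "\<dots> \<le> max ?p ?fl / ?p - 1" using p fl by (intro ln_le_minus_one) (auto simp: less_max_iff_disj)
      finally have "?p * (ln (max ?p ?fl) - ln ?p) \<le> ?p * (max ?p ?fl / ?p - 1)"
        using p by (intro mult_left_mono) auto
      also have "\<dots> = max ?p ?fl - ?p" using p by (simp add: right_diff_distrib)
      also have "\<dots> \<le> ?fl"
      proof -
        have "max ?p ?fl \<le> ?p + ?fl" using p fl by (intro max.boundedI) linarith+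
        then show ?thesis by linarith
      qed
      finally show ?thesis by (simp add: t right_diff_distrib)
    qed
  qed
  show "(\<integral>x. truncated_info (word n x) \<partial>\<mu>) \<le> rv_entropy \<mu> (word n)"
    unfolding integral_word rv_entropy_word sum_negf[symmetric] using w(1) by (intro sum_mono) auto
  have "(\<Sum>w::'a list | length w = n. ?fl) = 1 / real CARD('a) ^ n"
    by (simp add: card_words power_add mult_2)
  also have "\<dots> \<le> 1" using card_alphabet_ge_1 by (simp add: one_le_power)
  finally have "rv_entropy \<mu> (word n) - 1
      \<le> rv_entropy \<mu> (word n) - (\<Sum>w::'a list | length w = n. ?fl)" by simp
  also have "\<dots> = (\<Sum>w | length w = n. - (word_prob w * ln (word_prob w)) - ?fl)"
    unfolding rv_entropy_word by (simp only: sum_subtractf sum_negf)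
  also have "\<dots> \<le> (\<integral>x. truncated_info (word n x) \<partial>\<mu>)"
    unfolding integral_word using w(2) by (intro sum_mono) auto
  finally show "rv_entropy \<mu> (word n) - 1 \<le> (\<integral>x. truncated_info (word n x) \<partial>\<mu>)" .
qed

lemma integral_truncated_info_tendsto:
  "(\<lambda>j. (\<integral>x. truncated_info (word (Suc j) x) \<partial>\<mu>) / real (Suc j)) \<longlonglongrightarrow> word_entropy_rate"
proof -
  have "(\<lambda>n. rv_entropy \<mu> (word n) / real n - 1 / real n) \<longlonglongrightarrow> word_entropy_rate - 0"
    by (intro tendsto_diff word_entropy_tendsto lim_1_over_n)
  then have l: "(\<lambda>n. rv_entropy \<mu> (word n) / real n - 1 / real n) \<longlonglongrightarrow> word_entropy_rate" by simp
  have "(\<lambda>n. (\<integral>x. truncated_info (word n x) \<partial>\<mu>) / real n) \<longlonglongrightarrow> word_entropy_rate"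
  proof (rule tendsto_sandwich[OF _ _ l word_entropy_tendsto]; intro always_eventually allI)
    show "rv_entropy \<mu> (word n) / real n - 1 / real n
        \<le> (\<integral>x. truncated_info (word n x) \<partial>\<mu>) / real n" for n
      using divide_right_mono[OF integral_truncated_info(1)[of n], of "real n"]
      by (simp add: diff_divide_distrib)
    show "(\<integral>x. truncated_info (word n x) \<partial>\<mu>) / real n \<le> rv_entropy \<mu> (word n) / real n" for n
      by (intro divide_right_mono integral_truncated_info) simp
  qed
  then show ?thesis by (rule LIMSEQ_Suc)
qed

end

section \<open>The lower bound\<close>

text \<open>The mass lives on a parameter space and reaches \<open>E\<close> through
  \<open>\<Phi>\<close>. Measurable supersets \<open>B\<close> stand in for the preimages of balls,
  since nothing is assumed about the measurability of those preimages.\<close>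

lemma mass_distribution_principle:
  fixes d :: "'x \<Rightarrow> 'x \<Rightarrow> real" and \<Phi> :: "'w \<Rightarrow> 'x"
  assumes P: "prob_space P" and A: "A \<in> sets P" "emeasure P A > 0" and \<Phi>: "\<Phi> ` A \<subseteq> E"
    and a: "a > 0" and s: "s \<ge> 0"
    and balls: "\<And>n w. n \<ge> N \<Longrightarrow> w \<in> A \<Longrightarrow> \<exists>B\<in>sets P.
      {v \<in> A. d (\<Phi> v) (\<Phi> w) \<le> exp (- real n / a)} \<subseteq> B \<and> emeasure P B \<le> ennreal (exp (- real n * s / a))"
  shows "hausdorff_measure d s E \<noteq> 0"
proof -
  interpret prob_space P by fact
  define \<delta> where "\<delta> = exp (- real N / a)"
  \<comment> \<open>The cost of passing from an arbitrary diameter to the next larger radius of the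
    form \<open>exp (- n / a)\<close>, which exceeds it by a factor of at most
    \<open>exp (1 / a)\<close>.\<close>
  define c where "c = ennreal (exp (- s / a))"
  have claim: "\<exists>B\<in>sets P. {v \<in> A. \<Phi> v \<in> U} \<subseteq> B \<and> c * emeasure P B \<le> diam_power d s U"
    if U: "ediam d U \<le> ennreal \<delta>" for U
  proof (cases "\<exists>w\<in>A. \<Phi> w \<in> U")
    case False
    then have "{v \<in> A. \<Phi> v \<in> U} = {}" by blast
    then show ?thesis by (intro bexI[of _ "{}"]) simp_all
  next
    case True
    then obtain w where w: "w \<in> A" "\<Phi> w \<in> U" by blast
    define D where "D = enn2real (ediam d U)"
    have "ediam d U < \<top>" using U by (rule le_less_trans) simp
    then have D: "ediam d U = ennreal D" "0 \<le> D" by (simp_all add: D_def)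
    have D\<delta>: "D \<le> \<delta>" using U D by (simp add: ennreal_le_iff \<delta>_def)
    have dD: "d (\<Phi> v) (\<Phi> w) \<le> D" if "\<Phi> v \<in> U" for v
    proof -
      have "ennreal (d (\<Phi> v) (\<Phi> w)) \<le> ediam d U"
        unfolding ediam_def by (rule SUP_upper2[OF that], rule SUP_upper2[OF w(2)]) simp
      then show ?thesis using D by (simp add: ennreal_le_iff)
    qed
    have Une: "U \<noteq> {}" using w by blast
    have small: "\<exists>B\<in>sets P. {v \<in> A. \<Phi> v \<in> U} \<subseteq> B \<and> emeasure P B \<le> ennreal (exp (- real n * s / a))"
      if n: "n \<ge> N" "D \<le> exp (- real n / a)" for n
    proof -
      obtain B where "B \<in> sets P" "{v \<in> A. d (\<Phi> v) (\<Phi> w) \<le> exp (- real n / a)} \<subseteq> B"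
        "emeasure P B \<le> ennreal (exp (- real n * s / a))"
        using balls[OF n(1) w(1)] by blast
      moreover have "{v \<in> A. \<Phi> v \<in> U} \<subseteq> {v \<in> A. d (\<Phi> v) (\<Phi> w) \<le> exp (- real n / a)}"
        using dD n(2) order_trans by blast
      ultimately show ?thesis by blast
    qed
    \<comment> \<open>The gauge is \<open>1\<close> for \<open>s = 0\<close>, so the whole space
      serves as \<open>B\<close>. Diameter zero is separate because no largest admissible
      \<open>n\<close> exists then.\<close>
    consider "s = 0" | "s > 0" "D > 0" | "s > 0" "D = 0" using s D(2) by linarith
    then show ?thesis
    proof cases
      case 1
      have "{v \<in> A. \<Phi> v \<in> U} \<subseteq> space P" using sets.sets_into_space[OF A(1)] by blast
      moreover have "c * emeasure P (space P) \<le> diam_power d s U"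
        using 1 Une by (simp add: c_def diam_power_def emeasure_space_1)
      ultimately show ?thesis by blast
    next
      case 2
      \<comment> \<open>The largest \<open>n\<close> with
        \<open>D \<le> exp (- n / a)\<close>.\<close>
      define n where "n = nat \<lfloor>- a * ln D\<rfloor>"
      have "ln D \<le> ln \<delta>" using 2 D\<delta> by (subst ln_le_cancel_iff) (auto simp: \<delta>_def)
      then have "ln D \<le> - real N / a" by (simp add: \<delta>_def)
      from mult_left_mono[OF this, of a] have N: "real N \<le> - a * ln D" using a by simp
      then have n: "real n \<le> - a * ln D" "- a * ln D < real n + 1"
        unfolding n_def by linarith+
      have "N \<le> n" unfolding n_def using N by (simp add: le_nat_floor)
      moreover have "a * ln D / a \<le> - real n / a" using n(1) a by (intro divide_right_mono) auto
      then have "ln D \<le> - real n / a" using a by simp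
      then have "exp (ln D) \<le> exp (- real n / a)" by (simp only: exp_le_cancel_iff)
      then have "D \<le> exp (- real n / a)" using 2 by simp
      ultimately obtain B where B: "B \<in> sets P" "{v \<in> A. \<Phi> v \<in> U} \<subseteq> B"
        "emeasure P B \<le> ennreal (exp (- real n * s / a))"
        using small by blast
      have "- (real n + 1) / a \<le> a * ln D / a" using n(2) a by (intro divide_right_mono) auto
      then have "- (real n + 1) / a \<le> ln D" using a by simp
      then have "s * (- (real n + 1) / a) \<le> s * ln D" using s by (intro mult_left_mono)
      then have le: "exp (- s / a) * exp (- real n * s / a) \<le> D powr s"
        using 2 a by (simp add: powr_def field_simps flip: exp_add)
      have "c * emeasure P B \<le> c * ennreal (exp (- real n * s / a))"
        using B(3) by (rule mult_left_mono) simp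
      also have "\<dots> = ennreal (exp (- s / a) * exp (- real n * s / a))"
        by (simp add: c_def ennreal_mult)
      also have "\<dots> \<le> ennreal (D powr s)" using le by (rule ennreal_leI)
      also have "\<dots> = diam_power d s U" using 2 Une by (simp add: diam_power_def D_def)
      finally show ?thesis using B by blast
    next
      case 3
      \<comment> \<open>A set of diameter zero fits into balls of every radius, so intersecting
        their supersets gives a null set.\<close>
      have "\<exists>B\<in>sets P. {v \<in> A. \<Phi> v \<in> U} \<subseteq> B \<and> emeasure P B \<le> ennreal (exp (- real (n + N) * s / a))" for n
        using 3 by (intro small) simp_all
      then obtain B where B: "\<And>n. B n \<in> sets P" "\<And>n. {v \<in> A. \<Phi> v \<in> U} \<subseteq> B n"
        "\<And>n. emeasure P (B n) \<le> ennreal (exp (- real (n + N) * s / a))"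
        by metis
      have INT: "(\<Inter>n. B n) \<in> sets P" using B(1) by (intro sets.countable_INT) auto
      have "(\<lambda>n. ennreal (exp (- real (n + N) * s / a))) \<longlonglongrightarrow> ennreal 0"
      proof (rule tendsto_ennrealI)
        show "(\<lambda>n. exp (- real (n + N) * s / a)) \<longlonglongrightarrow> 0" using 3 a by real_asymp
      qed
      moreover have "emeasure P (\<Inter>n. B n) \<le> ennreal (exp (- real (n + N) * s / a))" for n
        using emeasure_mono[of "\<Inter>n. B n" "B n" P] B(1,3) by (meson INT_lower UNIV_I order_trans)
      ultimately have "emeasure P (\<Inter>n. B n) \<le> ennreal 0"
        by (intro LIMSEQ_le_const) auto
      then have "c * emeasure P (\<Inter>n. B n) \<le> diam_power d s U" by simp
      then show ?thesis using INT B(2) by blast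
    qed
  qed
  have "c * emeasure P A \<le> hausdorff_content d s \<delta> E"
    unfolding hausdorff_content_def
  proof (rule INF_greatest)
    fix U :: "nat \<Rightarrow> 'x set" assume "U \<in> {U. E \<subseteq> (\<Union>i. U i) \<and> (\<forall>i. ediam d (U i) \<le> ennreal \<delta>)}"
    then have U: "E \<subseteq> (\<Union>i. U i)" "\<And>i. ediam d (U i) \<le> ennreal \<delta>" by auto
    have "\<exists>B\<in>sets P. {v \<in> A. \<Phi> v \<in> U i} \<subseteq> B \<and> c * emeasure P B \<le> diam_power d s (U i)" for i
      by (rule claim[OF U(2)])
    then obtain B where B: "\<And>i. B i \<in> sets P" "\<And>i. {v \<in> A. \<Phi> v \<in> U i} \<subseteq> B i"
      "\<And>i. c * emeasure P (B i) \<le> diam_power d s (U i)"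
      by metis
    have "A \<subseteq> (\<Union>i. B i)"
    proof
      fix v assume v: "v \<in> A"
      then obtain i where "\<Phi> v \<in> U i" using \<Phi> U(1) by blast
      with v B(2)[of i] show "v \<in> (\<Union>i. B i)" by blast
    qed
    then have "emeasure P A \<le> emeasure P (\<Union>i. B i)"
      using B(1) by (intro emeasure_mono sets.countable_UN) auto
    also have "\<dots> \<le> (\<Sum>i. emeasure P (B i))"
      using B(1) by (intro emeasure_subadditive_countably) auto
    finally have "c * emeasure P A \<le> c * (\<Sum>i. emeasure P (B i))" by (rule mult_left_mono) simp
    also have "\<dots> = (\<Sum>i. c * emeasure P (B i))" by (rule ennreal_suminf_cmult[symmetric])
    also have "\<dots> \<le> (\<Sum>i. diam_power d s (U i))" by (intro suminf_le B(3)) auto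
    finally show "c * emeasure P A \<le> (\<Sum>i. diam_power d s (U i))" .
  qed
  also have "\<dots> \<le> hausdorff_measure d s E"
    unfolding hausdorff_measure_def by (rule SUP_upper) (simp add: \<delta>_def)
  finally have "c * emeasure P A \<le> hausdorff_measure d s E" .
  moreover have "0 < c * emeasure P A" using A(2) by (simp add: c_def ennreal_zero_less_mult_iff)
  ultimately show ?thesis by auto
qed

text \<open>Prefix lengths are integers, so a common image prefix of length at least
  \<open>n * (a + b) / a\<close> is at least as long as the rounded-up
  \<open>factor_length\<close>.\<close>

lemma weighted_dist_le_expD:
  assumes ab: "a > 0" "b \<ge> 0" and le: "weighted_dist \<pi> a b x y \<le> exp (- real n / a)"
  shows "word n x = word n y"
    and "word (factor_length a b n) (\<pi> x) = word (factor_length a b n) (\<pi> y)"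
proof -
  have long: "c * (real n / a) \<le> real l" if "exp_minus (enat l) c \<le> exp (- real n / a)" "c > 0" for l c
    using that by (simp add: exp_minus_def pos_le_divide_eq mult.commute)
  have "enat n \<le> common_prefix x y"
  proof (cases "common_prefix x y")
    case (enat l)
    then show ?thesis using long[of l a] le ab by (simp add: weighted_dist_def)
  qed simp
  then show "word n x = word n y" by (simp add: common_prefix_ge_iff word_eq_iff)
  have "enat (factor_length a b n) \<le> common_prefix (\<pi> x) (\<pi> y)"
  proof (cases "common_prefix (\<pi> x) (\<pi> y)")
    case (enat l)
    then have "(a + b) * (real n / a) \<le> real l"
      using le ab by (intro long) (simp_all add: weighted_dist_def)
    then show ?thesis
      using enat by (simp add: factor_length_def nat_ceiling_le_eq mult.commute)
  qed simp
  then show "word (factor_length a b n) (\<pi> x) = word (factor_length a b n) (\<pi> y)"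
    by (simp add: common_prefix_ge_iff word_eq_iff)
qed

text \<open>
  Stands in for a metric ball of concatenations; the blocks cut by its two boundaries are ignored.
\<close>

definition block_ball ::
    "((nat \<Rightarrow> 'a) \<Rightarrow> nat \<Rightarrow> 'd) \<Rightarrow> nat \<Rightarrow> nat \<Rightarrow> (nat \<Rightarrow> nat \<Rightarrow> 'a) \<Rightarrow> (nat \<Rightarrow> nat \<Rightarrow> 'a) set" where
  "block_ball \<pi> J K \<omega>' = {\<omega>. \<forall>j\<in>{..<J} \<union> {Suc J..<K}.
     \<omega> j \<in> (if j < J then {x. word (Suc j) x = word (Suc j) (\<omega>' j)}
            else {x. word (Suc j) (\<pi> x) = word (Suc j) (\<pi> (\<omega>' j))})}"

lemma mem_block_ballI:
  assumes p: "\<And>x n. \<pi> x n = p (x n)"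
    and n: "word n (concat_blocks \<omega>) = word n (concat_blocks \<omega>')"
    and m: "word m (\<pi> (concat_blocks \<omega>)) = word m (\<pi> (concat_blocks \<omega>'))"
  shows "\<omega> \<in> block_ball \<pi> (block_index n) (block_index m) \<omega>'"
proof -
  have pos: "triangle j + i < l" if "j < block_index l" "i < Suc j" for i j l
  proof -
    have "triangle (Suc j) \<le> triangle (block_index l)" using that by (intro triangle_mono) simp
    with block_index_bounds(1)[of l] that show ?thesis by simp
  qed
  have 1: "\<omega> j i = \<omega>' j i" if "j < block_index n" "i < Suc j" for i j
    using n pos[OF that] concat_blocks_triangle[of i j \<omega>] concat_blocks_triangle[of i j \<omega>'] that
    by (simp add: word_eq_iff)
  have 2: "p (\<omega> j i) = p (\<omega>' j i)" if "j < block_index m" "i < Suc j" for i j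
  proof -
    have "\<pi> (concat_blocks \<omega>) (triangle j + i) = \<pi> (concat_blocks \<omega>') (triangle j + i)"
      using m pos[OF that] by (simp add: word_eq_iff)
    then show ?thesis
      using concat_blocks_triangle[of i j \<omega>] concat_blocks_triangle[of i j \<omega>'] that by (simp add: p)
  qed
  show ?thesis
    unfolding block_ball_def using 1 2 by (auto simp: word_eq_iff p)
qed

lemma (in shift_system) factor_measurable:
  assumes "one_block_factor_map \<pi>"
  shows "\<pi> \<in> measurable \<mu> shift_borel"
proof -
  have "continuous_map shift_topology shift_topology \<pi>"
    using assms by (simp add: one_block_factor_map_def)
  then show ?thesis
    unfolding measurable_cong_sets[OF sets_eq refl] by (rule measurable_continuous_shift)
qed

lemma (in shift_system) hausdorff_dim_generic_points_ge:
  fixes \<pi> :: "(nat \<Rightarrow> 'a) \<Rightarrow> nat \<Rightarrow> 'd::finite"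
  assumes \<pi>: "one_block_factor_map \<pi>" and ab: "a > 0" "b \<ge> 0"
  shows "ereal (a * word_entropy_rate + b * shift_system.word_entropy_rate (distr \<mu> shift_borel \<pi>))
    \<le> hausdorff_dim (weighted_dist \<pi> a b) (generic_points \<mu>)"
proof -
  interpret \<nu>: shift_system "distr \<mu> shift_borel \<pi>" using \<pi> by (rule shift_system_factor)
  interpret \<Omega>: prob_space block_space by (rule prob_space_block_space)
  obtain p where p: "\<And>x n. \<pi> x n = p (x n)"
    using \<pi> unfolding one_block_factor_map_def by blast
  note \<pi>_meas = factor_measurable[OF \<pi>]
  let ?m = "factor_length a b"
  let ?d = "weighted_dist \<pi> a b"
  define s0 where "s0 = a * word_entropy_rate + b * \<nu>.word_entropy_rate"
  define U where "U j x = truncated_info (word (Suc j) x)" for j x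
  define V where "V j x = \<nu>.truncated_info (word (Suc j) (\<pi> x))" for j x
  have U_meas: "U j \<in> borel_measurable \<mu>" for j
  proof -
    have "continuous_map shift_topology euclideanreal (U j)"
      by (rule continuous_map_finite_coordinates[of "Suc j"]) (simp add: U_def)
    then show ?thesis
      unfolding measurable_cong_sets[OF sets_eq refl] by (rule measurable_continuous_real)
  qed
  have info_meas: "(\<lambda>y. \<nu>.truncated_info (word (Suc j) y)) \<in> borel_measurable shift_borel" for j
    by (rule measurable_continuous_real, rule continuous_map_finite_coordinates[of "Suc j"]) simp
  have V_meas: "V j \<in> borel_measurable \<mu>" for j
    unfolding V_def by (rule measurable_compose[OF \<pi>_meas info_meas])
  have V_int: "(\<integral>x. V j x \<partial>\<mu>) = (\<integral>y. \<nu>.truncated_info (word (Suc j) y) \<partial>distr \<mu> shift_borel \<pi>)" for j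
    unfolding V_def by (rule integral_distr[symmetric, OF \<pi>_meas info_meas])
  have V_nonneg: "0 \<le> V j x" for j x by (simp add: V_def \<nu>.truncated_info_nonneg)
  have U_bound: "\<bar>U j x\<bar> \<le> 2 * ln (real CARD('a)) * real (Suc j)" for j x
    using truncated_info_nonneg truncated_info_le[of "word (Suc j) x"]
    by (simp add: U_def del: of_nat_Suc)
  have V_bound: "\<bar>V j x\<bar> \<le> 2 * ln (real CARD('d)) * real (Suc j)" for j x
    using \<nu>.truncated_info_nonneg \<nu>.truncated_info_le[of "word (Suc j) (\<pi> x)"]
    by (simp add: V_def del: of_nat_Suc)
  have U_lln: "AE \<omega> in block_space. (\<lambda>J. (\<Sum>j<J. U j (\<omega> j)) / real (triangle J)) \<longlonglongrightarrow> word_entropy_rate"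
    by (rule block_strong_law[OF U_meas U_bound]) (simp add: U_def integral_truncated_info_tendsto del: of_nat_Suc)
  have V_lln: "AE \<omega> in block_space. (\<lambda>J. (\<Sum>j<J. V j (\<omega> j)) / real (triangle J)) \<longlonglongrightarrow> \<nu>.word_entropy_rate"
    by (rule block_strong_law[OF V_meas V_bound])
       (simp only: V_int \<nu>.integral_truncated_info_tendsto)
  \<comment> \<open>A lower bound for minus the logarithm of the mass of the ball around
    \<open>\<omega>\<close>. The subtracted sum runs to \<open>Suc (block_index n)\<close> because
    the block cut at position \<open>n\<close> contributes nothing.\<close>
  define Q where "Q n \<omega> = (\<Sum>j<block_index n. U j (\<omega> j))
      + ((\<Sum>j<block_index (?m n). V j (\<omega> j)) - (\<Sum>j<Suc (block_index n). V j (\<omega> j)))" for n \<omega>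
  have Q_meas [measurable]: "Q n \<in> borel_measurable block_space" for n
    unfolding Q_def
    by (intro borel_measurable_add borel_measurable_diff borel_measurable_sum
        measurable_compose[OF measurable_block U_meas] measurable_compose[OF measurable_block V_meas])
  have Q_lim: "AE \<omega> in block_space. (\<lambda>n. Q n \<omega> / real n) \<longlonglongrightarrow> s0 / a"
    using U_lln V_lln
  proof eventually_elim
    case (elim \<omega>)
    have "(\<lambda>n. (\<Sum>j<block_index n. U j (\<omega> j)) / real n + ((\<Sum>j<block_index (?m n). V j (\<omega> j)) / real n
          - (\<Sum>j<Suc (block_index n). V j (\<omega> j)) / real n))
        \<longlonglongrightarrow> word_entropy_rate + ((a + b) / a * \<nu>.word_entropy_rate - \<nu>.word_entropy_rate)"
      by (rule tendsto_add[OF block_sum_tendsto(1)[OF elim(1)] tendsto_diff[OF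
            tendsto_average_factor_length[OF ab block_sum_tendsto(1)[OF elim(2)]]
            block_sum_tendsto(2)[OF elim(2)]]])
    moreover have "word_entropy_rate + ((a + b) / a * \<nu>.word_entropy_rate - \<nu>.word_entropy_rate) = s0 / a"
      using ab by (simp add: s0_def field_simps)
    ultimately show ?case by (simp only: Q_def add_divide_distrib diff_divide_distrib)
  qed
  have ball_meas: "block_ball \<pi> J K \<omega>' \<in> sets block_space"
    and ball_prob: "emeasure block_space (block_ball \<pi> J K \<omega>') \<le> ennreal (exp (-
      ((\<Sum>j<J. U j (\<omega>' j)) + ((\<Sum>j<K. V j (\<omega>' j)) - (\<Sum>j<Suc J. V j (\<omega>' j))))))" for J K \<omega>'
  proof -
    let ?I = "{..<J} \<union> {Suc J..<K}"
    define X where "X j = (if j < J then {x. word (Suc j) x = word (Suc j) (\<omega>' j)}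
            else {x. word (Suc j) (\<pi> x) = word (Suc j) (\<pi> (\<omega>' j))})" for j
    define W where "W j = (if j < J then U j (\<omega>' j) else V j (\<omega>' j))" for j
    have ball: "block_ball \<pi> J K \<omega>' = {\<omega> \<in> space block_space. \<forall>j\<in>?I. \<omega> j \<in> X j}"
      by (simp add: block_ball_def X_def space_block_space)
    have \<nu>_set: "{x. word (Suc j) (\<pi> x) = w} = \<pi> -` {y. word (Suc j) y = w} \<inter> space \<mu>" for j w
      by auto
    have w_set: "{y. word n y = w} \<in> sets (shift_borel :: (nat \<Rightarrow> 'd) measure)" for n w
      using \<nu>.word_fibre_sets[of n w] by simp
    have X: "X j \<in> sets \<mu>" for j
    proof (cases "j < J")
      case True
      then show ?thesis unfolding X_def by (simp only: if_True word_fibre_sets)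
    next
      case False
      then show ?thesis
        unfolding X_def by (simp only: if_False \<nu>_set) (rule measurable_sets[OF \<pi>_meas w_set])
    qed
    have XW: "emeasure \<mu> (X j) \<le> ennreal (exp (- W j))" for j
    proof (cases "j < J")
      case True
      have "prob (X j) = word_prob (word (Suc j) (\<omega>' j))" using True by (simp add: X_def word_prob_def)
      then show ?thesis
        using True word_prob_le_truncated_info by (simp add: emeasure_eq_measure W_def U_def ennreal_leI)
    next
      case False
      have "prob (X j) = measure (distr \<mu> shift_borel \<pi>) {y. word (Suc j) y = word (Suc j) (\<pi> (\<omega>' j))}"
        unfolding measure_distr[OF \<pi>_meas w_set] using False by (simp only: X_def if_False \<nu>_set)
      then have "prob (X j) = \<nu>.word_prob (word (Suc j) (\<pi> (\<omega>' j)))" by (simp add: \<nu>.word_prob_def)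
      then show ?thesis
        using False \<nu>.word_prob_le_truncated_info by (simp add: emeasure_eq_measure W_def V_def ennreal_leI)
    qed
    show "block_ball \<pi> J K \<omega>' \<in> sets block_space"
      unfolding ball
    proof (rule sets.sets_Collect_finite_All)
      fix j assume "j \<in> ?I"
      have "(\<lambda>\<omega>. \<omega> j) -` X j \<inter> space block_space \<in> sets block_space"
        by (rule measurable_sets[OF measurable_block X])
      also have "(\<lambda>\<omega>. \<omega> j) -` X j \<inter> space block_space = {\<omega> \<in> space block_space. \<omega> j \<in> X j}" by auto
      finally show "{\<omega> \<in> space block_space. \<omega> j \<in> X j} \<in> sets block_space" .
    qed simp
    have "emeasure block_space (block_ball \<pi> J K \<omega>') = (\<Prod>j\<in>?I. emeasure \<mu> (X j))"
      unfolding ball by (rule product_prob_space.emeasure_PiM_Collect[OF product_prob_space_blocks]) (auto simp: X)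
    also have "\<dots> \<le> (\<Prod>j\<in>?I. ennreal (exp (- W j)))" by (rule prod_mono_ennreal) (rule XW)
    also have "\<dots> = ennreal (exp (- (\<Sum>j\<in>?I. W j)))"
      by (simp add: prod_ennreal exp_sum[symmetric] sum_negf)
    also have "\<dots> \<le> ennreal (exp (- ((\<Sum>j<J. U j (\<omega>' j))
        + ((\<Sum>j<K. V j (\<omega>' j)) - (\<Sum>j<Suc J. V j (\<omega>' j))))))"
    proof -
      have "(\<Sum>j\<in>?I. W j) = (\<Sum>j<J. W j) + (\<Sum>j\<in>{Suc J..<K}. W j)"
        by (rule sum.union_disjoint) auto
      also have "(\<Sum>j<J. W j) = (\<Sum>j<J. U j (\<omega>' j))" by (simp add: W_def)
      also have "(\<Sum>j\<in>{Suc J..<K}. W j) = (\<Sum>j\<in>{Suc J..<K}. V j (\<omega>' j))"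
        by (intro sum.cong) (auto simp: W_def)
      finally have W: "(\<Sum>j\<in>?I. W j) = (\<Sum>j<J. U j (\<omega>' j)) + (\<Sum>j\<in>{Suc J..<K}. V j (\<omega>' j))" .
      \<comment> \<open>Only an inequality holds in general: for \<open>K \<le> J\<close>, as can
        happen when \<open>b = 0\<close>, the second range of blocks is empty while the difference
        of sums may be negative.\<close>
      have "(\<Sum>j<K. V j (\<omega>' j)) \<le> (\<Sum>j\<in>{..<Suc J} \<union> {Suc J..<K}. V j (\<omega>' j))"
        by (rule sum_mono2) (auto simp: V_nonneg)
      also have "\<dots> = (\<Sum>j<Suc J. V j (\<omega>' j)) + (\<Sum>j\<in>{Suc J..<K}. V j (\<omega>' j))"
        by (rule sum.union_disjoint) auto
      finally show ?thesis unfolding W by (intro ennreal_leI) simp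
    qed
    finally show "emeasure block_space (block_ball \<pi> J K \<omega>') \<le> ennreal (exp (- ((\<Sum>j<J. U j (\<omega>' j))
        + ((\<Sum>j<K. V j (\<omega>' j)) - (\<Sum>j<Suc J. V j (\<omega>' j))))))" .
  qed
  have "s0 \<le> s" if s: "s \<ge> 0" "hausdorff_measure ?d s (generic_points \<mu>) = 0" for s
  proof (rule ccontr)
    assume "\<not> s0 \<le> s"
    then have "s / a < s0 / a" using ab by (simp add: divide_strict_right_mono)
    \<comment> \<open>The mass distribution principle needs one \<open>N\<close> for all centres.
      The almost sure convergence provides an \<open>N\<close> depending on \<open>\<omega>\<close>,
      so some \<open>G N\<close> has positive measure.\<close>
    define G where "G N = {\<omega> \<in> space block_space. \<forall>n. N \<le> n \<longrightarrow> real n * s / a \<le> Q n \<omega>}" for N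
    have G: "G N \<in> sets block_space" for N
      unfolding G_def by measurable
    have "AE \<omega> in block_space. \<omega> \<in> (\<Union>N. G N)"
      using Q_lim
    proof eventually_elim
      case (elim \<omega>)
      have "\<forall>\<^sub>F n in sequentially. s / a < Q n \<omega> / real n"
        using elim \<open>s / a < s0 / a\<close> by (rule order_tendstoD)
      then have "\<forall>\<^sub>F n in sequentially. real n * s / a \<le> Q n \<omega>"
        using eventually_gt_at_top[of 0]
      proof eventually_elim
        case (elim n)
        then have "s / a * real n < Q n \<omega>" by (simp add: pos_less_divide_eq)
        then show ?case by (simp add: mult.commute)
      qed
      then show ?case unfolding eventually_sequentially G_def space_block_space by blast
    qed
    then have "emeasure block_space (\<Union>N. G N) = 1"
      using G by (intro \<Omega>.emeasure_eq_1_AE) auto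
    moreover have "emeasure block_space (\<Union>N. G N) = 0" if "\<And>N. emeasure block_space (G N) = 0"
      using that G by (intro emeasure_UN_eq_0) auto
    ultimately obtain N where N: "emeasure block_space (G N) \<noteq> 0" by auto
    obtain Z where Z: "Z \<in> null_sets block_space"
      "{\<omega> \<in> space block_space. concat_blocks \<omega> \<notin> generic_points \<mu>} \<subseteq> Z"
      using AE_concat_blocks_generic unfolding eventually_ae_filter by blast
    \<comment> \<open>Removing a measurable null set that contains all non-generic concatenations
      keeps \<open>A\<close> measurable and maps it into the generic points.\<close>
    define A where "A = G N - Z"
    have "hausdorff_measure ?d s (generic_points \<mu>) \<noteq> 0"
    proof (rule mass_distribution_principle[OF prob_space_block_space _ _ _ ab(1) s(1), where A = A
          and \<Phi> = concat_blocks and N = N])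
      show "A \<in> sets block_space" using G Z by (auto simp: A_def)
      show "0 < emeasure block_space A"
        unfolding A_def using emeasure_Diff_null_set[OF Z(1) G] N by (simp add: zero_less_iff_neq_zero)
      show "concat_blocks ` A \<subseteq> generic_points \<mu>"
        using Z(2) by (auto simp: A_def space_block_space)
      fix n \<omega>' assume n: "N \<le> n" and \<omega>': "\<omega>' \<in> A"
      let ?B = "block_ball \<pi> (block_index n) (block_index (?m n)) \<omega>'"
      have "{\<omega> \<in> A. ?d (concat_blocks \<omega>) (concat_blocks \<omega>') \<le> exp (- real n / a)} \<subseteq> ?B"
      proof
        fix \<omega> assume "\<omega> \<in> {\<omega> \<in> A. ?d (concat_blocks \<omega>) (concat_blocks \<omega>') \<le> exp (- real n / a)}"
        then have d: "?d (concat_blocks \<omega>) (concat_blocks \<omega>') \<le> exp (- real n / a)" by simp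
        show "\<omega> \<in> ?B"
          using p weighted_dist_le_expD[OF ab d] by (rule mem_block_ballI)
      qed
      moreover have "emeasure block_space ?B \<le> ennreal (exp (- real n * s / a))"
      proof -
        have "real n * s / a \<le> Q n \<omega>'" using n \<omega>' by (simp add: A_def G_def)
        then have "ennreal (exp (- Q n \<omega>')) \<le> ennreal (exp (- real n * s / a))"
          by (intro ennreal_leI) simp
        with ball_prob[of "block_index n" "block_index (?m n)" \<omega>'] show ?thesis
          unfolding Q_def by (rule order_trans)
      qed
      ultimately show "\<exists>B\<in>sets block_space.
          {\<omega> \<in> A. ?d (concat_blocks \<omega>) (concat_blocks \<omega>') \<le> exp (- real n / a)} \<subseteq> B \<and>
          emeasure block_space B \<le> ennreal (exp (- real n * s / a))"
        using ball_meas by blast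
    qed
    with s(2) show False by simp
  qed
  then have "ereal s0 \<le> hausdorff_dim ?d (generic_points \<mu>)"
    unfolding hausdorff_dim_def by (intro Inf_greatest) auto
  then show ?thesis by (simp add: s0_def)
qed

lemma (in shift_system) generic_points_nonempty: "generic_points \<mu> \<noteq> {}"
proof
  interpret \<Omega>: prob_space block_space by (rule prob_space_block_space)
  assume "generic_points \<mu> = {}"
  then have "AE \<omega> in block_space. False" using AE_concat_blocks_generic by simp
  then show False by simp
qed

theorem theorem1p7:
  fixes \<pi> :: "(nat \<Rightarrow> 'a::finite) \<Rightarrow> (nat \<Rightarrow> 'd::finite)"
    and a b :: real
    and \<mu> :: "(nat \<Rightarrow> 'a) measure"
  assumes "one_block_factor_map \<pi>"
    and "a > 0" and "b \<ge> 0"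
    and "\<mu> \<in> invariant_measures"
  shows "generic_points \<mu> \<noteq> {} \<and>
    hausdorff_dim (weighted_dist \<pi> a b) (generic_points \<mu>) =
      ereal a * measure_entropy \<mu> left_shift +
      ereal b * measure_entropy (distr \<mu> shift_borel \<pi>) left_shift"
proof -
  interpret shift_system \<mu> using assms(4) by (simp add: shift_system_iff)
  interpret \<nu>: shift_system "distr \<mu> shift_borel \<pi>" using assms(1) by (rule shift_system_factor)
  have "hausdorff_dim (weighted_dist \<pi> a b) (generic_points \<mu>)
      = ereal (a * word_entropy_rate + b * \<nu>.word_entropy_rate)"
    using hausdorff_dim_generic_points_le[OF assms(1-3)] hausdorff_dim_generic_points_ge[OF assms(1-3)]
    by (rule antisym)
  then show ?thesis
    by (simp add: generic_points_nonempty measure_entropy_eq \<nu>.measure_entropy_eq)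
qed

end
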